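(* (a) Let $(T/\!\sim,\{P_i\}_{i=1}^p,\{V_j\}_{j=1}^q)$ be a triple (see context). Let $\Gamma$ be the algebra generated by $P_1,\dots,P_p$ and all matrices $E_{\mathcal I}=\sum_{j\in\mathcal I}e_{jj}$ ($\mathcal I\in T/\!\sim$), and let $\mathcal M$ be the smallest subspace of $k^{t\times t}$ containing $V_1,\dots,V_q$ and closed under left and right multiplication by $P_1,\dots,P_p$. Then $\Gamma$ is a basic matrix algebra whose associated equivalence relation is $\sim$, $\Gamma\mathcal M\subset\mathcal M$, $\mathcal M\Gamma\subset\mathcal M$, and for every step-sequence $\underline n$: $\mathcal M^{\rm tr}_{\underline n\times\underline n}=\mathcal M_{\underline n\times\underline n}$, and two matrices of this space are triple-equivalent if and only if they are $\Gamma_{\underline n\times\underline n}$-similar. (b) Conversely, let $(\Gamma,\mathcal M)$ be a linear matrix problem with $\Gamma\subset k^{t\times t}$, let $\mathcal I_1,\dots,\mathcal I_r$ be the classes of the equivalence relation of $\Gamma$, $E_\alpha=\sum_{i\in\mathcal I_\alpha}e_{ii}$, and $\mathcal R$ the set of matrices of $\Gamma$ with zero diagonal. Let $\{P_i\}_{i=1}^p$ be the union of bases of the spaces $E_\alpha\mathcal R E_\beta$ and $\{V_j\}_{j=1}^q$ the union of bases of the spaces $E_\alpha\mathcal M E_\beta$ ($1\le\alpha,\beta\le r$). Then $(\{\mathcal I_1,\dots,\mathcal I_r\},\{P_i\},\{V_j\})$ is a triple, and for every step-sequence $\underline n$: $\mathcal M^{\rm tr}_{\underline n\times\underline n}=\mathcal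 M_{\underline n\times\underline n}$, and two matrices of this space are triple-equivalent if and only if they are $\Gamma_{\underline n\times\underline n}$-similar.
   Context: $k$ is an algebraically closed field; $e_{ij}$ denotes a matrix unit. Let $\sim$ be an equivalence relation on $T=\{1,\dots,t\}$. A $t\times t$ matrix $A=[a_{ij}]$ links a class $\mathcal I$ to a class $\mathcal J$ if $a_{ij}\neq0$ implies $(i,j)\in\mathcal I\times\mathcal J$. A step-sequence is $\underline n=(n_1,\dots,n_t)$, $n_i\ge0$, with $n_i=n_j$ whenever $i\sim j$; an $\underline n\times\underline n$ matrix is $M=[M_{ij}]$ with blocks $M_{ij}\in k^{n_i\times n_j}$. For $A$ linking $\mathcal I$ to $\mathcal J$ and $(l,r)\in\{1,\dots,n_i\}\times\{1,\dots,n_j\}$ ($(i,j)\in\mathcal I\times\mathcal J$), $A^{[l,r]}$ is the $\underline n\times\underline n$ matrix obtained from $A$ by replacing each $a_{ij}$ by the $n_i\times n_j$ block that is $0$ if $a_{ij}=0$ and otherwise has $(l,r)$ entry $a_{ij}$ and all other entries $0$. A triple $(T/\!\sim,\{P_i\}_{i=1}^p,\{V_j\}_{j=1}^q)$ consists of the set of classes of $\sim$, a finite (possibly empty) set of nilpotent upper triangular matrices $P_i\in k^{t\times t}$ each linking some class to some class, and a finite set of matrices $V_j\in k^{t\times t}$ each linking some class to some class. Let $\mathcal P$ be the set of all products of the $P_i$ and $\mathcal V=\{PV_jP'\mid P,P'\in\{I_t\}\cup\mathcal P,1\le j\le q\}$. For a step-sequence $\underline n$, $\mathcal M^{\rm tr}_{\underline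 n\times\underline n}$ is the span of all $V^{[l,r]}$ with $0\ne V\in\mathcal V$. Two matrices of $\mathcal M^{\rm tr}_{\underline n\times\underline n}$ are triple-equivalent if one is obtained from the other by a finite sequence of transformations: (i) $M\mapsto S^{-1}MS$, where for a class $\mathcal I$ and an elementary invertible matrix $E$ of the common size $n_i$ ($i\in\mathcal I$), $S$ is block-diagonal with $S_{ii}=E$ for $i\in\mathcal I$ and $S_{ii}=I$ otherwise; (ii) $M\mapsto(I+aP^{[l,r]})^{-1}M(I+aP^{[l,r]})$ with $a\in k$, $0\ne P\in\mathcal P$. A basic matrix algebra is a subalgebra $\Gamma\subset k^{t\times t}$ (containing $I_t$) of upper triangular matrices such that the diagonal part of each element of $\Gamma$ lies in $\Gamma$; its diagonal matrices are spanned by 0–1 idempotents $E_\alpha=\sum_{i\in\mathcal I_\alpha}e_{ii}$ with $\sum E_\alpha=I$, and the classes $\mathcal I_\alpha$ define its equivalence relation; $\Gamma$ is the set of upper triangular $[s_{ij}]$ with $s_{ii}=s_{jj}$ for $i,j$ in the same class and whose entries satisfy certain linear systems $\sum_{\mathcal I\ni i<j\in\mathcal J}c^{(l)}_{ij}x_{ij}=0$, one system per pair of classes. A linear matrix problem is a pair $(\Gamma,\mathcal M)$, $\Gamma$ a basic $t\times t$ algebra, $\mathcal M\subset k^{t\times t}$ a subspace with $\Gamma\mathcal M\subset\mathcal M$, $\mathcal M\Gamma\subset\mathcal M$; $\mathcal M$ is the solution space of a linear system whose equations each involve only entries $x_{ij}$, $(i,j)\in\mathcal I\times\mathcal J$,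 for one pair of classes. For a step-sequence $\underline n$, $\Gamma_{\underline n\times\underline n}$ is the algebra of upper block-triangular $\underline n\times\underline n$ matrices $S$ with $S_{ii}=S_{jj}$ for equivalent $i,j$ and whose blocks satisfy the same equations $\sum c^{(l)}_{ij}S_{ij}=0$; $\mathcal M_{\underline n\times\underline n}$ is the space of $\underline n\times\underline n$ matrices whose blocks satisfy the equations defining $\mathcal M$. $M,N$ are $\Gamma_{\underline n\times\underline n}$-similar if $N=S^{-1}MS$ with $S$ invertible in $\Gamma_{\underline n\times\underline n}$. *)

theory Defs
  imports Main "HOL-Computational_Algebra.Polynomial"
begin

text \<open>Conventions. The index set T = {1..t} is rendered as {0..<t}.
  A t x t matrix over the field is a function nat => nat => 'a that vanishes
  outside {0..<t} x {0..<t}. An n x n block matrix (n a step-sequence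
  n :: nat => nat) is a function on pairs: entry ((i,l),(j,r)) is the
  (l,r) entry of the block M_ij, with l < n i, r < n j (0-based), and
  it vanishes outside that index range.\<close>

type_synonym 'a mat = "nat \<Rightarrow> nat \<Rightarrow> 'a"
type_synonym 'a bmat = "nat \<times> nat \<Rightarrow> nat \<times> nat \<Rightarrow> 'a"

definition lspan :: "('b \<Rightarrow> 'c \<Rightarrow> 'a::field) set \<Rightarrow> ('b \<Rightarrow> 'c \<Rightarrow> 'a) set" where
  "lspan S = {A. \<exists>F c. finite F \<and> F \<subseteq> S \<and> A = (\<lambda>x y. \<Sum>v\<in>F. c v * v x y)}"

definition lin_indep :: "('b \<Rightarrow> 'c \<Rightarrow> 'a::field) set \<Rightarrow> bool" where
  "lin_indep S \<longleftrightarrow> finite S \<and>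
     (\<forall>c. (\<lambda>x y. \<Sum>v\<in>S. c v * v x y) = (\<lambda>x y. 0) \<longrightarrow> (\<forall>v\<in>S. c v = 0))"

definition is_basis :: "('b \<Rightarrow> 'c \<Rightarrow> 'a::field) set \<Rightarrow> ('b \<Rightarrow> 'c \<Rightarrow> 'a) set \<Rightarrow> bool" where
  "is_basis B W \<longleftrightarrow> B \<subseteq> W \<and> lin_indep B \<and> lspan B = W"

definition wf :: "nat \<Rightarrow> 'a::zero mat \<Rightarrow> bool" where
  "wf t A \<longleftrightarrow> (\<forall>i j. (t \<le> i \<or> t \<le> j) \<longrightarrow> A i j = 0)"

definition mmult :: "nat \<Rightarrow> 'a::comm_ring_1 mat \<Rightarrow> 'a mat \<Rightarrow> 'a mat" where
  "mmult t A B = (\<lambda>i j. if i < t \<and> j < t then (\<Sum>k<t. A i k * B k j) else 0)"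

definition mone :: "nat \<Rightarrow> 'a::comm_ring_1 mat" where
  "mone t = (\<lambda>i j. if i = j \<and> i < t then 1 else 0)"

primrec mpow :: "nat \<Rightarrow> 'a::comm_ring_1 mat \<Rightarrow> nat \<Rightarrow> 'a mat" where
  "mpow t A 0 = mone t"
| "mpow t A (Suc m) = mmult t (mpow t A m) A"

definition upper_tri :: "'a::zero mat \<Rightarrow> bool" where
  "upper_tri A \<longleftrightarrow> (\<forall>i j. A i j \<noteq> 0 \<longrightarrow> i \<le> j)"

definition nilpotent :: "nat \<Rightarrow> 'a::comm_ring_1 mat \<Rightarrow> bool" where
  "nilpotent t A \<longleftrightarrow> (\<exists>m. mpow t A m = (\<lambda>i j. 0))"

definition diag_part :: "'a::zero mat \<Rightarrow> 'a mat" where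
  "diag_part A = (\<lambda>i j. if i = j then A i j else 0)"

definition is_diagonal :: "'a::zero mat \<Rightarrow> bool" where
  "is_diagonal A \<longleftrightarrow> (\<forall>i j. i \<noteq> j \<longrightarrow> A i j = 0)"

definition eidem :: "nat set \<Rightarrow> 'a::comm_ring_1 mat" where
  "eidem I = (\<lambda>i j. if i = j \<and> i \<in> I then 1 else 0)"

definition classes :: "nat \<Rightarrow> (nat \<times> nat) set \<Rightarrow> nat set set" where
  "classes t R = {..<t} // R"

definition links :: "nat set \<Rightarrow> nat set \<Rightarrow> 'a::zero mat \<Rightarrow> bool" where
  "links I J A \<longleftrightarrow> (\<forall>i j. A i j \<noteq> 0 \<longrightarrow> i \<in> I \<and> j \<in> J)"

definition links_some :: "nat \<Rightarrow> (nat \<times> nat) set \<Rightarrow> 'a::zero mat \<Rightarrow> bool" where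
  "links_some t R A \<longleftrightarrow> (\<exists>I\<in>classes t R. \<exists>J\<in>classes t R. links I J A)"

definition msubspace :: "nat \<Rightarrow> 'a::field mat set \<Rightarrow> bool" where
  "msubspace t S \<longleftrightarrow> S \<subseteq> {A. wf t A} \<and> (\<lambda>i j. 0) \<in> S \<and>
     (\<forall>A\<in>S. \<forall>B\<in>S. (\<lambda>i j. A i j + B i j) \<in> S) \<and>
     (\<forall>c. \<forall>A\<in>S. (\<lambda>i j. c * A i j) \<in> S)"

definition msubalg :: "nat \<Rightarrow> 'a::field mat set \<Rightarrow> bool" where
  "msubalg t S \<longleftrightarrow> msubspace t S \<and> mone t \<in> S \<and> (\<forall>A\<in>S. \<forall>B\<in>S. mmult t A B \<in> S)"

definition gen_alg :: "nat \<Rightarrow> 'a::field mat set \<Rightarrow> 'a mat set" where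
  "gen_alg t G = \<Inter>{A. msubalg t A \<and> G \<subseteq> A}"

definition gen_bimod :: "nat \<Rightarrow> 'a::field mat set \<Rightarrow> 'a mat set \<Rightarrow> 'a mat set" where
  "gen_bimod t Ps Vs = \<Inter>{S. msubspace t S \<and> Vs \<subseteq> S \<and>
      (\<forall>P\<in>Ps. \<forall>X\<in>S. mmult t P X \<in> S \<and> mmult t X P \<in> S)}"

definition basic_alg :: "nat \<Rightarrow> 'a::field mat set \<Rightarrow> bool" where
  "basic_alg t \<Gamma> \<longleftrightarrow> msubalg t \<Gamma> \<and> (\<forall>S\<in>\<Gamma>. upper_tri S) \<and> (\<forall>S\<in>\<Gamma>. diag_part S \<in> \<Gamma>)"

definition alg_rel :: "nat \<Rightarrow> 'a::field mat set \<Rightarrow> (nat \<times> nat) set \<Rightarrow> bool" where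
  "alg_rel t \<Gamma> R \<longleftrightarrow> equiv {..<t} R \<and>
     {D\<in>\<Gamma>. is_diagonal D} = lspan {eidem I | I. I \<in> classes t R}"

definition set_mult :: "nat \<Rightarrow> 'a::field mat set \<Rightarrow> 'a mat set \<Rightarrow> 'a mat set" where
  "set_mult t A B = {mmult t X Y | X Y. X \<in> A \<and> Y \<in> B}"

definition lmp :: "nat \<Rightarrow> 'a::field mat set \<Rightarrow> 'a mat set \<Rightarrow> (nat \<times> nat) set \<Rightarrow> bool" where
  "lmp t \<Gamma> M R \<longleftrightarrow> basic_alg t \<Gamma> \<and> alg_rel t \<Gamma> R \<and> msubspace t M \<and>
     set_mult t \<Gamma> M \<subseteq> M \<and> set_mult t M \<Gamma> \<subseteq> M \<and>
     (\<exists>Eqs. finite Eqs \<and>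
        (\<forall>c\<in>Eqs. \<exists>I\<in>classes t R. \<exists>J\<in>classes t R. links I J c) \<and>
        M = {A. wf t A \<and> (\<forall>c\<in>Eqs. (\<Sum>i<t. \<Sum>j<t. c i j * A i j) = 0)})"

inductive_set prods :: "nat \<Rightarrow> 'a::comm_ring_1 mat set \<Rightarrow> 'a mat set" for t Ps where
  base: "P \<in> Ps \<Longrightarrow> P \<in> prods t Ps"
| step: "P \<in> prods t Ps \<Longrightarrow> Q \<in> Ps \<Longrightarrow> mmult t P Q \<in> prods t Ps"

definition Vset :: "nat \<Rightarrow> 'a::comm_ring_1 mat set \<Rightarrow> 'a mat set \<Rightarrow> 'a mat set" where
  "Vset t Ps Vs = {mmult t (mmult t P V) P' | P V P'.
      P \<in> insert (mone t) (prods t Ps) \<and> V \<in> Vs \<and> P' \<in> insert (mone t) (prods t Ps)}"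

definition triple :: "nat \<Rightarrow> (nat \<times> nat) set \<Rightarrow> 'a::field mat set \<Rightarrow> 'a mat set \<Rightarrow> bool" where
  "triple t R Ps Vs \<longleftrightarrow> equiv {..<t} R \<and> finite Ps \<and> finite Vs \<and>
     (\<forall>P\<in>Ps. wf t P \<and> upper_tri P \<and> nilpotent t P \<and> links_some t R P) \<and>
     (\<forall>V\<in>Vs. wf t V \<and> links_some t R V)"

definition step_seq :: "nat \<Rightarrow> (nat \<times> nat) set \<Rightarrow> (nat \<Rightarrow> nat) \<Rightarrow> bool" where
  "step_seq t R n \<longleftrightarrow> (\<forall>i j. (i, j) \<in> R \<longrightarrow> n i = n j)"

definition bidx :: "nat \<Rightarrow> (nat \<Rightarrow> nat) \<Rightarrow> (nat \<times> nat) set" where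
  "bidx t n = {(i, l). i < t \<and> l < n i}"

definition bwf :: "nat \<Rightarrow> (nat \<Rightarrow> nat) \<Rightarrow> 'a::zero bmat \<Rightarrow> bool" where
  "bwf t n A \<longleftrightarrow> (\<forall>x y. (x \<notin> bidx t n \<or> y \<notin> bidx t n) \<longrightarrow> A x y = 0)"

definition bmult :: "nat \<Rightarrow> (nat \<Rightarrow> nat) \<Rightarrow> 'a::comm_ring_1 bmat \<Rightarrow> 'a bmat \<Rightarrow> 'a bmat" where
  "bmult t n A B = (\<lambda>x y. if x \<in> bidx t n \<and> y \<in> bidx t n
      then (\<Sum>z\<in>bidx t n. A x z * B z y) else 0)"

definition bone :: "nat \<Rightarrow> (nat \<Rightarrow> nat) \<Rightarrow> 'a::comm_ring_1 bmat" where
  "bone t n = (\<lambda>x y. if x = y \<and> x \<in> bidx t n then 1 else 0)"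

definition lr_ok :: "nat \<Rightarrow> (nat \<times> nat) set \<Rightarrow> (nat \<Rightarrow> nat) \<Rightarrow> 'a::zero mat \<Rightarrow> nat \<Rightarrow> nat \<Rightarrow> bool" where
  "lr_ok t R n A l r \<longleftrightarrow> (\<exists>I\<in>classes t R. \<exists>J\<in>classes t R.
      links I J A \<and> (\<forall>i\<in>I. l < n i) \<and> (\<forall>j\<in>J. r < n j))"

definition bup :: "nat \<Rightarrow> (nat \<Rightarrow> nat) \<Rightarrow> 'a::zero mat \<Rightarrow> nat \<Rightarrow> nat \<Rightarrow> 'a bmat" where
  "bup t n A l r = (\<lambda>(i, l') (j, r'). if (i, l') \<in> bidx t n \<and> (j, r') \<in> bidx t n
      \<and> l' = l \<and> r' = r then A i j else 0)"

definition Mtr :: "nat \<Rightarrow> (nat \<times> nat) set \<Rightarrow> 'a::field mat set \<Rightarrow> 'a mat set \<Rightarrow> (nat \<Rightarrow> nat) \<Rightarrow> 'a bmat set" where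
  "Mtr t R Ps Vs n = lspan {bup t n V l r | V l r.
      V \<in> Vset t Ps Vs \<and> V \<noteq> (\<lambda>i j. 0) \<and> lr_ok t R n V l r}"

definition elementary :: "nat \<Rightarrow> 'a::field mat \<Rightarrow> bool" where
  "elementary m E \<longleftrightarrow>
     (\<exists>l r a. l < m \<and> r < m \<and> l \<noteq> r \<and>
        E = (\<lambda>x y. mone m x y + (if x = l \<and> y = r then a else 0))) \<or>
     (\<exists>l r. l < m \<and> r < m \<and> l \<noteq> r \<and>
        E = (\<lambda>x y. if x < m \<and> y < m \<and>
               y = (if x = l then r else if x = r then l else x) then 1 else 0)) \<or>
     (\<exists>l a. l < m \<and> a \<noteq> 0 \<and>
        E = (\<lambda>x y. if x = y \<and> x < m then (if x = l then a else 1) else 0))"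

definition blockdiag :: "nat \<Rightarrow> (nat \<Rightarrow> nat) \<Rightarrow> nat set \<Rightarrow> 'a::comm_ring_1 mat \<Rightarrow> 'a bmat" where
  "blockdiag t n I E = (\<lambda>(i, l) (j, r). if (i, l) \<in> bidx t n \<and> (j, r) \<in> bidx t n \<and> i = j
      then (if i \<in> I then E l r else (if l = r then 1 else 0)) else 0)"

definition sim_by :: "nat \<Rightarrow> (nat \<Rightarrow> nat) \<Rightarrow> 'a::comm_ring_1 bmat \<Rightarrow> 'a bmat \<Rightarrow> 'a bmat \<Rightarrow> bool" where
  "sim_by t n S M N \<longleftrightarrow> (\<exists>S'. bmult t n S' S = bone t n \<and> bmult t n S S' = bone t n \<and>
      N = bmult t n (bmult t n S' M) S)"

definition tstep :: "nat \<Rightarrow> (nat \<times> nat) set \<Rightarrow> 'a::field mat set \<Rightarrow> (nat \<Rightarrow> nat) \<Rightarrow> 'a bmat \<Rightarrow> 'a bmat \<Rightarrow> bool" where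
  "tstep t R Ps n M N \<longleftrightarrow>
     (\<exists>I\<in>classes t R. \<exists>m E. (\<forall>i\<in>I. n i = m) \<and> elementary m E \<and>
        sim_by t n (blockdiag t n I E) M N) \<or>
     (\<exists>a P l r. P \<in> prods t Ps \<and> P \<noteq> (\<lambda>i j. 0) \<and> lr_ok t R n P l r \<and>
        sim_by t n (\<lambda>x y. bone t n x y + a * bup t n P l r x y) M N)"

definition triple_equiv :: "nat \<Rightarrow> (nat \<times> nat) set \<Rightarrow> 'a::field mat set \<Rightarrow> (nat \<Rightarrow> nat) \<Rightarrow> 'a bmat \<Rightarrow> 'a bmat \<Rightarrow> bool" where
  "triple_equiv t R Ps n M N \<longleftrightarrow> (tstep t R Ps n)\<^sup>*\<^sup>* M N \<or> (tstep t R Ps n)\<^sup>*\<^sup>* N M"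

definition gamma_eq :: "nat \<Rightarrow> 'a::field mat set \<Rightarrow> (nat \<times> nat) set \<Rightarrow> 'a mat \<Rightarrow> bool" where
  "gamma_eq t \<Gamma> R c \<longleftrightarrow> (\<exists>I\<in>classes t R. \<exists>J\<in>classes t R.
       \<forall>i j. c i j \<noteq> 0 \<longrightarrow> i \<in> I \<and> j \<in> J \<and> i < j) \<and>
     (\<forall>S\<in>\<Gamma>. (\<Sum>i<t. \<Sum>j<t. c i j * S i j) = 0)"

definition Gamma_n :: "nat \<Rightarrow> 'a::field mat set \<Rightarrow> (nat \<times> nat) set \<Rightarrow> (nat \<Rightarrow> nat) \<Rightarrow> 'a bmat set" where
  "Gamma_n t \<Gamma> R n = {S. bwf t n S \<and>
      (\<forall>i l j r. j < i \<longrightarrow> S (i, l) (j, r) = 0) \<and>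
      (\<forall>i j l r. (i, j) \<in> R \<longrightarrow> S (i, l) (i, r) = S (j, l) (j, r)) \<and>
      (\<forall>c. gamma_eq t \<Gamma> R c \<longrightarrow>
         (\<forall>l r. (\<Sum>i<t. \<Sum>j<t. c i j * S (i, l) (j, r)) = 0))}"

definition M_eq :: "nat \<Rightarrow> 'a::field mat set \<Rightarrow> (nat \<times> nat) set \<Rightarrow> 'a mat \<Rightarrow> bool" where
  "M_eq t M R c \<longleftrightarrow> (\<exists>I\<in>classes t R. \<exists>J\<in>classes t R. links I J c) \<and>
     (\<forall>A\<in>M. (\<Sum>i<t. \<Sum>j<t. c i j * A i j) = 0)"

definition M_n :: "nat \<Rightarrow> 'a::field mat set \<Rightarrow> (nat \<times> nat) set \<Rightarrow> (nat \<Rightarrow> nat) \<Rightarrow> 'a bmat set" where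
  "M_n t M R n = {A. bwf t n A \<and>
      (\<forall>c. M_eq t M R c \<longrightarrow> (\<forall>l r. (\<Sum>i<t. \<Sum>j<t. c i j * A (i, l) (j, r)) = 0))}"

definition Gamma_similar :: "nat \<Rightarrow> 'a::field mat set \<Rightarrow> (nat \<times> nat) set \<Rightarrow> (nat \<Rightarrow> nat) \<Rightarrow> 'a bmat \<Rightarrow> 'a bmat \<Rightarrow> bool" where
  "Gamma_similar t \<Gamma> R n M N \<longleftrightarrow> (\<exists>S\<in>Gamma_n t \<Gamma> R n. \<exists>S'\<in>Gamma_n t \<Gamma> R n.
      bmult t n S' S = bone t n \<and> bmult t n S S' = bone t n \<and>
      N = bmult t n (bmult t n S' M) S)"

end

theory Submission
  imports Defs "HOL-Library.Function_Algebras"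
begin

text \<open>
  A subspace spanned by matrices that each link a class to a class equals, by double annihilators,
  the solution space of the class-to-class equations vanishing on it. Applied slice by slice to a
  block matrix, this identifies \<open>M_n\<close> with the span of the \<open>V\<^bsup>[l,r]\<^esup>\<close>, and \<open>Gamma_n\<close> with the
  span of the blow-ups of the idempotents and of the products of the \<open>P\<^sub>i\<close>. As blowing up is
  compatible with products, \<open>Gamma_n\<close> is an algebra, namely block-diagonal part plus nilpotent radical.

  An invertible \<open>S\<close> in \<open>Gamma_n\<close> factors as \<open>A (1 + N)\<close> with \<open>A\<close> block-diagonal and \<open>N\<close> in the
  radical. By Gaussian elimination in each class \<open>A\<close> is a product of matrices of transformations (i).
  The radical is filtered by the length of products of the \<open>P\<^sub>i\<close>; modulo the next layer \<open>1 + N\<close> is a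
  product of factors \<open>1 + a P\<^bsup>[l,r]\<^esup>\<close>, and the filtration reaches zero, so \<open>1 + N\<close> is a product of
  matrices of transformations (ii).

  For the converse construction, the chosen bases generate the given algebra and bimodule, which
  reduces it to the first part.
\<close>

section \<open>Matrices over a finite index set\<close>

text \<open>\<open>Gamma_n\<close> and \<open>M_n\<close> are given by equations, the
  transformations by generators. What makes the two sides meet is linking: every generator lives in
  one class-to-class block, so a functional separating a block from the span of the generators can
  be chosen inside that block, and is then itself an admissible equation. Linking also makes the
  generators closed under multiplication up to zero. The equations of \<open>Gamma_n\<close> see
  strictly upper positions only, so diagonal blocks are treated apart, through their equality within
  a class; the predicate \<open>Q\<close> below separates the cases. The filtration is needed
  because (1 + N)(1 + N') differs from 1 + N + N' by N N': a sum in the radical becomes a product of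
  factors only up to longer products. Finally, the inverse in \<open>sim_by\<close> is an arbitrary
  function, while \<open>Gamma_similar\<close> wants one in \<open>Gamma_n\<close>; so every
  transforming matrix must be given an inverse in \<open>Gamma_n\<close>, and all inverses must be
  seen to act alike.\<close>

definition scl :: "'a::field \<Rightarrow> ('b \<Rightarrow> 'c \<Rightarrow> 'a) \<Rightarrow> 'b \<Rightarrow> 'c \<Rightarrow> 'a" where
  "scl c A = (\<lambda>x y. c * A x y)"

lemma scl_apply [simp]: "scl c A x y = c * A x y"
  by (simp add: scl_def)

text \<open>Addition of functions is pointwise and the index types stay arbitrary, so one vector
  space serves both \<open>mat\<close> and \<open>bmat\<close>.\<close>

global_interpretation mat_vs: vector_space "scl :: 'a::field \<Rightarrow> ('b \<Rightarrow> 'c \<Rightarrow> 'a) \<Rightarrow> _"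
  by unfold_locales (auto simp: fun_eq_iff algebra_simps)

lemma sum_apply2: "(\<Sum>v\<in>F. f v) x y = (\<Sum>v\<in>F. f v x y)"
  by (induction F rule: infinite_finite_induct) auto

lemma lspan_eq_span: "lspan S = mat_vs.span (S :: ('b \<Rightarrow> 'c \<Rightarrow> 'a::field) set)"
proof -
  have "(\<Sum>v\<in>F. scl (c v) v) = (\<lambda>x y. \<Sum>v\<in>F. c v * v x y)"
    for F and c :: "('b \<Rightarrow> 'c \<Rightarrow> 'a) \<Rightarrow> 'a"
    by (auto simp: fun_eq_iff sum_apply2)
  then have "mat_vs.span S = {A. \<exists>F c. (finite F \<and> F \<subseteq> S) \<and> A = (\<lambda>x y. \<Sum>v\<in>F. c v * v x y)}"
    unfolding mat_vs.span_explicit by (simp only: conj_commute)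
  then show ?thesis by (simp only: lspan_def conj_assoc)
qed

lemma zero_mat_eq: "(\<lambda>x y. 0) = 0"
  by (simp add: fun_eq_iff)

lemma msubspace_iff: "msubspace t S \<longleftrightarrow> mat_vs.subspace S \<and> (\<forall>A\<in>S. wf t A)"
proof -
  have "(\<lambda>i j. A i j + B i j) = A + B" "(\<lambda>i j. c * A i j) = scl c A"
    for A B :: "'a mat" and c :: 'a
    by (auto simp: fun_eq_iff)
  then show ?thesis
    unfolding msubspace_def mat_vs.subspace_def zero_mat_eq by auto
qed

text \<open>Linearity is asked for as one bare identity, so that multiplication by a fixed matrix or
  a blow-up can serve as \<open>f\<close> with the obligations left to simp.\<close>

lemma span_image_mem:
  assumes "x \<in> mat_vs.span X" and "f 0 = 0"
    and "\<And>c x y. f (scl c x + y) = scl c (f x) + f y"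
    and "\<And>x. x \<in> X \<Longrightarrow> f x \<in> mat_vs.span Y"
  shows "f x \<in> mat_vs.span Y"
proof (rule mat_vs.span_induct_alt[OF assms(1), where h = "\<lambda>x. f x \<in> mat_vs.span Y"])
  show "f 0 \<in> mat_vs.span Y"
    by (simp add: assms(2) mat_vs.span_zero)
  show "f (scl c x + y) \<in> mat_vs.span Y" if "x \<in> X" "f y \<in> mat_vs.span Y" for c x y
    using that by (simp add: assms(3,4) mat_vs.span_add mat_vs.span_scale)
qed

text \<open>A basis of the span of \<open>X\<close> stays independent when \<open>a\<close> is
  added, so some linear functional is 1 at \<open>a\<close> and 0 on the basis; its values on matrix
  units are the coefficients. Keeping them inside \<open>D\<close> is what later makes the
  functional an admissible equation.\<close>

lemma separating_functional:
  fixes X :: "('b \<Rightarrow> 'c \<Rightarrow> 'a::field) set"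
  assumes "finite D"
    and X: "\<forall>x\<in>X. \<forall>i j. x i j \<noteq> 0 \<longrightarrow> (i, j) \<in> D"
    and a: "\<forall>i j. a i j \<noteq> 0 \<longrightarrow> (i, j) \<in> D"
    and notin: "a \<notin> mat_vs.span X"
  shows "\<exists>c. (\<forall>i j. c i j \<noteq> 0 \<longrightarrow> (i, j) \<in> D) \<and>
    (\<forall>x\<in>X. (\<Sum>(i, j)\<in>D. c i j * x i j) = 0) \<and> (\<Sum>(i, j)\<in>D. c i j * a i j) \<noteq> 0"
proof -
  have "vector_space_pair (scl :: 'a \<Rightarrow> ('b \<Rightarrow> 'c \<Rightarrow> 'a) \<Rightarrow> _) ((*) :: 'a \<Rightarrow> 'a \<Rightarrow> 'a)"
    by unfold_locales (auto simp: algebra_simps)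
  note extend = vector_space_pair.linear_independent_extend[OF this]
  obtain B where B: "B \<subseteq> X" "mat_vs.independent B" "X \<subseteq> mat_vs.span B"
    by (rule mat_vs.maximal_independent_subset)
  have span: "mat_vs.span B = mat_vs.span X"
    using B by (metis mat_vs.span_mono mat_vs.span_span subset_antisym)
  have "a \<notin> B" using notin span by (metis mat_vs.span_base)
  have "mat_vs.independent (insert a B)"
    using B notin span by (simp add: mat_vs.independent_insert)
  from extend[OF this, of "\<lambda>x. if x = a then 1 else 0"]
  obtain f where f: "Vector_Spaces.linear scl (*) f"
    and f': "\<forall>x\<in>insert a B. f x = (if x = a then 1 else 0)"
    by (elim exE conjE) (rule that)
  note fB = bspec[OF f']
  interpret f: Vector_Spaces.linear scl "(*)" f by (fact f)
  have f0: "f x = 0" if "x \<in> mat_vs.span B" for x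
  proof (rule mat_vs.span_induct_alt[OF that, where h = "\<lambda>x. f x = 0"])
    show "f 0 = 0" by (rule f.zero)
    show "f (scl c x + y) = 0" if "x \<in> B" "f y = 0" for c x y
    proof -
      have "f x = 0" using that(1) fB[of x] \<open>a \<notin> B\<close> by (cases "x = a") simp_all
      then show ?thesis using that(2) by (simp only: f.add f.scale) simp
    qed
  qed
  define e :: "'b \<times> 'c \<Rightarrow> 'b \<Rightarrow> 'c \<Rightarrow> 'a" where
    "e = (\<lambda>p i j. if p = (i, j) then 1 else 0)"
  \<comment> \<open>\<open>D\<close> is finite and contains the support of \<open>x\<close>, so
    \<open>x\<close> is a finite combination of matrix units and \<open>f\<close> is determined by
    its values on them.\<close>
  have expand: "f x = (\<Sum>(i, j)\<in>D. f (e (i, j)) * x i j)"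
    if "\<And>i j. x i j \<noteq> 0 \<Longrightarrow> (i, j) \<in> D" for x
  proof -
    have "x i j = (\<Sum>p\<in>D. scl (x (fst p) (snd p)) (e p)) i j" for i j
    proof -
      have "(\<Sum>p\<in>D. scl (x (fst p) (snd p)) (e p)) i j
          = (\<Sum>p\<in>D. if p = (i, j) then x i j else 0)"
        by (auto simp: sum_apply2 e_def intro!: sum.cong)
      also have "\<dots> = x i j"
        using that[of i j] \<open>finite D\<close> by auto
      finally show ?thesis by simp
    qed
    then have "x = (\<Sum>p\<in>D. scl (x (fst p) (snd p)) (e p))"
      by (intro ext)
    then have "f x = f (\<Sum>p\<in>D. scl (x (fst p) (snd p)) (e p))"
      by (rule arg_cong)
    also have "\<dots> = (\<Sum>p\<in>D. x (fst p) (snd p) * f (e p))"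
      by (simp only: f.sum f.scale)
    finally have "f x = (\<Sum>p\<in>D. x (fst p) (snd p) * f (e p))" .
    also have "\<dots> = (\<Sum>(i, j)\<in>D. f (e (i, j)) * x i j)"
      by (intro sum.cong refl) (simp add: case_prod_beta)
    finally show ?thesis .
  qed
  define c where "c = (\<lambda>i j. if (i, j) \<in> D then f (e (i, j)) else 0)"
  have c: "(\<Sum>(i, j)\<in>D. c i j * x i j) = f x"
    if "\<And>i j. x i j \<noteq> 0 \<Longrightarrow> (i, j) \<in> D" for x
  proof -
    have "(\<Sum>(i, j)\<in>D. c i j * x i j) = (\<Sum>(i, j)\<in>D. f (e (i, j)) * x i j)"
      by (intro sum.cong) (auto simp: c_def)
    then show ?thesis using expand[OF that] by simp
  qed
  show ?thesis
  proof (intro exI[of _ c] conjI allI ballI impI)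
    show "(i, j) \<in> D" if "c i j \<noteq> 0" for i j
      using that by (auto simp: c_def split: if_splits)
    show "(\<Sum>(i, j)\<in>D. c i j * x i j) = 0" if "x \<in> X" for x
    proof -
      have "f x = 0" using that span by (intro f0) (simp add: mat_vs.span_base)
      moreover have "(\<Sum>(i, j)\<in>D. c i j * x i j) = f x"
        using that X by (intro c) simp
      ultimately show ?thesis by simp
    qed
    have "f a = 1" using fB[of a] by simp
    moreover have "(\<Sum>(i, j)\<in>D. c i j * a i j) = f a" using a by (intro c) simp
    ultimately show "(\<Sum>(i, j)\<in>D. c i j * a i j) \<noteq> 0" by simp
  qed
qed

text \<open>\<open>mmult\<close> and \<open>bmult\<close> differ only in their index sets, {..<t}
  and \<open>bidx t n\<close>; the laws of multiplication are proved once, over an arbitrary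
  \<open>D\<close>.\<close>

definition gmul :: "'i set \<Rightarrow> ('i \<Rightarrow> 'i \<Rightarrow> 'a::field) \<Rightarrow> ('i \<Rightarrow> 'i \<Rightarrow> 'a) \<Rightarrow> 'i \<Rightarrow> 'i \<Rightarrow> 'a" where
  "gmul D A B = (\<lambda>x y. if x \<in> D \<and> y \<in> D then (\<Sum>z\<in>D. A x z * B z y) else 0)"

definition gone :: "'i set \<Rightarrow> 'i \<Rightarrow> 'i \<Rightarrow> 'a::field" where
  "gone D = (\<lambda>x y. if x = y \<and> x \<in> D then 1 else 0)"

definition supp_on :: "'i set \<Rightarrow> ('i \<Rightarrow> 'i \<Rightarrow> 'a::field) \<Rightarrow> bool" where
  "supp_on D A \<longleftrightarrow> (\<forall>x y. (x \<notin> D \<or> y \<notin> D) \<longrightarrow> A x y = 0)"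

lemma mat_as_generic:
  "mmult t = gmul {..<t}" "mone t = gone {..<t}" "wf t = supp_on {..<t}"
  by (auto simp: mmult_def gmul_def mone_def gone_def wf_def supp_on_def fun_eq_iff not_less)

lemma bmat_as_generic:
  "bmult t n = gmul (bidx t n)" "bone t n = gone (bidx t n)" "bwf t n = supp_on (bidx t n)"
  by (auto simp: bmult_def gmul_def bone_def gone_def bwf_def supp_on_def fun_eq_iff)

lemma finite_bidx [simp]: "finite (bidx t n)"
proof -
  have "bidx t n = Sigma {..<t} (\<lambda>i. {..<n i})" by (auto simp: bidx_def)
  then show ?thesis by simp
qed

lemma supp_on_gmul [simp]: "supp_on D (gmul D A B)"
  by (auto simp: supp_on_def gmul_def)

lemma supp_on_gone [simp]: "supp_on D (gone D)"
  by (auto simp: supp_on_def gone_def)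

lemma supp_on_add: "supp_on D A \<Longrightarrow> supp_on D B \<Longrightarrow> supp_on D (A + B)"
  by (auto simp: supp_on_def)

lemma gmul_assoc: "gmul D (gmul D A B) C = gmul D A (gmul D B C)"
proof (intro ext)
  fix x y
  show "gmul D (gmul D A B) C x y = gmul D A (gmul D B C) x y"
  proof (cases "x \<in> D \<and> y \<in> D")
    case True
    then have "gmul D (gmul D A B) C x y = (\<Sum>z\<in>D. \<Sum>w\<in>D. A x w * B w z * C z y)"
      by (simp add: gmul_def sum_distrib_right)
    also have "\<dots> = (\<Sum>w\<in>D. \<Sum>z\<in>D. A x w * B w z * C z y)"
      by (rule sum.swap)
    also have "\<dots> = gmul D A (gmul D B C) x y"
      using True by (simp add: gmul_def sum_distrib_left mult.assoc)
    finally show ?thesis .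
  qed (auto simp: gmul_def)
qed

lemma gmul_apply: "gmul D A B x y = (if x \<in> D \<and> y \<in> D then (\<Sum>z\<in>D. A x z * B z y) else 0)"
  by (simp add: gmul_def)

lemma gmul_linear:
  "gmul D 0 B = 0" "gmul D A 0 = 0"
  "gmul D (A + A') B = gmul D A B + gmul D A' B"
  "gmul D A (B + B') = gmul D A B + gmul D A B'"
  "gmul D (A - A') B = gmul D A B - gmul D A' B"
  "gmul D A (B - B') = gmul D A B - gmul D A B'"
  "gmul D (scl c A) B = scl c (gmul D A B)" "gmul D A (scl c B) = scl c (gmul D A B)"
proof -
  show "gmul D 0 B = 0" "gmul D A 0 = 0"
    by (intro ext, simp add: gmul_apply)+
  show "gmul D (A + A') B = gmul D A B + gmul D A' B"
    "gmul D A (B + B') = gmul D A B + gmul D A B'"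
    by (intro ext, simp add: gmul_apply distrib_left distrib_right sum.distrib)+
  show "gmul D (A - A') B = gmul D A B - gmul D A' B"
    "gmul D A (B - B') = gmul D A B - gmul D A B'"
    by (intro ext, simp add: gmul_apply left_diff_distrib right_diff_distrib sum_subtractf)+
  show "gmul D (scl c A) B = scl c (gmul D A B)" "gmul D A (scl c B) = scl c (gmul D A B)"
    by (intro ext, simp add: gmul_apply sum_distrib_left mult.assoc mult.left_commute)+
qed

lemma gmul_gone_left [simp]: "finite D \<Longrightarrow> supp_on D A \<Longrightarrow> gmul D (gone D) A = A"
proof -
  assume "finite D" "supp_on D A"
  have "(\<Sum>z\<in>D. (if x = z \<and> x \<in> D then 1 else 0) * A z y) = A x y" if "x \<in> D" for x y
  proof -
    have "(\<Sum>z\<in>D. (if x = z \<and> x \<in> D then 1 else 0) * A z y) = (\<Sum>z\<in>D. if x = z then A z y else 0)"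
      using that by (intro sum.cong) auto
    then show ?thesis using \<open>finite D\<close> that by simp
  qed
  with \<open>supp_on D A\<close> show ?thesis
    by (auto simp: gmul_def gone_def supp_on_def fun_eq_iff)
qed

lemma gmul_gone_right [simp]: "finite D \<Longrightarrow> supp_on D A \<Longrightarrow> gmul D A (gone D) = A"
proof -
  assume "finite D" "supp_on D A"
  have "(\<Sum>z\<in>D. A x z * (if z = y \<and> z \<in> D then 1 else 0)) = A x y" if "y \<in> D" for x y
  proof -
    have "(\<Sum>z\<in>D. A x z * (if z = y \<and> z \<in> D then 1 else 0)) = (\<Sum>z\<in>D. if z = y then A x z else 0)"
      using that by (intro sum.cong) auto
    then show ?thesis using \<open>finite D\<close> that by simp
  qed
  with \<open>supp_on D A\<close> show ?thesis
    by (auto simp: gmul_def gone_def supp_on_def fun_eq_iff)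
qed

lemma gmul_span:
  assumes "A \<in> mat_vs.span X" "B \<in> mat_vs.span Y"
    and "\<And>x y. x \<in> X \<Longrightarrow> y \<in> Y \<Longrightarrow> gmul D x y \<in> mat_vs.span Z"
  shows "gmul D A B \<in> mat_vs.span Z"
proof -
  have "gmul D x B \<in> mat_vs.span Z" if "x \<in> X" for x
    by (intro span_image_mem[where f = "gmul D x", OF assms(2)])
      (simp_all add: gmul_linear assms(3) that)
  then show ?thesis
    by (intro span_image_mem[where f = "\<lambda>A. gmul D A B", OF assms(1)]) (simp_all add: gmul_linear)
qed

definition ginv :: "'i set \<Rightarrow> ('i \<Rightarrow> 'i \<Rightarrow> 'a::field) \<Rightarrow> ('i \<Rightarrow> 'i \<Rightarrow> 'a) \<Rightarrow> bool" where
  "ginv D A B \<longleftrightarrow> gmul D A B = gone D \<and> gmul D B A = gone D"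

lemma ginv_sym: "ginv D A B \<longleftrightarrow> ginv D B A"
  by (auto simp: ginv_def)

lemma ginv_gone [simp]: "finite D \<Longrightarrow> ginv D (gone D) (gone D)"
  by (simp add: ginv_def)

text \<open>Without a support assumption \<open>gone D\<close> acts as a projection: both sides are
  \<open>A\<close> cut down to \<open>D\<close>.\<close>

lemma gmul_gone_commute: "finite D \<Longrightarrow> gmul D (gone D) A = gmul D A (gone D)"
  by (auto simp: gmul_def gone_def fun_eq_iff if_distrib if_distribR cong: if_cong)

text \<open>The outer product reads \<open>B\<close> only on \<open>D\<close>, so cutting
  \<open>B\<close> down to \<open>D\<close> changes nothing.\<close>

lemma gmul_gone_gmul: "finite D \<Longrightarrow> gmul D A (gmul D (gone D) B) = gmul D A B"
proof -
  assume "finite D"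
  have "gmul D A (gmul D (gone D) B) = gmul D A (gmul D B (gone D))"
    by (simp add: gmul_gone_commute[OF \<open>finite D\<close>])
  also have "\<dots> = gmul D (gmul D A B) (gone D)"
    by (simp only: gmul_assoc)
  finally show ?thesis using \<open>finite D\<close> by simp
qed

lemma ginv_gmul:
  assumes "finite D" "ginv D A A'" "ginv D B B'"
  shows "ginv D (gmul D A B) (gmul D B' A')"
proof -
  have "gmul D (gmul D A B) (gmul D B' A') = gmul D A (gmul D (gmul D B B') A')"
    "gmul D (gmul D B' A') (gmul D A B) = gmul D B' (gmul D (gmul D A' A) B)"
    by (simp_all add: gmul_assoc)
  then show ?thesis using assms by (simp add: ginv_def gmul_gone_gmul)
qed

text \<open>The inverses need not be supported on \<open>D\<close>, so only their products with other matrices agree.\<close>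

lemma ginv_unique:
  assumes "finite D" "ginv D A B" "ginv D A B'"
  shows "gmul D B C = gmul D B' C"
proof -
  have "gmul D B (gone D) = gmul D B (gmul D A B')"
    using assms by (simp add: ginv_def)
  also have "\<dots> = gmul D (gmul D B A) B'"
    by (simp only: gmul_assoc)
  also have "\<dots> = gmul D (gone D) B'"
    using assms by (simp add: ginv_def)
  finally have *: "gmul D B (gone D) = gmul D (gone D) B'" .
  have "gmul D B C = gmul D (gmul D B (gone D)) C"
    by (simp add: gmul_assoc gmul_gone_gmul[OF \<open>finite D\<close>])
  also have "\<dots> = gmul D (gmul D B' (gone D)) C"
    by (simp add: * gmul_gone_commute[OF \<open>finite D\<close>])
  also have "\<dots> = gmul D B' C"
    by (simp add: gmul_assoc gmul_gone_gmul[OF \<open>finite D\<close>])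
  finally show ?thesis .
qed

section \<open>Generation by elementary matrices\<close>

text \<open>The row operation that adds \<open>a\<close> times row \<open>r\<close> to row
  \<open>l\<close>.\<close>

lemma gmul_transvection:
  assumes "finite D" "l \<in> D" "r \<in> D" "supp_on D A"
  shows "gmul D (\<lambda>x y. gone D x y + (if x = l \<and> y = r then a else 0)) A i j
    = A i j + (if i = l then a * A r j else 0)"
proof -
  have "(\<lambda>x y. gone D x y + (if x = l \<and> y = r then a else 0))
    = gone D + (\<lambda>x y. if x = l \<and> y = r then a else 0)"
    by (simp add: fun_eq_iff)
  moreover have "gmul D (\<lambda>x y. if x = l \<and> y = r then a else 0) A i j
      = (if i = l then a * A r j else 0)"
  proof (cases "i = l \<and> j \<in> D")
    case True
    have "(\<Sum>z\<in>D. (if z = r then a else 0) * A z j) = (\<Sum>z\<in>D. if z = r then a * A r j else 0)"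
      by (intro sum.cong) auto
    then show ?thesis using True assms by (simp add: gmul_apply)
  next
    case False
    then show ?thesis using assms by (auto simp: gmul_apply supp_on_def)
  qed
  ultimately show ?thesis using assms by (simp add: gmul_linear)
qed

lemma gmul_diagonal:
  assumes "finite D" "supp_on D A"
  shows "gmul D (\<lambda>x y. if x = y \<and> x \<in> D then d x else 0) A i j = d i * A i j"
proof (cases "i \<in> D \<and> j \<in> D")
  case True
  then have "gmul D (\<lambda>x y. if x = y \<and> x \<in> D then d x else 0) A i j
    = (\<Sum>z\<in>D. if z = i then d i * A i j else 0)"
    by (auto simp: gmul_apply intro!: sum.cong)
  then show ?thesis using True assms by simp
next
  case False
  then show ?thesis using assms by (auto simp: gmul_apply supp_on_def)
qed

text \<open>Inverses stay within the three kinds: the transvection with -a, the same swap, the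
  scaling by the inverse scalar. Elimination relies on this to move a row operation back to the
  other side.\<close>

lemma elementary_ginv:
  assumes "elementary m E"
  shows "supp_on {..<m} E" "\<exists>F. elementary m F \<and> ginv {..<m} E F"
proof -
  let ?D = "{..<m}"
  from assms have "supp_on ?D E \<and> (\<exists>F. elementary m F \<and> ginv ?D E F)"
    unfolding elementary_def[of m E] mat_as_generic
  proof (elim disjE exE conjE)
    fix l r a
    assume transvection: "l < m" "r < m" "l \<noteq> r"
      "E = (\<lambda>x y. gone ?D x y + (if x = l \<and> y = r then a else 0))"
    let ?T = "\<lambda>a x y. gone ?D x y + (if x = l \<and> y = r then a else 0)"
    have el: "elementary m (?T (- a))"
      unfolding elementary_def mat_as_generic using transvection(1-3) by blast
    have supp: "supp_on ?D (?T b)" for b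
      using transvection(1,2) by (auto simp: supp_on_def gone_def)
    have mult: "gmul ?D (?T b) (?T c) = ?T (b + c)" for b c
    proof (intro ext)
      fix x y
      show "gmul ?D (?T b) (?T c) x y = ?T (b + c) x y"
        using transvection(1-3) gmul_transvection[OF _ _ _ supp, of l r b c x y]
        by (auto simp: gone_def)
    qed
    have "ginv ?D E (?T (- a))"
      unfolding ginv_def transvection(4) mult by (simp add: fun_eq_iff)
    with el supp show ?thesis unfolding transvection(4) by blast
  next
    fix l r
    assume swap: "l < m" "r < m" "l \<noteq> r"
      "E = (\<lambda>x y. if x < m \<and> y < m \<and>
               y = (if x = l then r else if x = r then l else x) then 1 else 0)"
    define p where "p = (\<lambda>x. if x = l then r else if x = r then l else x)"
    have E: "E = (\<lambda>x y. if x < m \<and> y < m \<and> y = p x then 1 else 0)"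
      by (simp add: swap(4) p_def)
    have p: "p x < m" "p (p x) = x" if "x < m" for x
      using that swap(1-3) by (auto simp: p_def)
    have "gmul ?D E E x y = gone ?D x y" for x y
    proof (cases "x < m \<and> y < m")
      case True
      then have "gmul ?D E E x y = (\<Sum>z<m. E x z * E z y)"
        by (simp add: gmul_apply)
      also have "\<dots> = (\<Sum>z<m. if z = p x then (if y = x then 1 else 0) else 0)"
        using p True by (intro sum.cong) (auto simp: E)
      finally show ?thesis using True p by (simp add: gone_def)
    qed (auto simp: gmul_apply gone_def)
    then have "ginv ?D E E" by (simp add: ginv_def fun_eq_iff)
    with assms show ?thesis by (auto simp: E supp_on_def)
  next
    fix l a
    assume scale: "l < m" "a \<noteq> 0"
      "E = (\<lambda>x y. if x = y \<and> x < m then (if x = l then a else 1) else 0)"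
    let ?S = "\<lambda>a x y. if x = y \<and> x \<in> ?D then (if x = l then a else 1) else 0"
    have E: "E = ?S a" by (simp add: scale(3))
    have el: "elementary m (?S (inverse a))"
      unfolding elementary_def lessThan_iff using scale(1,2) nonzero_imp_inverse_nonzero by blast
    have supp: "supp_on ?D (?S b)" for b
      by (auto simp: supp_on_def)
    have mult: "gmul ?D (?S b) (?S c) = gone ?D" if "b * c = 1" for b c
      by (intro ext, subst gmul_diagonal) (auto simp: supp_on_def gone_def that)
    have "ginv ?D E (?S (inverse a))"
      unfolding ginv_def E using scale(2) by (intro conjI mult) simp_all
    with el supp show ?thesis unfolding E by blast
  qed
  then show "supp_on {..<m} E" "\<exists>F. elementary m F \<and> ginv {..<m} E F" by auto
qed

text \<open>Words grow on the right, as the words of block transformations in \<open>tprods\<close>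
  will, so that \<open>blockdiag_in_tprods\<close> can copy them letter by letter. Elimination
  multiplies on the left; the next lemma reconciles the two.\<close>

inductive_set elementary_products :: "nat \<Rightarrow> 'a::field mat set" for m where
  one: "gone {..<m} \<in> elementary_products m"
| step: "S \<in> elementary_products m \<Longrightarrow> elementary m E \<Longrightarrow> gmul {..<m} S E \<in> elementary_products m"

lemma elementary_gmul_elementary_products:
  assumes "S \<in> elementary_products m" "elementary m E"
  shows "gmul {..<m} E S \<in> elementary_products m"
  using assms(1)
proof (induction rule: elementary_products.induct)
  case one
  then show ?case
    using elementary_products.step[OF elementary_products.one assms(2)] elementary_ginv(1)[OF assms(2)]
    by simp
next
  case (step S F)
  then show ?case
    using elementary_products.step[of "gmul {..<m} E S" m F] by (simp add: gmul_assoc)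
qed

text \<open>A = F (E A) for the elementary inverse \<open>F\<close> of \<open>E\<close>, so a row
  operation may be performed before the factorization is sought.\<close>

lemma elementary_products_reduce:
  assumes "elementary m E" "gmul {..<m} E A \<in> elementary_products m" "supp_on {..<m} A"
  shows "A \<in> elementary_products m"
proof -
  obtain F where F: "elementary m F" "ginv {..<m} E F"
    using elementary_ginv(2)[OF assms(1)] by blast
  have "gmul {..<m} F (gmul {..<m} E A) = A"
    using F(2) assms(3) by (simp add: gmul_assoc[symmetric] ginv_def)
  then show ?thesis
    using elementary_gmul_elementary_products[OF assms(2) F(1)] by simp
qed

text \<open>One column of Gaussian elimination: make the pivot nonzero, scale it to 1, clear the
  rest of the column. The assumption \<open>next_column\<close> stands for the elimination of the
  remaining columns.\<close>

lemma elementary_products_column_step: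
  fixes A A' :: "'a::field mat"
  assumes next_column: "\<And>A A' :: 'a mat. \<lbrakk>supp_on {..<m} A; ginv {..<m} A A'; \<And>i j. j \<le> k \<Longrightarrow> A i j = gone {..<m} i j\<rbrakk>
      \<Longrightarrow> A \<in> elementary_products m"
    and k: "k < m"
    and A: "supp_on {..<m} A" "ginv {..<m} A A'" "\<And>i j. j < k \<Longrightarrow> A i j = gone {..<m} i j"
  shows "A \<in> elementary_products m"
proof -
  let ?D = "{..<m}"
  let ?T = "\<lambda>l r a x y. gone ?D x y + (if x = l \<and> y = r then a else 0)"
  have el_T: "elementary m (?T l r a)" if "l < m" "r < m" "l \<noteq> r" for l r a
    unfolding elementary_def mat_as_generic using that by blast
  have inv: "\<exists>B'. ginv ?D (gmul ?D E B) B'" if "elementary m E" "ginv ?D B B'" for E B B' :: "'a mat"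
    using elementary_ginv(2)[OF that(1)] ginv_gmul[OF _ _ that(2)] by blast
  \<comment> \<open>Induction on the number of nonzero entries of column \<open>k\<close> away from
    the pivot; each row operation removes one of them.\<close>
  have clear: "B \<in> elementary_products m"
    if "supp_on ?D B" "\<exists>B'. ginv ?D B B'" "\<And>i j. j < k \<Longrightarrow> B i j = gone ?D i j" "B k k = 1" for B :: "'a mat"
    using that
  proof (induction "card {i. i < m \<and> i \<noteq> k \<and> B i k \<noteq> 0}" arbitrary: B rule: less_induct)
    case less
    show ?case
    proof (cases "\<exists>i<m. i \<noteq> k \<and> B i k \<noteq> 0")
      case False
      obtain B' where B': "ginv ?D B B'" using less.prems(2) by blast
      have "B i j = gone ?D i j" if "j \<le> k" for i j
        using that False less.prems(1,3,4) k
        by (cases "j < k") (auto simp: supp_on_def gone_def not_less)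
      then show ?thesis by (rule next_column[OF less.prems(1) B'])
    next
      case True
      then obtain i where i: "i < m" "i \<noteq> k" "B i k \<noteq> 0" by blast
      define C where "C = gmul ?D (?T i k (- B i k)) B"
      have C: "C x y = B x y + (if x = i then - B i k * B k y else 0)" for x y
        unfolding C_def using i k less.prems(1) by (subst gmul_transvection) auto
      have "{x. x < m \<and> x \<noteq> k \<and> C x k \<noteq> 0} \<subset> {x. x < m \<and> x \<noteq> k \<and> B x k \<noteq> 0}"
        using i less.prems(4) by (auto simp: C)
      then have "card {x. x < m \<and> x \<noteq> k \<and> C x k \<noteq> 0} < card {x. x < m \<and> x \<noteq> k \<and> B x k \<noteq> 0}"
        by (intro psubset_card_mono) auto
      \<comment> \<open>Row \<open>k\<close> vanishes to the left of the pivot, so adding a multiple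
        of it leaves the finished columns alone.\<close>
      moreover have "C x y = gone ?D x y" if "y < k" for x y
        using less.prems(3)[OF that] that by (simp add: C gone_def)
      moreover have "C k k = 1" using i less.prems(4) by (simp add: C)
      moreover have "\<exists>C'. ginv ?D C C'"
        unfolding C_def using less.prems(2) inv[OF el_T[OF i(1) k i(2)]] by blast
      moreover have "supp_on ?D C" by (simp add: C_def)
      ultimately have "C \<in> elementary_products m" using less.hyps by blast
      then show ?thesis
        using elementary_products_reduce[OF el_T[OF i(1) k i(2)]] less.prems(1) by (simp add: C_def)
    qed
  qed
  have scale: "B \<in> elementary_products m"
    if "supp_on ?D B" "\<exists>B'. ginv ?D B B'" "\<And>i j. j < k \<Longrightarrow> B i j = gone ?D i j" "B k k \<noteq> 0" for B :: "'a mat"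
  proof -
    let ?S = "\<lambda>x y. if x = y \<and> x \<in> ?D then (if x = k then inverse (B k k) else 1) else 0"
    have el: "elementary m ?S"
      unfolding elementary_def lessThan_iff using k that(4) nonzero_imp_inverse_nonzero by blast
    have C: "gmul ?D ?S B x y = (if x = k then inverse (B k k) else 1) * B x y" for x y
      using that(1) by (subst gmul_diagonal) auto
    have "gmul ?D ?S B \<in> elementary_products m"
    proof (rule clear)
      show "gmul ?D ?S B x y = gone ?D x y" if "y < k" for x y
        using \<open>\<And>i j. j < k \<Longrightarrow> B i j = gone ?D i j\<close>[OF that] that unfolding C by (simp add: gone_def)
      show "gmul ?D ?S B k k = 1" unfolding C using that(4) by simp
      show "\<exists>B'. ginv ?D (gmul ?D ?S B) B'" using inv[OF el] that(2) by blast
    qed simp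
    then show ?thesis by (rule elementary_products_reduce[OF el _ that(1)])
  qed
  show ?thesis
  proof (cases "A k k = 0")
    case False
    then show ?thesis using scale[of A] A by blast
  next
    case True
    \<comment> \<open>Otherwise column \<open>k\<close> lives in the rows above \<open>k\<close>.
      The earlier columns of \<open>A\<close> are unit vectors, which forces row \<open>k\<close> of
      the inverse to vanish at the positions before \<open>k\<close>, so entry (k, k) of A' A would
      be 0.\<close>
    have "\<exists>i<m. k < i \<and> A i k \<noteq> 0"
    proof (rule ccontr)
      assume "\<not> (\<exists>i<m. k < i \<and> A i k \<noteq> 0)"
      with True have zero: "A i k = 0" if "k \<le> i" "i < m" for i
        using that by (cases "i = k") auto
      have "A' k z = 0" if "z < k" for z
      proof -
        have "gone ?D k z = gmul ?D A' A k z"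
          using A(2) by (simp add: ginv_def)
        also have "\<dots> = (\<Sum>w\<in>?D. A' k w * A w z)"
          using k that by (simp add: gmul_apply)
        also have "\<dots> = (\<Sum>w\<in>?D. if w = z then A' k z else 0)"
          using that by (intro sum.cong) (auto simp: A(3) gone_def)
        finally show ?thesis using k that by (simp add: gone_def)
      qed
      then have "A' k z * A z k = 0" if "z < m" for z
        using zero that by (cases "z < k") auto
      then have "gmul ?D A' A k k = 0" by (auto simp: gmul_apply intro!: sum.neutral)
      then show False using A(2) k by (simp add: ginv_def gone_def)
    qed
    then obtain i where i: "i < m" "k < i" "A i k \<noteq> 0" by blast
    \<comment> \<open>Adding the lower row \<open>i\<close> does the work of a row swap: the pivot
      becomes nonzero, and since i > k this row is zero in the finished columns.\<close>
    let ?C = "gmul ?D (?T k i 1) A"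
    have el: "elementary m (?T k i 1)" using el_T[of k i 1] i k by simp
    have C: "?C x y = A x y + (if x = k then A i y else 0)" for x y
      using i k A(1) by (subst gmul_transvection) auto
    have "?C \<in> elementary_products m"
    proof (rule scale)
      show "?C x y = gone ?D x y" if "y < k" for x y
        using A(3)[OF that] that i unfolding C by (simp add: gone_def)
      show "?C k k \<noteq> 0" unfolding C using True i by simp
      show "\<exists>B'. ginv ?D ?C B'" using inv[OF el A(2)] .
    qed simp
    then show ?thesis by (rule elementary_products_reduce[OF el _ A(1)])
  qed
qed

theorem invertible_elementary_products:
  assumes "supp_on {..<m} A" "ginv {..<m} A A'"
  shows "A \<in> elementary_products m"
proof -
  \<comment> \<open>Generalized to matrices whose first \<open>k\<close> columns are those of the
    identity, for induction on the m - k columns left; \<open>A'\<close> varies because row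
    operations change the inverse.\<close>
  have "A \<in> elementary_products m"
    if "supp_on {..<m} A" "ginv {..<m} A A'" "\<And>i j. j < k \<Longrightarrow> A i j = gone {..<m} i j" "k \<le> m"
    for k and A A' :: "'a mat"
    using that
  proof (induction "m - k" arbitrary: k A A')
    case 0
    have "A i j = gone {..<m} i j" for i j
      using 0 by (cases "j < m") (auto simp: supp_on_def gone_def)
    then have "A = gone {..<m}" by (intro ext)
    then show ?case by (simp add: elementary_products.one)
  next
    case (Suc d)
    then have "k < m" "d = m - Suc k" by auto
    show ?case
      by (rule elementary_products_column_step[OF _ \<open>k < m\<close> Suc.prems(1-3)])
        (use Suc.hyps(1)[OF \<open>d = m - Suc k\<close>] \<open>k < m\<close> less_Suc_eq_le in auto)
  qed
  from this[of A A' 0] assms show ?thesis by simp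
qed

section \<open>Block matrices cut out by class-to-class equations\<close>

lemma gmul_nonzeroE:
  assumes "gmul D A B i j \<noteq> 0"
  obtains k where "k \<in> D" "A i k \<noteq> 0" "B k j \<noteq> 0"
proof -
  have "(\<Sum>k\<in>D. A i k * B k j) \<noteq> 0"
    using assms by (auto simp: gmul_apply split: if_splits)
  then obtain k where "k \<in> D" "A i k * B k j \<noteq> 0"
    by (rule sum.not_neutral_contains_not_neutral)
  then show thesis using that by auto
qed

lemma links_gmul: "links I J A \<Longrightarrow> links K L B \<Longrightarrow> links I L (gmul D A B)"
  unfolding links_def by (metis gmul_nonzeroE)

section \<open>Classes of the index relation\<close>

locale index_classes =
  fixes t :: nat and R :: "(nat \<times> nat) set"
  assumes equiv: "equiv {..<t} R"
begin

lemma classes_less: "I \<in> classes t R \<Longrightarrow> i \<in> I \<Longrightarrow> i < t"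
  using in_quotient_imp_subset[OF equiv] by (auto simp: classes_def)

lemma classes_nonempty: "I \<in> classes t R \<Longrightarrow> \<exists>i. i \<in> I"
  using in_quotient_imp_non_empty[OF equiv] by (auto simp: classes_def)

lemma classes_disjoint:
  "\<lbrakk>I \<in> classes t R; J \<in> classes t R; i \<in> I; i \<in> J\<rbrakk> \<Longrightarrow> I = J"
  using quotient_disj[OF equiv] by (auto simp: classes_def)

lemma class_of: "i < t \<Longrightarrow> R `` {i} \<in> classes t R" "i < t \<Longrightarrow> i \<in> R `` {i}"
  using equiv_class_self[OF equiv] by (auto simp: classes_def quotient_def)

lemma classes_related: "\<lbrakk>I \<in> classes t R; i \<in> I; j \<in> I\<rbrakk> \<Longrightarrow> (i, j) \<in> R"
  using in_quotient_imp_in_rel[OF equiv] by (auto simp: classes_def)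

lemma finite_classes: "finite (classes t R)"
  unfolding classes_def using equiv by (intro finite_quotient) (auto simp: equiv_def)

lemma classes_closed: "\<lbrakk>I \<in> classes t R; i \<in> I; (i, j) \<in> R\<rbrakk> \<Longrightarrow> j \<in> I"
  using in_quotient_imp_closed[OF equiv] by (auto simp: classes_def)

lemma related_less: "(i, j) \<in> R \<Longrightarrow> i < t \<and> j < t"
  using equiv by (auto simp: equiv_def)

end

text \<open>The linear equation with coefficients \<open>c\<close>, evaluated at \<open>A\<close>;
  the sums in \<open>gamma_eq\<close> and \<open>M_eq\<close> are of this form.\<close>

definition pairing :: "nat \<Rightarrow> 'a::field mat \<Rightarrow> 'a mat \<Rightarrow> 'a" where
  "pairing t c A = (\<Sum>i<t. \<Sum>j<t. c i j * A i j)"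

lemma pairing_linear:
  "pairing t c 0 = 0" "pairing t c (A + B) = pairing t c A + pairing t c B"
  "pairing t c (scl a A) = a * pairing t c A"
  by (simp_all add: pairing_def distrib_left sum.distrib sum_distrib_left mult.left_commute)

lemma pairing_span:
  assumes "A \<in> mat_vs.span X" and X: "\<And>x. x \<in> X \<Longrightarrow> pairing t c x = 0"
  shows "pairing t c A = 0"
proof (rule mat_vs.span_induct_alt[OF assms(1), where h = "\<lambda>A. pairing t c A = 0"])
  show "pairing t c (scl a x + y) = 0" if "x \<in> X" "pairing t c y = 0" for a x y
    using that X[of x] by (simp add: pairing_linear)
qed (simp add: pairing_linear)

lemma pairing_eq_sum:
  assumes "D \<subseteq> {..<t} \<times> {..<t}" "\<And>i j. c i j \<noteq> 0 \<Longrightarrow> (i, j) \<in> D"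
  shows "pairing t c A = (\<Sum>(i, j)\<in>D. c i j * A i j)"
proof -
  have "pairing t c A = (\<Sum>(i, j)\<in>{..<t} \<times> {..<t}. c i j * A i j)"
    by (simp add: pairing_def sum.cartesian_product)
  also have "\<dots> = (\<Sum>(i, j)\<in>D. c i j * A i j)"
  proof (intro sum.mono_neutral_right ballI)
    show "(case p of (i, j) \<Rightarrow> c i j * A i j) = 0" if "p \<in> {..<t} \<times> {..<t} - D" for p
      using that assms(2) by (cases p) (metis DiffD2 case_prod_conv mult_zero_left)
  qed (use assms(1) in auto)
  finally show ?thesis .
qed

lemma pairing_cong:
  assumes "\<And>i j. c i j \<noteq> 0 \<Longrightarrow> A i j = B i j"
  shows "pairing t c A = pairing t c B"
  unfolding pairing_def using assms by (intro sum.cong) (metis mult_zero_left)+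

text \<open>\<open>Gamma_n\<close> and \<open>M_n\<close> impose their equations on the (l, r)
  entries of the blocks for each l and r separately. Passing to slices turns this into statements
  about t x t matrices.\<close>

definition slice :: "'a bmat \<Rightarrow> nat \<Rightarrow> nat \<Rightarrow> 'a mat" where
  "slice A l r = (\<lambda>i j. A (i, l) (j, r))"

lemma slice_linear:
  "slice 0 l r = 0" "slice (A + B) l r = slice A l r + slice B l r"
  "slice (scl a A) l r = scl a (slice A l r)"
  by (simp_all add: slice_def fun_eq_iff)

lemma bup_apply: "bup t n A l r (i, a) (j, b) =
    (if (i, a) \<in> bidx t n \<and> (j, b) \<in> bidx t n \<and> a = l \<and> b = r then A i j else 0)"
  by (simp add: bup_def)

lemma bup_linear:
  "bup t n 0 l r = 0" "bup t n (A + B) l r = bup t n A l r + bup t n B l r"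
  "bup t n (scl a A) l r = scl a (bup t n A l r)"
  by (auto simp: fun_eq_iff bup_apply)

lemma supp_on_bup: "supp_on (bidx t n) (bup t n A l r)"
  by (auto simp: supp_on_def bup_def)

definition blow_gens ::
    "nat \<Rightarrow> (nat \<times> nat) set \<Rightarrow> (nat \<Rightarrow> nat) \<Rightarrow> 'a::field mat set \<Rightarrow> 'a bmat set" where
  "blow_gens t R n X = {bup t n V l r | V l r. V \<in> X \<and> V \<noteq> (\<lambda>i j. 0) \<and> lr_ok t R n V l r}"

text \<open>With \<open>Vset t Ps Vs\<close> for \<open>X\<close> this is \<open>Mtr\<close>. The
  set is a parameter because the idempotents, the products and the layers of the radical are blown
  up in the same way.\<close>

definition blowup ::
    "nat \<Rightarrow> (nat \<times> nat) set \<Rightarrow> (nat \<Rightarrow> nat) \<Rightarrow> 'a::field mat set \<Rightarrow> 'a bmat set" where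
  "blowup t R n X = mat_vs.span (blow_gens t R n X)"

lemma bup_in_blowup:
  assumes "V \<in> X \<or> V = 0" "lr_ok t R n V l r"
  shows "bup t n V l r \<in> blowup t R n X"
proof (cases "V = 0")
  case True
  then show ?thesis by (simp add: bup_linear blowup_def mat_vs.span_zero)
next
  case False
  then show ?thesis
    using assms unfolding blowup_def blow_gens_def zero_mat_eq by (intro mat_vs.span_base) blast
qed

lemma blowup_mono: "X \<subseteq> Y \<Longrightarrow> blowup t R n X \<subseteq> blowup t R n Y"
  unfolding blowup_def blow_gens_def by (intro mat_vs.span_mono) blast

lemma blowup_subset_zero: "X \<subseteq> {0} \<Longrightarrow> blowup t R n X = {0}"
proof -
  assume "X \<subseteq> {0}"
  then have "blow_gens t R n X = {}" by (auto simp: blow_gens_def zero_mat_eq)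
  then show ?thesis by (simp add: blowup_def)
qed

lemma blowup_Un: "blowup t R n (X \<union> Y) = {A + B | A B. A \<in> blowup t R n X \<and> B \<in> blowup t R n Y}"
proof -
  have "blow_gens t R n (X \<union> Y) = blow_gens t R n X \<union> blow_gens t R n Y"
    unfolding blow_gens_def by blast
  then show ?thesis by (simp add: blowup_def mat_vs.span_Un)
qed

text \<open>The common shape of \<open>M_eq\<close> and \<open>gamma_eq\<close>. \<open>Q\<close>
  restricts the positions of the unknowns: no restriction for the bimodule, (<) for the radical, (=)
  for the diagonal part.\<close>

definition block_equation ::
    "nat \<Rightarrow> (nat \<times> nat) set \<Rightarrow> (nat \<Rightarrow> nat \<Rightarrow> bool) \<Rightarrow> 'a::field mat set \<Rightarrow> 'a mat \<Rightarrow> bool" where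
  "block_equation t R Q X c \<longleftrightarrow>
    (\<exists>I\<in>classes t R. \<exists>J\<in>classes t R. \<forall>i j. c i j \<noteq> 0 \<longrightarrow> i \<in> I \<and> j \<in> J \<and> Q i j) \<and>
    (\<forall>x\<in>X. pairing t c x = 0)"

locale step_sequence = index_classes +
  fixes n :: "nat \<Rightarrow> nat"
  assumes step_seq: "step_seq t R n"
begin

lemma step_const: "\<lbrakk>I \<in> classes t R; i \<in> I; j \<in> I\<rbrakk> \<Longrightarrow> n i = n j"
  using step_seq classes_related unfolding step_seq_def by blast

text \<open>By \<open>lr_ok\<close> the position (l0, r0) exists in every block where
  \<open>x\<close> has a nonzero entry, so blowing up loses no entry.\<close>

lemma slice_bup:
  assumes "lr_ok t R n x l0 r0"
  shows "slice (bup t n x l0 r0) l r = (if l = l0 \<and> r = r0 then x else 0)"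
proof -
  obtain I J where IJ: "I \<in> classes t R" "J \<in> classes t R" "links I J x"
    "\<forall>i\<in>I. l0 < n i" "\<forall>j\<in>J. r0 < n j"
    using assms by (auto simp: lr_ok_def)
  have "x i j = 0" if "(i, l0) \<notin> bidx t n \<or> (j, r0) \<notin> bidx t n" for i j
    using that IJ classes_less unfolding links_def bidx_def by blast
  then show ?thesis
    by (auto simp: slice_def bup_apply fun_eq_iff)
qed

text \<open>Each property cuts out a subspace and holds for the generators. The third one is stated
  for arbitrary \<open>c\<close>, so that it also covers the equality of two diagonal entries, which
  is not a \<open>gamma_eq\<close>.\<close>

lemma blowup_subset:
  assumes X: "\<forall>x\<in>X. \<forall>i j. x i j \<noteq> 0 \<longrightarrow> Q i j"
    and "A \<in> blowup t R n X"
  shows "supp_on (bidx t n) A" "\<And>i j l r. A (i, l) (j, r) \<noteq> 0 \<Longrightarrow> Q i j"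
    and "\<And>c l r. \<forall>x\<in>X. pairing t c x = 0 \<Longrightarrow> pairing t c (slice A l r) = 0"
proof -
  let ?W = "{A. supp_on (bidx t n) A \<and> (\<forall>i j l r. A (i, l) (j, r) \<noteq> 0 \<longrightarrow> Q i j) \<and>
    (\<forall>c. (\<forall>x\<in>X. pairing t c x = 0) \<longrightarrow> (\<forall>l r. pairing t c (slice A l r) = 0))}"
  have "mat_vs.subspace ?W"
  proof (rule mat_vs.subspaceI)
    show "0 \<in> ?W"
      by (simp add: supp_on_def slice_linear pairing_linear)
    show "A + B \<in> ?W" if AB: "A \<in> ?W" "B \<in> ?W" for A B
    proof (intro CollectI conjI allI impI)
      show "supp_on (bidx t n) (A + B)" using AB by (blast intro: supp_on_add)
      show "Q i j" if "(A + B) (i, l) (j, r) \<noteq> 0" for i j l r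
      proof -
        have "A (i, l) (j, r) \<noteq> 0 \<or> B (i, l) (j, r) \<noteq> 0" using that by auto
        then show ?thesis using AB by blast
      qed
      show "pairing t c (slice (A + B) l r) = 0" if "\<forall>x\<in>X. pairing t c x = 0" for c l r
      proof -
        have "pairing t c (slice A l r) = 0" "pairing t c (slice B l r) = 0"
          using AB that by blast+
        then show ?thesis by (simp add: slice_linear pairing_linear)
      qed
    qed
    show "scl a A \<in> ?W" if A: "A \<in> ?W" for a A
    proof (intro CollectI conjI allI impI)
      show "supp_on (bidx t n) (scl a A)" using A by (simp add: supp_on_def)
      show "Q i j" if "scl a A (i, l) (j, r) \<noteq> 0" for i j l r
      proof -
        have "A (i, l) (j, r) \<noteq> 0" using that by auto
        then show ?thesis using A by blast
      qed
      show "pairing t c (slice (scl a A) l r) = 0" if "\<forall>x\<in>X. pairing t c x = 0" for c l r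
      proof -
        have "pairing t c (slice A l r) = 0" using A that by blast
        then show ?thesis by (simp add: slice_linear pairing_linear)
      qed
    qed
  qed
  moreover have "blow_gens t R n X \<subseteq> ?W"
  proof
    fix A assume "A \<in> blow_gens t R n X"
    then obtain V l0 r0 where V: "A = bup t n V l0 r0" "V \<in> X" "lr_ok t R n V l0 r0"
      unfolding blow_gens_def by blast
    show "A \<in> ?W"
    proof (intro CollectI conjI allI impI)
      show "supp_on (bidx t n) A" by (simp add: V supp_on_bup)
      show "Q i j" if "A (i, l) (j, r) \<noteq> 0" for i j l r
      proof -
        have "V i j \<noteq> 0" using that unfolding V bup_apply by (simp split: if_splits)
        then show ?thesis using X V(2) by blast
      qed
      show "pairing t c (slice A l r) = 0" if "\<forall>x\<in>X. pairing t c x = 0" for c l r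
        using that V(2) unfolding V(1) slice_bup[OF V(3)] by (simp add: pairing_linear)
    qed
  qed
  ultimately have "mat_vs.span (blow_gens t R n X) \<subseteq> ?W"
    by (intro mat_vs.span_minimal)
  then have W: "A \<in> ?W" using assms(2) unfolding blowup_def by (rule subsetD)
  show "supp_on (bidx t n) A" using W by blast
  show "Q i j" if "A (i, l) (j, r) \<noteq> 0" for i j l r using W that by blast
  show "pairing t c (slice A l r) = 0" if "\<forall>x\<in>X. pairing t c x = 0" for c l r
    using W that by blast
qed

text \<open>If this failed, a separating functional supported in the block would kill the generators
  linking \<open>I\<close> to \<open>J\<close>, and also all others, since distinct classes are
  disjoint and those have no entry there. It would thus be a block equation that \<open>B\<close>
  violates.\<close>

lemma block_in_span:
  assumes X: "\<forall>x\<in>X. links_some t R x" "\<forall>x\<in>X. \<forall>i j. x i j \<noteq> 0 \<longrightarrow> Q i j"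
    and B: "\<forall>i j. B i j \<noteq> 0 \<longrightarrow> Q i j" "\<forall>c. block_equation t R Q X c \<longrightarrow> pairing t c B = 0"
    and I: "I \<in> classes t R" and J: "J \<in> classes t R"
  shows "(\<lambda>i j. if i \<in> I \<and> j \<in> J then B i j else 0) \<in> mat_vs.span {x \<in> X. links I J x}"
    (is "?Y \<in> mat_vs.span ?X")
proof (rule ccontr)
  let ?D = "{(i, j). i \<in> I \<and> j \<in> J \<and> Q i j}"
  have D: "?D \<subseteq> {..<t} \<times> {..<t}" using I J classes_less by auto
  assume notin: "?Y \<notin> mat_vs.span ?X"
  have fin: "finite ?D" using D by (rule finite_subset) simp
  have X': "\<forall>x\<in>?X. \<forall>i j. x i j \<noteq> 0 \<longrightarrow> (i, j) \<in> ?D"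
    using X(2) by (auto simp: links_def)
  have Y': "\<forall>i j. ?Y i j \<noteq> 0 \<longrightarrow> (i, j) \<in> ?D"
    using B(1) by simp
  obtain c where c: "\<forall>i j. c i j \<noteq> 0 \<longrightarrow> (i, j) \<in> ?D"
    and cX: "\<forall>x\<in>?X. (\<Sum>(i, j)\<in>?D. c i j * x i j) = 0"
    and cY: "(\<Sum>(i, j)\<in>?D. c i j * ?Y i j) \<noteq> 0"
    using separating_functional[OF fin X' Y' notin] by (elim exE conjE) (rule that)
  have pair: "pairing t c x = (\<Sum>(i, j)\<in>?D. c i j * x i j)" for x
    using c by (intro pairing_eq_sum[OF D]) simp
  have "pairing t c x = 0" if "x \<in> X" for x
  proof (cases "links I J x")
    case True
    then show ?thesis using that unfolding pair by (intro bspec[OF cX]) simp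
  next
    case False
    obtain I' J' where IJ: "I' \<in> classes t R" "J' \<in> classes t R" "links I' J' x"
      using X(1) \<open>x \<in> X\<close> by (auto simp: links_some_def)
    have "x i j = 0" if "c i j \<noteq> 0" for i j
    proof (rule ccontr)
      assume "x i j \<noteq> 0"
      then have "i \<in> I'" "j \<in> J'" using IJ(3) by (auto simp: links_def)
      moreover have "i \<in> I" "j \<in> J" using c that by auto
      ultimately have "I' = I" "J' = J" using IJ(1,2) I J classes_disjoint by blast+
      with IJ(3) False show False by simp
    qed
    then have "pairing t c x = pairing t c 0" by (intro pairing_cong) simp
    then show ?thesis by (simp add: pairing_linear)
  qed
  then have "block_equation t R Q X c"
    unfolding block_equation_def using c by (intro conjI bexI[OF _ I] bexI[OF _ J]) auto
  then have "pairing t c B = 0" using B(2) by simp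
  moreover have "pairing t c ?Y = pairing t c B"
    using c by (intro pairing_cong) auto
  ultimately show False using cY unfolding pair[of ?Y, symmetric] by simp
qed

text \<open>To get from equations to generators, \<open>A\<close> is written as the sum of the
  blow-ups of the class blocks of its slices; \<open>block_in_span\<close> puts each block into the
  span of \<open>X\<close>.\<close>

lemma blowup_iff:
  assumes X: "\<forall>x\<in>X. links_some t R x" "\<forall>x\<in>X. \<forall>i j. x i j \<noteq> 0 \<longrightarrow> Q i j"
  shows "A \<in> blowup t R n X \<longleftrightarrow> supp_on (bidx t n) A \<and>
    (\<forall>i j l r. A (i, l) (j, r) \<noteq> 0 \<longrightarrow> Q i j) \<and>
    (\<forall>c. block_equation t R Q X c \<longrightarrow> (\<forall>l r. pairing t c (slice A l r) = 0))"
    (is "_ \<longleftrightarrow> ?rhs")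
proof
  assume "A \<in> blowup t R n X"
  from blowup_subset[OF X(2) this] show ?rhs
    unfolding block_equation_def by auto
next
  assume rhs: ?rhs
  define Y where "Y = (\<lambda>I J l r i j. if i \<in> I \<and> j \<in> J then slice A l r i j else 0)"
  \<comment> \<open>Sizes are constant on classes: either \<open>l\<close> and \<open>r\<close> fit
    every block from \<open>I\<close> to \<open>J\<close>, which gives \<open>lr_ok\<close>, or they
    fit none and the block of the slice is zero.\<close>
  have mem: "bup t n (Y I J l r) l r \<in> blowup t R n X"
    if "I \<in> classes t R" "J \<in> classes t R" for I J l r
  proof (cases "(\<exists>i\<in>I. l < n i) \<and> (\<exists>j\<in>J. r < n j)")
    case True
    then have lr: "\<forall>i\<in>I. l < n i" "\<forall>j\<in>J. r < n j"
      using step_const that by metis+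
    have "\<forall>i j. slice A l r i j \<noteq> 0 \<longrightarrow> Q i j"
      unfolding slice_def using rhs by blast
    moreover have "\<forall>c. block_equation t R Q X c \<longrightarrow> pairing t c (slice A l r) = 0"
      using rhs by blast
    ultimately have "Y I J l r \<in> mat_vs.span {x \<in> X. links I J x}"
      unfolding Y_def by (rule block_in_span[OF X _ _ that])
    then show ?thesis
      unfolding blowup_def
    proof (rule span_image_mem[where f = "\<lambda>x. bup t n x l r"])
      show "bup t n x l r \<in> mat_vs.span (blow_gens t R n X)" if "x \<in> {x \<in> X. links I J x}" for x
        using that \<open>I \<in> classes t R\<close> \<open>J \<in> classes t R\<close> lr bup_in_blowup[of x X t R n l r]
        unfolding blowup_def lr_ok_def by blast
    qed (simp_all add: bup_linear)
  next
    case False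
    then have "Y I J l r = 0"
      using rhs by (auto simp: Y_def slice_def fun_eq_iff supp_on_def bidx_def)
    then show ?thesis by (simp add: bup_linear blowup_def mat_vs.span_zero)
  qed
  \<comment> \<open>Any common bound on the block sizes makes the summation range finite; their sum
    is such a bound.\<close>
  define N where "N = (\<Sum>i<t. n i)"
  have N: "l < N" if "l < n i" "i < t" for i l
    using that member_le_sum[of i "{..<t}" n] by (simp add: N_def)
  define K where "K = classes t R \<times> classes t R \<times> {..<N} \<times> {..<N}"
  have "finite K" by (simp add: K_def finite_classes)
  have "A = (\<Sum>(I, J, l, r)\<in>K. bup t n (Y I J l r) l r)"
  proof (intro ext)
    fix x y :: "nat \<times> nat"
    obtain i a j b where xy: "x = (i, a)" "y = (j, b)" by (metis surj_pair)
    show "A x y = (\<Sum>(I, J, l, r)\<in>K. bup t n (Y I J l r) l r) x y"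
    proof (cases "x \<in> bidx t n \<and> y \<in> bidx t n")
      case True
      then have ij: "i < t" "j < t" "a < n i" "b < n j" by (auto simp: xy bidx_def)
      \<comment> \<open>Only this summand contributes at (x, y): \<open>i\<close> and
        \<open>j\<close> lie in exactly one class each, and a blow-up fills a single inner
        position.\<close>
      let ?k = "(R `` {i}, R `` {j}, a, b)"
      have "?k \<in> K" using ij N by (auto simp: K_def class_of)
      have "(case k of (I, J, l, r) \<Rightarrow> bup t n (Y I J l r) l r) x y = (if k = ?k then A x y else 0)"
        if "k \<in> K" for k
      proof -
        obtain I J l r where k: "k = (I, J, l, r)" by (metis surj_pair)
        then have IJ: "I \<in> classes t R" "J \<in> classes t R" using that by (auto simp: K_def)
        then have "i \<in> I \<longleftrightarrow> I = R `` {i}" "j \<in> J \<longleftrightarrow> J = R `` {j}"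
          using ij class_of classes_disjoint by blast+
        then show ?thesis using True by (auto simp: k xy bup_apply Y_def slice_def)
      qed
      then have "(\<Sum>(I, J, l, r)\<in>K. bup t n (Y I J l r) l r) x y = (\<Sum>k\<in>K. if k = ?k then A x y else 0)"
        unfolding sum_apply2 by (rule sum.cong[OF refl])
      also have "\<dots> = A x y" using \<open>?k \<in> K\<close> \<open>finite K\<close> by simp
      finally show ?thesis by simp
    next
      case False
      then have "A x y = 0" using rhs unfolding supp_on_def by blast
      moreover have "(case k of (I, J, l, r) \<Rightarrow> bup t n (Y I J l r) l r) x y = 0" for k
        using False by (cases k) (auto simp: xy bup_apply)
      ultimately show ?thesis by (simp add: sum_apply2)
    qed
  qed
  moreover have "(\<Sum>(I, J, l, r)\<in>K. bup t n (Y I J l r) l r) \<in> blowup t R n X"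
    unfolding blowup_def
    by (rule mat_vs.span_sum) (use mem in \<open>auto simp: K_def blowup_def\<close>)
  ultimately show "A \<in> blowup t R n X" by simp
qed

text \<open>Blow-ups multiply like matrix units in their inner indices. \<open>lr_ok\<close> ensures
  that inner position \<open>r\<close> exists wherever \<open>P\<close> has a nonzero entry, so the
  sum over (k, s) collapses to s = r and leaves the t x t product.\<close>

lemma gmul_bup:
  assumes "lr_ok t R n P l r"
  shows "gmul (bidx t n) (bup t n P l r) (bup t n Q l' r')
    = (if r = l' then bup t n (gmul {..<t} P Q) l r' else 0)"
proof (intro ext)
  fix x y :: "nat \<times> nat"
  obtain i a j b where xy: "x = (i, a)" "y = (j, b)" by (metis surj_pair)
  obtain I J where IJ: "I \<in> classes t R" "J \<in> classes t R" "links I J P"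
    "\<forall>i\<in>I. l < n i" "\<forall>j\<in>J. r < n j"
    using assms by (auto simp: lr_ok_def)
  have P: "P i k = 0" if "\<not> r < n k" for k
    using that IJ by (auto simp: links_def)
  show "gmul (bidx t n) (bup t n P l r) (bup t n Q l' r') x y
    = (if r = l' then bup t n (gmul {..<t} P Q) l r' else 0) x y"
  proof (cases "x \<in> bidx t n \<and> y \<in> bidx t n \<and> a = l \<and> b = r' \<and> r = l'")
    case True
    then have ij: "i < t" "j < t" by (auto simp: xy bidx_def)
    have bidx: "bidx t n = Sigma {..<t} (\<lambda>k. {..<n k})" by (auto simp: bidx_def)
    have "gmul (bidx t n) (bup t n P l r) (bup t n Q l' r') x y
      = (\<Sum>z\<in>bidx t n. bup t n P l r x z * bup t n Q l' r' z y)"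
      using True by (simp add: gmul_apply)
    also have "\<dots> = (\<Sum>k<t. \<Sum>s<n k. bup t n P l r x (k, s) * bup t n Q l' r' (k, s) y)"
      unfolding bidx by (subst sum.Sigma) (simp_all add: case_prod_beta)
    also have "\<dots> = (\<Sum>k<t. \<Sum>s<n k. if s = r then P i k * Q k j else 0)"
      using True by (intro sum.cong refl) (auto simp: xy bup_apply bidx_def)
    also have "\<dots> = (\<Sum>k<t. P i k * Q k j)"
      using P by (intro sum.cong refl) auto
    also have "\<dots> = (if r = l' then bup t n (gmul {..<t} P Q) l r' else 0) x y"
      using True ij by (auto simp: xy bup_apply gmul_apply)
    finally show ?thesis .
  next
    case False
    have "bup t n P l r x z * bup t n Q l' r' z y = 0" if "x \<in> bidx t n" "y \<in> bidx t n" for z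
      using False that by (cases z) (auto simp: xy bup_apply)
    then have "gmul (bidx t n) (bup t n P l r) (bup t n Q l' r') x y = 0"
      unfolding gmul_apply by (auto intro!: sum.neutral simp del: mult_eq_0_iff)
    moreover have "(if r = l' then bup t n (gmul {..<t} P Q) l r' else 0) x y = 0"
      using False by (auto simp: xy bup_apply)
    ultimately show ?thesis by simp
  qed
qed

lemma gmul_blowup:
  assumes "A \<in> blowup t R n X" "B \<in> blowup t R n Y"
    and XY: "\<And>x y. x \<in> X \<Longrightarrow> y \<in> Y \<Longrightarrow> gmul {..<t} x y \<in> insert 0 Z"
  shows "gmul (bidx t n) A B \<in> blowup t R n Z"
  unfolding blowup_def
proof (rule gmul_span[OF assms(1,2)[unfolded blowup_def]])
  fix u v assume "u \<in> blow_gens t R n X" "v \<in> blow_gens t R n Y"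
  then obtain P l r Q l' r' where u: "u = bup t n P l r" "P \<in> X" "lr_ok t R n P l r"
    and v: "v = bup t n Q l' r'" "Q \<in> Y" "lr_ok t R n Q l' r'"
    unfolding blow_gens_def by blast
  obtain I J where IJ: "I \<in> classes t R" "links I J P" "\<forall>i\<in>I. l < n i"
    using u(3) unfolding lr_ok_def by blast
  obtain I' J' where IJ': "J' \<in> classes t R" "links I' J' Q" "\<forall>j\<in>J'. r' < n j"
    using v(3) unfolding lr_ok_def by blast
  have "links I J' (gmul {..<t} P Q)"
    using IJ(2) IJ'(2) by (rule links_gmul)
  then have "lr_ok t R n (gmul {..<t} P Q) l r'"
    unfolding lr_ok_def using IJ(1,3) IJ'(1,3) by blast
  then have "bup t n (gmul {..<t} P Q) l r' \<in> blowup t R n Z"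
    using XY[OF u(2) v(2)] by (intro bup_in_blowup) blast+
  then show "gmul (bidx t n) u v \<in> mat_vs.span (blow_gens t R n Z)"
    unfolding u(1) v(1) gmul_bup[OF u(3)] by (simp add: blowup_def mat_vs.span_zero)
qed

end

section \<open>The algebra and bimodule of a triple\<close>

lemma span_support:
  assumes "A \<in> mat_vs.span X" "\<forall>x\<in>X. \<forall>i j. x i j \<noteq> 0 \<longrightarrow> Q i j" "A i j \<noteq> 0"
  shows "Q i j"
proof (rule ccontr)
  assume "\<not> Q i j"
  have "A i j = 0"
  proof (rule mat_vs.span_induct_alt[OF assms(1), where h = "\<lambda>A. A i j = 0"])
    show "(scl c x + y) i j = 0" if "x \<in> X" "y i j = 0" for c x y
    proof -
      have "x i j = 0" using that(1) assms(2) \<open>\<not> Q i j\<close> by blast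
      then show ?thesis using that(2) by simp
    qed
  qed simp
  with assms(3) show False by simp
qed

lemma insert_zero_in_span: "x \<in> insert 0 X \<Longrightarrow> x \<in> mat_vs.span X"
  by (elim insertE) (simp_all add: mat_vs.span_zero mat_vs.span_base)

lemma span_supp_on:
  assumes "A \<in> mat_vs.span X" "\<forall>x\<in>X. supp_on D x"
  shows "supp_on D A"
  using span_support[OF assms(1), where Q = "\<lambda>i j. i \<in> D \<and> j \<in> D"] assms(2)
  unfolding supp_on_def by blast

lemma eidem_eq: "I \<subseteq> D \<Longrightarrow> eidem I = (\<lambda>x y. if x = y \<and> x \<in> D then (if x \<in> I then 1 else 0) else 0)"
  by (auto simp: eidem_def fun_eq_iff)

lemma gmul_eidem_left:
  fixes A :: "'a::field mat"
  assumes "finite D" "supp_on D A" "I \<subseteq> D"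
  shows "gmul D (eidem I) A = (\<lambda>i j. if i \<in> I then A i j else 0)"
  by (intro ext) (simp add: eidem_eq[OF assms(3)] gmul_diagonal[OF assms(1,2)])

lemma gmul_eidem_right:
  fixes A :: "'a::field mat"
  assumes "finite D" "supp_on D A" "J \<subseteq> D"
  shows "gmul D A (eidem J) = (\<lambda>i j. if j \<in> J then A i j else 0)"
proof (intro ext)
  fix i j
  show "gmul D A (eidem J) i j = (if j \<in> J then A i j else 0)"
  proof (cases "i \<in> D \<and> j \<in> D")
    case True
    have "(\<Sum>z\<in>D. A i z * eidem J z j) = (\<Sum>z\<in>D. if z = j then (if j \<in> J then A i j else 0) else 0)"
      by (intro sum.cong) (auto simp: eidem_def)
    then show ?thesis using True assms(1) by (simp add: gmul_apply)
  next
    case False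
    then show ?thesis using assms by (auto simp: gmul_apply supp_on_def)
  qed
qed

text \<open>For triangular \<open>A\<close> the diagonal entries of a power are the powers of the
  diagonal entries, and a field has no nonzero nilpotents.\<close>

lemma nilpotent_upper_tri_diag:
  fixes A :: "'a::field mat"
  assumes "supp_on {..<t} A" "upper_tri A" "nilpotent t A"
  shows "A i i = 0"
proof (cases "i < t")
  case True
  have "(\<forall>k. mpow t A m i k \<noteq> 0 \<longrightarrow> i \<le> k) \<and> mpow t A m i i = A i i ^ m" for m
  proof (induction m)
    case 0
    then show ?case using True by (simp add: mat_as_generic gone_def)
  next
    case (Suc m)
    have "i \<le> k" if nz: "mpow t A (Suc m) i k \<noteq> 0" for k
    proof -
      obtain j where "mpow t A m i j \<noteq> 0" "A j k \<noteq> 0"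
        using nz unfolding mpow.simps mat_as_generic by (rule gmul_nonzeroE)
      then show ?thesis using Suc assms(2) unfolding upper_tri_def by (meson le_trans)
    qed
    moreover have "mpow t A (Suc m) i i = A i i ^ Suc m"
    proof -
      have "mpow t A m i j * A j i = (if j = i then A i i ^ Suc m else 0)" for j
      proof (cases "j = i")
        case False
        then have "mpow t A m i j = 0 \<or> A j i = 0"
          using Suc assms(2) unfolding upper_tri_def by (metis le_antisym)
        then show ?thesis using False by auto
      qed (simp add: Suc)
      then show ?thesis using True by (simp add: mat_as_generic gmul_apply)
    qed
    ultimately show ?case by blast
  qed
  moreover obtain m where "mpow t A m = (\<lambda>i j. 0)"
    using assms(3) by (auto simp: nilpotent_def)
  ultimately have "A i i ^ m = 0" by metis
  then show ?thesis by simp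
next
  case False
  then show ?thesis using assms(1) by (simp add: supp_on_def)
qed

text \<open>Each factor moves at least one step to the right, so a nonzero entry of the m-th power
  lies at distance at least \<open>m\<close> from the diagonal; within t columns this is impossible
  for m = t.\<close>

lemma nilpotent_strictly_upper:
  fixes A :: "'a::field mat"
  assumes "\<forall>i j. A i j \<noteq> 0 \<longrightarrow> i < j"
  shows "nilpotent t A"
proof -
  have *: "mpow t A m i j \<noteq> 0 \<longrightarrow> i + m \<le> j \<and> j < t" for m i j
  proof (induction m arbitrary: j)
    case 0
    then show ?case by (simp add: mat_as_generic gone_def)
  next
    case (Suc m)
    show ?case
    proof
      assume nz: "mpow t A (Suc m) i j \<noteq> 0"
      then obtain k where k: "mpow t A m i k \<noteq> 0" "A k j \<noteq> 0"
        unfolding mpow.simps mat_as_generic by (rule gmul_nonzeroE)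
      have "j < t" using nz by (auto simp: mat_as_generic gmul_apply split: if_splits)
      moreover have "i + m \<le> k" "k < j" using k Suc assms by blast+
      ultimately show "i + Suc m \<le> j \<and> j < t" by simp
    qed
  qed
  have "mpow t A t i j = 0" for i j
    using *[of t i j] by fastforce
  then have "mpow t A t = (\<lambda>i j. 0)" by (intro ext)
  then show ?thesis unfolding nilpotent_def by blast
qed

definition eidems :: "nat \<Rightarrow> (nat \<times> nat) set \<Rightarrow> 'a::field mat set" where
  "eidems t R = {eidem I | I. I \<in> classes t R}"

section \<open>Generators of the algebra of a triple\<close>

locale matrix_triple =
  fixes t :: nat and R :: "(nat \<times> nat) set" and Ps Vs :: "'a::field mat set"
  assumes triple: "triple t R Ps Vs"

sublocale matrix_triple \<subseteq> index_classes t R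
  using triple by unfold_locales (simp add: triple_def)

context matrix_triple
begin

abbreviation "D \<equiv> {..<t}"

lemma class_subset: "I \<in> classes t R \<Longrightarrow> I \<subseteq> D"
  using classes_less by auto

lemma prods_gmul_base: "P \<in> prods t Ps \<Longrightarrow> Q \<in> Ps \<Longrightarrow> gmul D P Q \<in> prods t Ps"
  using prods.step[of P t Ps Q] by (simp add: mat_as_generic)

text \<open>\<open>prods\<close> appends single matrices on the right only; the induction therefore
  runs over the right factor.\<close>

lemma prods_gmul: "Q \<in> prods t Ps \<Longrightarrow> P \<in> prods t Ps \<Longrightarrow> gmul D P Q \<in> prods t Ps"
proof (induction Q rule: prods.induct)
  case (base Q)
  then show ?case by (intro prods_gmul_base)
next
  case (step Q Q')
  then have "gmul D (gmul D P Q) Q' \<in> prods t Ps" using prods_gmul_base by blast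
  then show ?case by (simp add: mat_as_generic gmul_assoc)
qed

lemma links_some_gmul: "links_some t R A \<Longrightarrow> links_some t R B \<Longrightarrow> links_some t R (gmul E A B)"
  unfolding links_some_def using links_gmul by blast

lemma prods_props:
  assumes "P \<in> prods t Ps"
  shows "supp_on D P \<and> links_some t R P \<and> (\<forall>i j. P i j \<noteq> 0 \<longrightarrow> i < j)"
  using assms
proof (induction rule: prods.induct)
  case (base P)
  then have P: "supp_on D P" "upper_tri P" "nilpotent t P" "links_some t R P"
    using triple by (auto simp: triple_def mat_as_generic)
  have "i < j" if "P i j \<noteq> 0" for i j
    using nilpotent_upper_tri_diag[OF P(1-3), of i] P(2) that
    unfolding upper_tri_def by (metis le_neq_implies_less)
  then show ?case using P by blast
next
  case (step P Q)
  then have Q: "supp_on D Q" "upper_tri Q" "links_some t R Q"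
    using triple by (auto simp: triple_def mat_as_generic)
  have "i < j" if nz: "gmul D P Q i j \<noteq> 0" for i j
  proof -
    obtain k where "P i k \<noteq> 0" "Q k j \<noteq> 0" using nz by (rule gmul_nonzeroE)
    then have "i < k" "k \<le> j" using step.IH Q(2) unfolding upper_tri_def by blast+
    then show ?thesis by simp
  qed
  moreover have "links_some t R (gmul D P Q)" using step.IH Q(3) links_some_gmul by blast
  ultimately show ?case by (simp add: mat_as_generic)
qed

lemma supp_on_prods: "P \<in> prods t Ps \<Longrightarrow> supp_on D P"
  and links_prods: "P \<in> prods t Ps \<Longrightarrow> links_some t R P"
  and strict_prods: "P \<in> prods t Ps \<Longrightarrow> P i j \<noteq> 0 \<Longrightarrow> i < j"
  using prods_props by blast+

text \<open>All nonzero rows of \<open>A\<close> lie in one class and all nonzero columns in one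
  class, so a class idempotent either keeps \<open>A\<close> or kills it.\<close>

lemma gmul_eidem_links:
  assumes "links_some t R A" "supp_on D A" "I \<in> classes t R"
  shows "gmul D (eidem I) A \<in> {0, A}" "gmul D A (eidem I) \<in> {0, A}"
proof -
  obtain J K where JK: "J \<in> classes t R" "K \<in> classes t R" "links J K A"
    using assms(1) by (auto simp: links_some_def)
  have I: "gmul D (eidem I) A = (\<lambda>i j. if i \<in> I then A i j else 0)"
    "gmul D A (eidem I) = (\<lambda>i j. if j \<in> I then A i j else 0)"
    using gmul_eidem_left[OF _ assms(2)] gmul_eidem_right[OF _ assms(2)] class_subset[OF assms(3)]
    by auto
  show "gmul D (eidem I) A \<in> {0, A}"
  proof (cases "I = J")
    case True
    then have "gmul D (eidem I) A = A"
      unfolding I using JK(3) by (intro ext) (auto simp: links_def)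
    then show ?thesis by simp
  next
    case False
    then have "gmul D (eidem I) A = 0"
      unfolding I using JK(3) classes_disjoint[OF assms(3) JK(1)]
      by (intro ext) (auto simp: links_def)
    then show ?thesis by simp
  qed
  show "gmul D A (eidem I) \<in> {0, A}"
  proof (cases "I = K")
    case True
    then have "gmul D A (eidem I) = A"
      unfolding I using JK(3) by (intro ext) (auto simp: links_def)
    then show ?thesis by simp
  next
    case False
    then have "gmul D A (eidem I) = 0"
      unfolding I using JK(3) classes_disjoint[OF assms(3) JK(2)]
      by (intro ext) (auto simp: links_def)
    then show ?thesis by simp
  qed
qed

lemma links_eidem: "I \<in> classes t R \<Longrightarrow> links I I (eidem I)"
  by (auto simp: links_def eidem_def)

lemma eidems_props:
  assumes "e \<in> eidems t R"
  shows "supp_on D e" "links_some t R e" "\<forall>i j. e i j \<noteq> 0 \<longrightarrow> i = j"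
proof -
  obtain I where I: "I \<in> classes t R" "e = eidem I" using assms unfolding eidems_def by blast
  show "supp_on D e"
    using class_subset[OF I(1)] by (auto simp: I(2) supp_on_def eidem_def)
  show "links_some t R e"
    unfolding I(2) links_some_def using I(1) links_eidem by blast
  show "\<forall>i j. e i j \<noteq> 0 \<longrightarrow> i = j"
    by (simp add: I(2) eidem_def)
qed

text \<open>Closed under multiplication up to zero, hence its linear span is already the generated
  algebra.\<close>

definition "\<Gamma>gens = eidems t R \<union> prods t Ps"

lemma \<Gamma>gens_props:
  assumes "x \<in> \<Gamma>gens"
  shows "supp_on D x" "links_some t R x" "\<forall>i j. x i j \<noteq> 0 \<longrightarrow> i \<le> j"
proof -
  have "x \<in> eidems t R \<or> x \<in> prods t Ps" using assms by (simp add: \<Gamma>gens_def)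
  then show "supp_on D x" "links_some t R x" "\<forall>i j. x i j \<noteq> 0 \<longrightarrow> i \<le> j"
    using eidems_props[of x] prods_props[of x] by (blast, blast, fastforce)
qed

lemma gmul_eidems:
  assumes "e \<in> eidems t R" "supp_on D x" "links_some t R x"
  shows "gmul D e x \<in> {0, x}" "gmul D x e \<in> {0, x}"
proof -
  obtain I where "I \<in> classes t R" "e = eidem I" using assms(1) unfolding eidems_def by blast
  then show "gmul D e x \<in> {0, x}" "gmul D x e \<in> {0, x}"
    using gmul_eidem_links[OF assms(3,2)] by auto
qed

lemma gmul_\<Gamma>gens:
  assumes "x \<in> \<Gamma>gens" "y \<in> \<Gamma>gens"
  shows "gmul D x y \<in> insert 0 \<Gamma>gens"
proof -
  consider "x \<in> eidems t R" | "y \<in> eidems t R" | "x \<in> prods t Ps" "y \<in> prods t Ps"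
    using assms unfolding \<Gamma>gens_def by blast
  then show ?thesis
  proof cases
    case 1
    then show ?thesis
      using gmul_eidems(1)[OF 1 \<Gamma>gens_props(1,2)[OF assms(2)]] assms(2) by auto
  next
    case 2
    then show ?thesis
      using gmul_eidems(2)[OF 2 \<Gamma>gens_props(1,2)[OF assms(1)]] assms(1) by auto
  next
    case 3
    then show ?thesis unfolding \<Gamma>gens_def by (simp add: prods_gmul)
  qed
qed

text \<open>The identity is not among the generators in general; it enters their span because the
  classes partition the indices.\<close>

lemma mone_eq_sum: "(mone t :: 'a mat) = (\<Sum>I\<in>classes t R. eidem I)"
proof (intro ext)
  fix i j
  show "(mone t :: 'a mat) i j = (\<Sum>I\<in>classes t R. eidem I) i j"
  proof (cases "i = j \<and> i < t")
    case True
    have "(\<Sum>I\<in>classes t R. eidem I i j) = (\<Sum>I\<in>classes t R. if I = R `` {i} then 1 else (0::'a))"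
    proof (rule sum.cong[OF refl])
      fix I assume I: "I \<in> classes t R"
      have "i \<in> I \<longleftrightarrow> I = R `` {i}"
        using True class_of[of i] classes_disjoint[OF I, of "R `` {i}" i] by blast
      then show "eidem I i j = (if I = R `` {i} then 1 else (0::'a))"
        using True by (simp add: eidem_def)
    qed
    also have "\<dots> = 1" using True class_of finite_classes by simp
    finally show ?thesis using True by (simp add: mone_def sum_apply2)
  next
    case False
    then have "(eidem I :: 'a mat) i j = 0" if "I \<in> classes t R" for I
      using that classes_less by (auto simp: eidem_def)
    then show ?thesis using False by (simp add: mone_def sum_apply2)
  qed
qed

lemma msubalg_span: "msubalg t (mat_vs.span \<Gamma>gens)"
  unfolding msubalg_def msubspace_iff mat_as_generic(1,3)
proof (intro conjI ballI)
  show "mone t \<in> mat_vs.span \<Gamma>gens"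
    unfolding mone_eq_sum \<Gamma>gens_def eidems_def
    by (intro mat_vs.span_sum mat_vs.span_base) blast
  show "supp_on D A" if "A \<in> mat_vs.span \<Gamma>gens" for A
    using that \<Gamma>gens_props(1) by (intro span_supp_on[OF that]) blast
  show "gmul D A B \<in> mat_vs.span \<Gamma>gens" if "A \<in> mat_vs.span \<Gamma>gens" "B \<in> mat_vs.span \<Gamma>gens" for A B
  proof (rule gmul_span[OF that])
    fix x y assume "x \<in> \<Gamma>gens" "y \<in> \<Gamma>gens"
    then show "gmul D x y \<in> mat_vs.span \<Gamma>gens"
      by (intro insert_zero_in_span gmul_\<Gamma>gens)
  qed
qed (rule mat_vs.subspace_span)

lemma gen_alg_eq: "gen_alg t (Ps \<union> {eidem I | I. I \<in> classes t R}) = mat_vs.span \<Gamma>gens"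
proof
  have "Ps \<union> {eidem I | I. I \<in> classes t R} \<subseteq> mat_vs.span \<Gamma>gens"
  proof -
    have "Ps \<union> {eidem I | I. I \<in> classes t R} \<subseteq> \<Gamma>gens"
      unfolding \<Gamma>gens_def eidems_def using prods.base by blast
    then show ?thesis using mat_vs.span_superset by blast
  qed
  then show "gen_alg t (Ps \<union> {eidem I | I. I \<in> classes t R}) \<subseteq> mat_vs.span \<Gamma>gens"
    unfolding gen_alg_def using msubalg_span by blast
  show "mat_vs.span \<Gamma>gens \<subseteq> gen_alg t (Ps \<union> {eidem I | I. I \<in> classes t R})"
    unfolding gen_alg_def
  proof (rule Inter_greatest)
    fix A assume "A \<in> {A. msubalg t A \<and> Ps \<union> {eidem I | I. I \<in> classes t R} \<subseteq> A}"
    then have A: "msubalg t A" "Ps \<subseteq> A" "eidems t R \<subseteq> A" unfolding eidems_def by blast+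
    have "P \<in> A" if "P \<in> prods t Ps" for P
      using that
    proof (induction rule: prods.induct)
      case (base P)
      then show ?case using A(2) by blast
    next
      case (step P Q)
      then show ?case using A(1,2) unfolding msubalg_def by blast
    qed
    then have "\<Gamma>gens \<subseteq> A" using A(3) unfolding \<Gamma>gens_def by blast
    then show "mat_vs.span \<Gamma>gens \<subseteq> A"
      using A(1) unfolding msubalg_def msubspace_iff by (intro mat_vs.span_minimal) blast+
  qed
qed

section \<open>The bimodule of a triple\<close>

lemma Vset_eq: "Vset t Ps Vs = {gmul D (gmul D P V) P' | P V P'.
    P \<in> insert (gone D) (prods t Ps) \<and> V \<in> Vs \<and> P' \<in> insert (gone D) (prods t Ps)}"
  by (simp add: Vset_def mat_as_generic)

lemma supp_on_Vs: "V \<in> Vs \<Longrightarrow> supp_on D V" and links_Vs: "V \<in> Vs \<Longrightarrow> links_some t R V"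
  using triple by (auto simp: triple_def mat_as_generic)

lemma Vset_props:
  assumes "v \<in> Vset t Ps Vs"
  shows "supp_on D v" "links_some t R v"
proof -
  obtain P V P' where v: "v = gmul D (gmul D P V) P'" and
    *: "P = gone D \<or> P \<in> prods t Ps" "V \<in> Vs" "P' = gone D \<or> P' \<in> prods t Ps"
    using assms unfolding Vset_eq by blast
  show "supp_on D v" by (simp add: v)
  have "links_some t R (gmul D P V)"
    using *(1)
  proof
    assume "P = gone D"
    then show ?thesis using *(2) by (simp add: supp_on_Vs links_Vs)
  next
    assume "P \<in> prods t Ps"
    then show ?thesis using *(2) by (intro links_some_gmul links_prods links_Vs)
  qed
  with *(3) show "links_some t R v"
    unfolding v by (elim disjE) (simp_all add: links_some_gmul links_prods)
qed

lemma prods_gmul_insert: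
  assumes "P \<in> prods t Ps" "Q \<in> insert (gone D) (prods t Ps)"
  shows "gmul D P Q \<in> prods t Ps" "gmul D Q P \<in> prods t Ps"
  using assms supp_on_prods[OF assms(1)] by (auto simp: prods_gmul)

lemma prods_gmul_Vset:
  assumes "P \<in> prods t Ps" "v \<in> Vset t Ps Vs"
  shows "gmul D P v \<in> Vset t Ps Vs" "gmul D v P \<in> Vset t Ps Vs"
proof -
  obtain Q V Q' where v: "v = gmul D (gmul D Q V) Q'" and
    Q: "Q \<in> insert (gone D) (prods t Ps)" "V \<in> Vs" "Q' \<in> insert (gone D) (prods t Ps)"
    using assms(2) unfolding Vset_eq by blast
  have "gmul D P v = gmul D (gmul D (gmul D P Q) V) Q'"
    "gmul D v P = gmul D (gmul D Q V) (gmul D Q' P)"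
    by (simp_all add: v gmul_assoc)
  then show "gmul D P v \<in> Vset t Ps Vs" "gmul D v P \<in> Vset t Ps Vs"
    using Q prods_gmul_insert[OF assms(1)] unfolding Vset_eq by blast+
qed

text \<open>\<open>gen_bimod\<close> demands closure under single generators \<open>P\<close> only.
  Associativity passes this on to their products, and with the identity as a further factor this
  yields all of \<open>Vset\<close>.\<close>

lemma gen_bimod_eq: "gen_bimod t Ps Vs = mat_vs.span (Vset t Ps Vs)"
proof
  have Vs: "V \<in> Vset t Ps Vs" if "V \<in> Vs" for V
  proof -
    have "V = gmul D (gmul D (gone D) V) (gone D)" using that by (simp add: supp_on_Vs)
    then show ?thesis using that unfolding Vset_eq by blast
  qed
  have "msubspace t (mat_vs.span (Vset t Ps Vs))"
    unfolding msubspace_iff mat_as_generic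
  proof (intro conjI ballI mat_vs.subspace_span)
    show "supp_on D A" if "A \<in> mat_vs.span (Vset t Ps Vs)" for A
      using Vset_props(1) by (intro span_supp_on[OF that]) blast
  qed
  moreover have "Vs \<subseteq> mat_vs.span (Vset t Ps Vs)" using Vs by (auto intro: mat_vs.span_base)
  moreover have "mmult t P X \<in> mat_vs.span (Vset t Ps Vs) \<and> mmult t X P \<in> mat_vs.span (Vset t Ps Vs)"
    if "P \<in> Ps" "X \<in> mat_vs.span (Vset t Ps Vs)" for P X
  proof
    note P = prods_gmul_Vset[OF prods.base[OF that(1)]]
    show "mmult t P X \<in> mat_vs.span (Vset t Ps Vs)"
      unfolding mat_as_generic
      by (rule span_image_mem[where f = "gmul D P", OF that(2)])
        (simp_all add: gmul_linear P mat_vs.span_base)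
    show "mmult t X P \<in> mat_vs.span (Vset t Ps Vs)"
      unfolding mat_as_generic
      by (rule span_image_mem[where f = "\<lambda>X. gmul D X P", OF that(2)])
        (simp_all add: gmul_linear P mat_vs.span_base)
  qed
  ultimately show "gen_bimod t Ps Vs \<subseteq> mat_vs.span (Vset t Ps Vs)"
    unfolding gen_bimod_def by blast
  show "mat_vs.span (Vset t Ps Vs) \<subseteq> gen_bimod t Ps Vs"
    unfolding gen_bimod_def
  proof (rule Inter_greatest)
    fix S assume "S \<in> {S. msubspace t S \<and> Vs \<subseteq> S \<and>
      (\<forall>P\<in>Ps. \<forall>X\<in>S. mmult t P X \<in> S \<and> mmult t X P \<in> S)}"
    then have S: "msubspace t S" "Vs \<subseteq> S" "\<And>P X. P \<in> Ps \<Longrightarrow> X \<in> S \<Longrightarrow> gmul D P X \<in> S"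
      "\<And>P X. P \<in> Ps \<Longrightarrow> X \<in> S \<Longrightarrow> gmul D X P \<in> S"
      by (auto simp: mat_as_generic)
    have closed: "gmul D P X \<in> S \<and> gmul D X P \<in> S" if "P \<in> prods t Ps" "X \<in> S" for P X
      using that
    proof (induction arbitrary: X rule: prods.induct)
      case (base P)
      then show ?case using S(3,4) by blast
    next
      case (step P Q)
      then have "gmul D P (gmul D Q X) \<in> S" "gmul D (gmul D X P) Q \<in> S"
        using S(3,4) by blast+
      then show ?case by (simp add: mat_as_generic gmul_assoc)
    qed
    have closed_one: "gmul D (gone D) X \<in> S" "gmul D X (gone D) \<in> S" if "X \<in> S" for X
    proof -
      have "supp_on D X" using that S(1) by (auto simp: msubspace_iff mat_as_generic)
      then show "gmul D (gone D) X \<in> S" "gmul D X (gone D) \<in> S" using that by auto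
    qed
    have "Vset t Ps Vs \<subseteq> S"
    proof
      fix v assume "v \<in> Vset t Ps Vs"
      then obtain P V P' where v: "v = gmul D (gmul D P V) P'" and
        *: "P = gone D \<or> P \<in> prods t Ps" "V \<in> Vs" "P' = gone D \<or> P' \<in> prods t Ps"
        unfolding Vset_eq by blast
      have "V \<in> S" using * S(2) by blast
      then have "gmul D P V \<in> S" using *(1) closed closed_one by blast
      then show "v \<in> S" unfolding v using *(3) closed closed_one by blast
    qed
    then show "mat_vs.span (Vset t Ps Vs) \<subseteq> S"
      using S(1) unfolding msubspace_iff by (intro mat_vs.span_minimal) blast+
  qed
qed

lemma gmul_\<Gamma>gens_Vset:
  assumes "x \<in> \<Gamma>gens" "v \<in> Vset t Ps Vs"
  shows "gmul D x v \<in> insert 0 (Vset t Ps Vs)" "gmul D v x \<in> insert 0 (Vset t Ps Vs)"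
proof -
  have "x \<in> eidems t R \<or> x \<in> prods t Ps" using assms(1) by (simp add: \<Gamma>gens_def)
  then show "gmul D x v \<in> insert 0 (Vset t Ps Vs)" "gmul D v x \<in> insert 0 (Vset t Ps Vs)"
    using gmul_eidems[OF _ Vset_props[OF assms(2)], of x] prods_gmul_Vset[OF _ assms(2), of x] assms(2)
    by auto
qed

lemma set_mult_\<Gamma>:
  "set_mult t (mat_vs.span \<Gamma>gens) (mat_vs.span (Vset t Ps Vs)) \<subseteq> mat_vs.span (Vset t Ps Vs)"
  "set_mult t (mat_vs.span (Vset t Ps Vs)) (mat_vs.span \<Gamma>gens) \<subseteq> mat_vs.span (Vset t Ps Vs)"
proof -
  have "gmul D A B \<in> mat_vs.span (Vset t Ps Vs)" "gmul D B A \<in> mat_vs.span (Vset t Ps Vs)"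
    if A: "A \<in> mat_vs.span \<Gamma>gens" and B: "B \<in> mat_vs.span (Vset t Ps Vs)" for A B
    using gmul_span[OF A B insert_zero_in_span[OF gmul_\<Gamma>gens_Vset(1)]]
      gmul_span[OF B A insert_zero_in_span[OF gmul_\<Gamma>gens_Vset(2)]] by simp_all
  then show "set_mult t (mat_vs.span \<Gamma>gens) (mat_vs.span (Vset t Ps Vs)) \<subseteq> mat_vs.span (Vset t Ps Vs)"
    "set_mult t (mat_vs.span (Vset t Ps Vs)) (mat_vs.span \<Gamma>gens) \<subseteq> mat_vs.span (Vset t Ps Vs)"
    unfolding set_mult_def mat_as_generic by auto
qed

section \<open>Diagonal part and radical of the algebra\<close>

lemma span_eidems_diag: "(A :: 'a mat) \<in> mat_vs.span (eidems t R) \<Longrightarrow> A i j \<noteq> 0 \<Longrightarrow> i = j"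
  using span_support[of A "eidems t R" "(=)"] eidems_props(3) by blast

lemma span_prods_strict: "A \<in> mat_vs.span (prods t Ps) \<Longrightarrow> A i j \<noteq> 0 \<Longrightarrow> i < j"
  using span_support[of A "prods t Ps" "(<)"] strict_prods by blast

text \<open>Idempotents are diagonal and products strictly upper triangular, so the idempotent
  summand of \<open>S\<close> can only be its diagonal part.\<close>

lemma \<Gamma>_decompose:
  assumes "S \<in> mat_vs.span \<Gamma>gens"
  obtains N where "N \<in> mat_vs.span (prods t Ps)" "diag_part S \<in> mat_vs.span (eidems t R)"
    "S = diag_part S + N"
proof -
  obtain E N where E: "E \<in> mat_vs.span (eidems t R)" "N \<in> mat_vs.span (prods t Ps)" "S = E + N"
    using assms unfolding \<Gamma>gens_def mat_vs.span_Un by blast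
  have "diag_part S i j = E i j" for i j
    using span_eidems_diag[OF E(1), of i j] span_prods_strict[OF E(2), of i j]
    by (auto simp: diag_part_def E(3))
  then have "diag_part S = E" by (intro ext)
  with E that show thesis by simp
qed

lemma basic_alg_\<Gamma>: "basic_alg t (mat_vs.span \<Gamma>gens)"
  unfolding basic_alg_def
proof (intro conjI ballI msubalg_span)
  fix S assume S: "S \<in> mat_vs.span \<Gamma>gens"
  show "upper_tri S"
    unfolding upper_tri_def
    using span_support[OF S, where Q = "(\<le>)"] \<Gamma>gens_props(3) by blast
  show "diag_part S \<in> mat_vs.span \<Gamma>gens"
    using \<Gamma>_decompose[OF S] mat_vs.span_mono[of "eidems t R" \<Gamma>gens] unfolding \<Gamma>gens_def by blast
qed

lemma alg_rel_\<Gamma>: "alg_rel t (mat_vs.span \<Gamma>gens) R"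
  unfolding alg_rel_def lspan_eq_span eidems_def[symmetric]
proof (intro conjI equiv subset_antisym subsetI)
  fix E assume "E \<in> {E \<in> mat_vs.span \<Gamma>gens. is_diagonal E}"
  then have E: "E \<in> mat_vs.span \<Gamma>gens" "diag_part E = E"
    by (auto simp: is_diagonal_def diag_part_def fun_eq_iff)
  then show "E \<in> mat_vs.span (eidems t R)" using \<Gamma>_decompose[OF E(1)] by metis
next
  fix E :: "'a mat"
  assume E: "E \<in> mat_vs.span (eidems t R)"
  then have "E \<in> mat_vs.span \<Gamma>gens"
    using mat_vs.span_mono[of "eidems t R" \<Gamma>gens] unfolding \<Gamma>gens_def by blast
  then show "E \<in> {E \<in> mat_vs.span \<Gamma>gens. is_diagonal E}"
    using span_eidems_diag[OF E] by (auto simp: is_diagonal_def)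
qed

end

section \<open>Block matrices attached to a triple\<close>

locale blown_triple = matrix_triple + step_sequence

context blown_triple
begin

text \<open>The bimodule has no restriction on positions, hence the constant predicate
  \<open>Q\<close>; an equation holds on the span as soon as it holds on
  \<open>Vset\<close>.\<close>

lemma Mtr_eq_M_n: "Mtr t R Ps Vs n = M_n t (mat_vs.span (Vset t Ps Vs)) R n"
proof -
  have "M_eq t (mat_vs.span (Vset t Ps Vs)) R c
      \<longleftrightarrow> block_equation t R (\<lambda>_ _. True) (Vset t Ps Vs) c" for c
  proof -
    have "(\<forall>A\<in>mat_vs.span (Vset t Ps Vs). pairing t c A = 0)
        \<longleftrightarrow> (\<forall>A\<in>Vset t Ps Vs. pairing t c A = 0)"
      using pairing_span[of _ "Vset t Ps Vs" t c] mat_vs.span_base by blast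
    then show ?thesis
      unfolding M_eq_def block_equation_def pairing_def links_def by simp
  qed
  then have "A \<in> M_n t (mat_vs.span (Vset t Ps Vs)) R n \<longleftrightarrow> A \<in> blowup t R n (Vset t Ps Vs)" for A
    using Vset_props(2)
    by (subst blowup_iff[where Q = "\<lambda>_ _. True"])
      (auto simp: M_n_def bmat_as_generic pairing_def slice_def)
  moreover have "Mtr t R Ps Vs n = blowup t R n (Vset t Ps Vs)"
    by (simp add: Mtr_def lspan_eq_span blowup_def blow_gens_def)
  ultimately show ?thesis by blast
qed

abbreviation "\<Gamma>n \<equiv> Gamma_n t (mat_vs.span \<Gamma>gens) R n"

text \<open>The condition that two diagonal entries agree, written as a pairing, so that
  \<open>blowup_subset\<close> can transfer it to the blocks.\<close>

lemma pairing_diff: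
  fixes A :: "'b::field mat"
  assumes "i < t" "j < t" "i \<noteq> j"
  shows "pairing t (\<lambda>x y. if x = y then (if x = i then 1 else if x = j then - 1 else 0) else 0) A
    = A i i - A j j"
proof -
  have "pairing t (\<lambda>x y. if x = y then (if x = i then 1 else if x = j then - 1 else 0) else 0) A
    = (\<Sum>(x, y)\<in>{(i, i), (j, j)}.
      (if x = y then (if x = i then 1 else if x = j then - 1 else 0) else 0) * A x y)"
    using assms by (intro pairing_eq_sum) (auto split: if_splits)
  also have "\<dots> = A i i - A j j" using assms by simp
  finally show ?thesis .
qed

lemma blowup_subset_\<Gamma>n: "blowup t R n \<Gamma>gens \<subseteq> \<Gamma>n"
proof
  fix S assume S: "S \<in> blowup t R n \<Gamma>gens"
  have le: "\<forall>x\<in>\<Gamma>gens. \<forall>i j. x i j \<noteq> 0 \<longrightarrow> i \<le> j" using \<Gamma>gens_props(3) by blast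
  note S' = blowup_subset[OF le S]
  show "S \<in> \<Gamma>n"
    unfolding Gamma_n_def
  proof (intro CollectI conjI allI impI)
    show "bwf t n S" using S'(1) by (simp add: bmat_as_generic)
    show "S (i, l) (j, r) = 0" if "j < i" for i l j r
      using S'(2)[of i l j r] that by fastforce
    show "S (i, l) (i, r) = S (j, l) (j, r)" if ij: "(i, j) \<in> R" for i j l r
    proof (cases "i = j")
      case False
      let ?c = "\<lambda>x y. if x = y then (if x = i then 1 else if x = j then - 1 else 0) else 0"
      have t: "i < t" "j < t" using related_less[OF ij] by auto
      have "x i i = x j j" if x: "x \<in> \<Gamma>gens" for x
      proof (cases "x \<in> prods t Ps")
        case True
        then have "x i i = 0" "x j j = 0" using strict_prods[OF True] by blast+
        then show ?thesis by simp
      next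
        case False
        then obtain I where I: "I \<in> classes t R" "x = eidem I"
          using x unfolding \<Gamma>gens_def eidems_def by blast
        have "(j, i) \<in> R" using ij equiv by (meson equivE symD)
        then have "i \<in> I \<longleftrightarrow> j \<in> I" using I(1) ij classes_closed by blast
        then show ?thesis by (simp add: I eidem_def)
      qed
      then have "\<forall>x\<in>\<Gamma>gens. pairing t ?c x = 0"
        unfolding pairing_diff[OF t False] by (intro ballI) simp
      then have "pairing t ?c (slice S l r) = 0" by (rule S'(3))
      then show ?thesis
        unfolding pairing_diff[OF t False] by (simp add: slice_def)
    qed simp
    show "(\<Sum>i<t. \<Sum>j<t. c i j * S (i, l) (j, r)) = 0"
      if "gamma_eq t (mat_vs.span \<Gamma>gens) R c" for c l r
    proof -
      have "\<forall>x\<in>\<Gamma>gens. pairing t c x = 0"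
        using that mat_vs.span_base unfolding gamma_eq_def pairing_def by blast
      from S'(3)[OF this, of l r] show ?thesis by (simp add: pairing_def slice_def)
    qed
  qed
qed

text \<open>A diagonal equation concerns a single class \<open>I\<close>. There the diagonal of a
  slice is constant, so on the positions of the equation the slice is a multiple of
  \<open>eidem I\<close>, where the equation vanishes.\<close>

lemma diag_in_blowup:
  assumes supp: "supp_on (bidx t n) A"
    and diag: "\<forall>i j l r. A (i, l) (j, r) \<noteq> 0 \<longrightarrow> i = j"
    and inv: "\<forall>i j l r. (i, j) \<in> R \<longrightarrow> A (i, l) (i, r) = A (j, l) (j, r)"
  shows "A \<in> blowup t R n (eidems t R)"
proof -
  have "pairing t c (slice A l r) = 0" if eqn: "block_equation t R (=) (eidems t R) c" for c l r
  proof -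
    obtain I J where I: "I \<in> classes t R"
      and c: "\<forall>i j. c i j \<noteq> 0 \<longrightarrow> i \<in> I \<and> j \<in> J \<and> i = j"
      using eqn unfolding block_equation_def by blast
    have "pairing t c (eidem I) = 0"
      using eqn I unfolding block_equation_def eidems_def by blast
    obtain k where k: "k \<in> I" using classes_nonempty[OF I] by blast
    have "pairing t c (slice A l r) = pairing t c (scl (A (k, l) (k, r)) (eidem I))"
    proof (rule pairing_cong)
      fix i j assume "c i j \<noteq> 0"
      then have ij: "i = j" "i \<in> I" using c by blast+
      then have "A (i, l) (i, r) = A (k, l) (k, r)"
        using inv classes_related[OF I _ k] by blast
      then show "slice A l r i j = scl (A (k, l) (k, r)) (eidem I) i j"
        using ij by (simp add: slice_def eidem_def)
    qed
    then show ?thesis by (simp add: pairing_linear \<open>pairing t c (eidem I) = 0\<close>)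
  qed
  then show ?thesis
    using supp diag eidems_props by (subst blowup_iff[where Q = "(=)"]) blast+
qed

definition block_diag_part :: "'a bmat \<Rightarrow> 'a bmat" where
  "block_diag_part S = (\<lambda>x y. if fst x = fst y then S x y else 0)"

text \<open>A strictly upper equation that kills the products also kills the idempotents, which have
  no entries above the diagonal. So it is one of the equations imposed on \<open>S\<close>, and
  removing the diagonal blocks does not change its value.\<close>

lemma \<Gamma>n_decompose:
  assumes "S \<in> \<Gamma>n"
  shows "block_diag_part S \<in> blowup t R n (eidems t R)"
    "S - block_diag_part S \<in> blowup t R n (prods t Ps)"
proof -
  have supp: "supp_on (bidx t n) S" using assms by (simp add: Gamma_n_def bmat_as_generic)
  have low: "S (i, l) (j, r) = 0" if "j < i" for i j l r using assms that by (simp add: Gamma_n_def)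
  have inv: "S (i, l) (i, r) = S (j, l) (j, r)" if "(i, j) \<in> R" for i j l r
    using assms that unfolding Gamma_n_def by blast
  show "block_diag_part S \<in> blowup t R n (eidems t R)"
  proof (rule diag_in_blowup)
    show "supp_on (bidx t n) (block_diag_part S)"
      using supp by (simp add: supp_on_def block_diag_part_def)
    show "\<forall>i j l r. (i, j) \<in> R \<longrightarrow>
        block_diag_part S (i, l) (i, r) = block_diag_part S (j, l) (j, r)"
      using inv by (simp add: block_diag_part_def)
  qed (simp add: block_diag_part_def)
  let ?N = "S - block_diag_part S"
  have "pairing t c (slice ?N l r) = 0" if c: "block_equation t R (<) (prods t Ps) c" for c l r
  proof -
    have lt: "i < j" if "c i j \<noteq> 0" for i j using c that unfolding block_equation_def by blast
    have "pairing t c x = 0" if "x \<in> \<Gamma>gens" for x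
    proof (cases "x \<in> prods t Ps")
      case True
      then show ?thesis using c unfolding block_equation_def by blast
    next
      case False
      then have "\<forall>i j. x i j \<noteq> 0 \<longrightarrow> i = j"
        using that eidems_props(3) unfolding \<Gamma>gens_def by blast
      then have "pairing t c x = pairing t c 0"
        using lt by (intro pairing_cong) fastforce
      then show ?thesis by (simp add: pairing_linear)
    qed
    then have "\<forall>A\<in>mat_vs.span \<Gamma>gens. pairing t c A = 0"
      using pairing_span by blast
    then have "gamma_eq t (mat_vs.span \<Gamma>gens) R c"
      using c unfolding gamma_eq_def block_equation_def pairing_def by blast
    then have "pairing t c (slice S l r) = 0"
      using assms unfolding Gamma_n_def pairing_def slice_def by blast
    moreover have "pairing t c (slice ?N l r) = pairing t c (slice S l r)"
      using lt by (intro pairing_cong) (fastforce simp: slice_def block_diag_part_def)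
    ultimately show ?thesis by simp
  qed
  moreover have "supp_on (bidx t n) ?N"
    using supp by (simp add: supp_on_def block_diag_part_def)
  moreover have "i < j" if "?N (i, l) (j, r) \<noteq> 0" for i j l r
    using that low[of j i l r] by (cases i j rule: linorder_cases) (auto simp: block_diag_part_def)
  ultimately show "?N \<in> blowup t R n (prods t Ps)"
    using prods_props by (subst blowup_iff[where Q = "(<)"]) blast+
qed

lemma \<Gamma>n_eq: "\<Gamma>n = blowup t R n \<Gamma>gens"
proof (intro subset_antisym blowup_subset_\<Gamma>n subsetI)
  fix S assume "S \<in> \<Gamma>n"
  from \<Gamma>n_decompose[OF this]
  have "block_diag_part S + (S - block_diag_part S) \<in> blowup t R n \<Gamma>gens"
    unfolding \<Gamma>gens_def blowup_Un by blast
  then show "S \<in> blowup t R n \<Gamma>gens" by simp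
qed

end

section \<open>Triple equivalence and similarity\<close>

lemma blowup_closed:
  "0 \<in> blowup t R n X"
  "A \<in> blowup t R n X \<Longrightarrow> B \<in> blowup t R n X \<Longrightarrow> A + B \<in> blowup t R n X"
  "A \<in> blowup t R n X \<Longrightarrow> B \<in> blowup t R n X \<Longrightarrow> A - B \<in> blowup t R n X"
  "A \<in> blowup t R n X \<Longrightarrow> - A \<in> blowup t R n X"
  "A \<in> blowup t R n X \<Longrightarrow> scl c A \<in> blowup t R n X"
  unfolding blowup_def
  by (simp_all add: mat_vs.span_zero mat_vs.span_add mat_vs.span_diff mat_vs.span_neg mat_vs.span_scale)

lemma supp_on_blowup: "A \<in> blowup t R n X \<Longrightarrow> supp_on (bidx t n) A"
  unfolding blowup_def
  by (rule span_supp_on) (auto simp: blow_gens_def supp_on_bup)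

section \<open>Powers of the radical\<close>

context matrix_triple
begin

text \<open>Products of at least m + 1 of the generators: their span is the power m + 1 of the
  radical. The shift by one lets layer 0 be the radical itself.\<close>

primrec prods_ge :: "nat \<Rightarrow> 'a mat set" where
  "prods_ge 0 = prods t Ps"
| "prods_ge (Suc m) = {gmul D P Q | P Q. P \<in> prods_ge m \<and> Q \<in> prods t Ps}"

lemma prods_ge_subset_prods: "prods_ge m \<subseteq> prods t Ps"
  by (induction m) (auto intro: prods_gmul)

lemma prods_ge_Suc_subset: "prods_ge (Suc m) \<subseteq> prods_ge m"
proof (induction m)
  case 0
  then show ?case using prods_ge_subset_prods[of "Suc 0"] by simp
next
  case (Suc m)
  then show ?case unfolding prods_ge.simps(2)[of "Suc m"] prods_ge.simps(2)[of m] by blast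
qed

lemma prods_ge_strict: "P \<in> prods_ge m \<Longrightarrow> P i j \<noteq> 0 \<Longrightarrow> i + m < j"
proof (induction m arbitrary: P j)
  case 0
  then show ?case using strict_prods by simp
next
  case (Suc m)
  obtain P' Q where P: "P = gmul D P' Q" "P' \<in> prods_ge m" "Q \<in> prods t Ps"
    using Suc.prems(1) by auto
  obtain k where "P' i k \<noteq> 0" "Q k j \<noteq> 0"
    using Suc.prems(2) unfolding P(1) by (rule gmul_nonzeroE)
  then have "i + m < k" "k < j" using Suc.IH[OF P(2)] strict_prods[OF P(3)] by blast+
  then show ?case by simp
qed

lemma prods_ge_zero:
  assumes "t \<le> m"
  shows "prods_ge m \<subseteq> {0}"
proof
  fix P assume P: "P \<in> prods_ge m"
  have supp: "supp_on D P" using P prods_ge_subset_prods supp_on_prods by blast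
  have "P i j = 0" for i j
  proof (rule ccontr)
    assume nz: "P i j \<noteq> 0"
    then have "j < t" using supp unfolding supp_on_def by blast
    then show False using prods_ge_strict[OF P nz] assms by simp
  qed
  then show "P \<in> {0}" by (simp add: fun_eq_iff)
qed

text \<open>The layers are right ideals up to zero, so an error term deep in the filtration stays
  there when multiplied by any element of the blown-up algebra.\<close>

lemma gmul_prods_ge_\<Gamma>gens:
  assumes "P \<in> prods_ge m" "x \<in> \<Gamma>gens"
  shows "gmul D P x \<in> insert 0 (prods_ge m)"
proof (cases "x \<in> prods t Ps")
  case True
  then have "gmul D P x \<in> prods_ge (Suc m)" using assms(1) by auto
  then show ?thesis using prods_ge_Suc_subset by blast
next
  case False
  then have "x \<in> eidems t R" using assms(2) by (simp add: \<Gamma>gens_def)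
  moreover have "P \<in> prods t Ps" using assms(1) prods_ge_subset_prods by blast
  ultimately have "gmul D P x \<in> {0, P}" by (intro gmul_eidems(2) supp_on_prods links_prods)
  then show ?thesis using assms(1) by auto
qed

lemma eidems_subset_\<Gamma>gens: "eidems t R \<subseteq> \<Gamma>gens" and prods_subset_\<Gamma>gens: "prods t Ps \<subseteq> \<Gamma>gens"
  by (auto simp: \<Gamma>gens_def)

lemma gmul_eidems_prods:
  assumes "e \<in> eidems t R" "P \<in> prods t Ps"
  shows "gmul D e P \<in> insert 0 (prods t Ps)" "gmul D P e \<in> insert 0 (prods t Ps)"
  using gmul_eidems[OF assms(1) supp_on_prods[OF assms(2)] links_prods[OF assms(2)]] assms(2) by auto

lemma gmul_eidems_eidems:
  assumes "e \<in> eidems t R" "f \<in> eidems t R"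
  shows "gmul D e f \<in> insert 0 (eidems t R)"
  using gmul_eidems(1)[OF assms(1) eidems_props(1,2)[OF assms(2)]] assms(2) by auto

end

text \<open>The diagonal blocks may vary freely with \<open>i\<close>; \<open>blockdiag\<close> is
  the case of one matrix repeated over a class and identities elsewhere.\<close>

definition bdiag :: "nat \<Rightarrow> (nat \<Rightarrow> nat) \<Rightarrow> (nat \<Rightarrow> 'a::field mat) \<Rightarrow> 'a bmat" where
  "bdiag t n F = (\<lambda>x y. if x \<in> bidx t n \<and> y \<in> bidx t n \<and> fst x = fst y
    then F (fst x) (snd x) (snd y) else 0)"

lemma bdiag_cong:
  assumes "\<And>i l r. i < t \<Longrightarrow> l < n i \<Longrightarrow> r < n i \<Longrightarrow> F i l r = F' i l r"
  shows "bdiag t n F = bdiag t n F'"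
  using assms by (intro ext) (auto simp: bdiag_def bidx_def)

lemma gone_bdiag: "gone (bidx t n) = bdiag t n (\<lambda>i. gone {..<n i})"
  by (intro ext) (auto simp: bdiag_def bidx_def gone_def)

lemma blockdiag_bdiag: "blockdiag t n I E = bdiag t n (\<lambda>i. if i \<in> I then E else gone {..<n i})"
proof (intro ext)
  fix x y :: "nat \<times> nat"
  obtain i a j b where xy: "x = (i, a)" "y = (j, b)" by (metis surj_pair)
  show "blockdiag t n I E x y = bdiag t n (\<lambda>i. if i \<in> I then E else gone {..<n i}) x y"
  proof (cases "(i, a) \<in> bidx t n \<and> (j, b) \<in> bidx t n \<and> i = j")
    case True
    then show ?thesis by (simp add: xy bdiag_def blockdiag_def gone_def bidx_def)
  next
    case False
    then have "blockdiag t n I E x y = 0"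
      unfolding xy blockdiag_def prod.case by (rule if_not_P)
    with False show ?thesis unfolding xy bdiag_def fst_conv by (simp only: if_False)
  qed
qed

lemma gmul_bdiag:
  "gmul (bidx t n) (bdiag t n F) (bdiag t n F') = bdiag t n (\<lambda>i. gmul {..<n i} (F i) (F' i))"
proof (intro ext)
  fix x y :: "nat \<times> nat"
  obtain i a j b where xy: "x = (i, a)" "y = (j, b)" by (metis surj_pair)
  show "gmul (bidx t n) (bdiag t n F) (bdiag t n F') x y
    = bdiag t n (\<lambda>i. gmul {..<n i} (F i) (F' i)) x y"
  proof (cases "x \<in> bidx t n \<and> y \<in> bidx t n")
    case True
    then have ij: "i < t" "j < t" "a < n i" "b < n j" by (auto simp: xy bidx_def)
    have bidx: "bidx t n = Sigma {..<t} (\<lambda>k. {..<n k})" by (auto simp: bidx_def)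
    have "gmul (bidx t n) (bdiag t n F) (bdiag t n F') x y
      = (\<Sum>z\<in>bidx t n. bdiag t n F x z * bdiag t n F' z y)"
      using True by (simp add: gmul_apply)
    also have "\<dots> = (\<Sum>k<t. \<Sum>s<n k. bdiag t n F x (k, s) * bdiag t n F' (k, s) y)"
      unfolding bidx by (subst sum.Sigma) (simp_all add: case_prod_beta)
    also have "\<dots> = (\<Sum>k<t. if k = i then (if i = j then \<Sum>s<n i. F i a s * F' i s b else 0) else 0)"
    proof (rule sum.cong[OF refl])
      fix k assume "k \<in> {..<t}"
      then have "bdiag t n F x (k, s) * bdiag t n F' (k, s) y
          = (if k = i \<and> i = j then F i a s * F' i s b else 0)" if "s < n k" for s
        using True that by (auto simp: bdiag_def xy bidx_def)
      then have "(\<Sum>s<n k. bdiag t n F x (k, s) * bdiag t n F' (k, s) y)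
          = (\<Sum>s<n k. if k = i \<and> i = j then F i a s * F' i s b else 0)"
        by (intro sum.cong) auto
      also have "\<dots> = (if k = i then (if i = j then \<Sum>s<n i. F i a s * F' i s b else 0) else 0)"
        by auto
      finally show "(\<Sum>s<n k. bdiag t n F x (k, s) * bdiag t n F' (k, s) y)
          = (if k = i then (if i = j then \<Sum>s<n i. F i a s * F' i s b else 0) else 0)" .
    qed
    also have "\<dots> = (if i = j then \<Sum>s<n i. F i a s * F' i s b else 0)" using ij by simp
    also have "\<dots> = bdiag t n (\<lambda>i. gmul {..<n i} (F i) (F' i)) x y"
      using True ij by (auto simp: bdiag_def xy gmul_apply)
    finally show ?thesis .
  qed (auto simp: gmul_apply bdiag_def)
qed

text \<open>The conjugating matrices of \<open>tstep\<close>, detached from the matrices they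
  transform, so that they can be multiplied and inverted on their own.\<close>

definition tgen ::
    "nat \<Rightarrow> (nat \<times> nat) set \<Rightarrow> 'a::field mat set \<Rightarrow> (nat \<Rightarrow> nat) \<Rightarrow> 'a bmat \<Rightarrow> bool" where
  "tgen t R Ps n S \<longleftrightarrow>
     (\<exists>I\<in>classes t R. \<exists>m E. (\<forall>i\<in>I. n i = m) \<and> elementary m E \<and> S = blockdiag t n I E) \<or>
     (\<exists>a P l r. P \<in> prods t Ps \<and> P \<noteq> (\<lambda>i j. 0) \<and> lr_ok t R n P l r \<and>
        S = (\<lambda>x y. bone t n x y + a * bup t n P l r x y))"

lemma tstep_iff: "tstep t R Ps n M N \<longleftrightarrow> (\<exists>S. tgen t R Ps n S \<and> sim_by t n S M N)"
  unfolding tstep_def tgen_def by blast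

lemma sim_by_iff: "sim_by t n S M N \<longleftrightarrow>
    (\<exists>S'. ginv (bidx t n) S S' \<and> N = gmul (bidx t n) (gmul (bidx t n) S' M) S)"
  unfolding sim_by_def ginv_def bmat_as_generic by blast

inductive_set tprods ::
    "nat \<Rightarrow> (nat \<times> nat) set \<Rightarrow> 'a::field mat set \<Rightarrow> (nat \<Rightarrow> nat) \<Rightarrow> 'a bmat set" for t R Ps n where
  one: "gone (bidx t n) \<in> tprods t R Ps n"
| step: "S \<in> tprods t R Ps n \<Longrightarrow> tgen t R Ps n g \<Longrightarrow> gmul (bidx t n) S g \<in> tprods t R Ps n"

lemma supp_on_tprods: "S \<in> tprods t R Ps n \<Longrightarrow> supp_on (bidx t n) S"
  by (induction rule: tprods.induct) simp_all

lemma tprods_gmul: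
  assumes "S' \<in> tprods t R Ps n" "S \<in> tprods t R Ps n"
  shows "gmul (bidx t n) S S' \<in> tprods t R Ps n"
  using assms(1)
proof (induction rule: tprods.induct)
  case one
  then show ?case using assms(2) supp_on_tprods[OF assms(2)] by simp
next
  case (step S' g)
  have "gmul (bidx t n) (gmul (bidx t n) S S') g \<in> tprods t R Ps n"
    using step.IH step.hyps(2) by (rule tprods.step)
  then show ?case by (simp add: gmul_assoc)
qed

section \<open>Factorization of invertible elements\<close>

context blown_triple
begin

abbreviation "B \<equiv> bidx t n"

lemma \<Gamma>n_gmul: "S \<in> \<Gamma>n \<Longrightarrow> S' \<in> \<Gamma>n \<Longrightarrow> gmul B S S' \<in> \<Gamma>n"
  unfolding \<Gamma>n_eq using gmul_blowup[OF _ _ gmul_\<Gamma>gens] by blast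

lemma supp_on_\<Gamma>n: "S \<in> \<Gamma>n \<Longrightarrow> supp_on B S"
  by (simp add: Gamma_n_def bmat_as_generic)

lemma bdiag_\<Gamma>n:
  assumes "\<And>i j. (i, j) \<in> R \<Longrightarrow> F i = F j"
  shows "bdiag t n F \<in> \<Gamma>n"
proof -
  have "bdiag t n F \<in> blowup t R n (eidems t R)"
  proof (rule diag_in_blowup)
    show "\<forall>i j l r. (i, j) \<in> R \<longrightarrow> bdiag t n F (i, l) (i, r) = bdiag t n F (j, l) (j, r)"
    proof (intro allI impI)
      fix i j l r assume ij: "(i, j) \<in> R"
      then have "n i = n j" using step_seq by (simp add: step_seq_def)
      then show "bdiag t n F (i, l) (i, r) = bdiag t n F (j, l) (j, r)"
        using related_less[OF ij] assms[OF ij] by (simp add: bdiag_def bidx_def)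
    qed
  qed (auto simp: bdiag_def supp_on_def)
  then show ?thesis
    unfolding \<Gamma>n_eq using blowup_mono[OF eidems_subset_\<Gamma>gens] by blast
qed

lemma gone_\<Gamma>n: "gone B \<in> \<Gamma>n"
  unfolding gone_bdiag using step_seq by (intro bdiag_\<Gamma>n) (simp add: step_seq_def)

lemma prods_blowup_\<Gamma>n: "N \<in> blowup t R n (prods t Ps) \<Longrightarrow> N \<in> \<Gamma>n"
  unfolding \<Gamma>n_eq using blowup_mono[OF prods_subset_\<Gamma>gens] by blast

lemma \<Gamma>n_add: "A \<in> \<Gamma>n \<Longrightarrow> A' \<in> \<Gamma>n \<Longrightarrow> A + A' \<in> \<Gamma>n"
  unfolding \<Gamma>n_eq by (rule blowup_closed)

lemma prods_ge_blowup: "N \<in> blowup t R n (prods_ge m) \<Longrightarrow> N \<in> blowup t R n (prods t Ps)"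
  using blowup_mono[OF prods_ge_subset_prods] by blast

lemma gmul_prods_ge_Suc:
  assumes "A \<in> blowup t R n (prods_ge m)" "A' \<in> blowup t R n (prods t Ps)"
  shows "gmul B A A' \<in> blowup t R n (prods_ge (Suc m))"
  using assms by (rule gmul_blowup) auto

text \<open>Since \<open>(1 + N)(1 - N) = 1 - N\<^sup>2\<close> and \<open>N\<^sup>2\<close> lies deeper in the filtration by length of products,
  the inverse is found by induction on the depth.\<close>

lemma unipotent_inverse:
  assumes "N \<in> blowup t R n (prods_ge m)"
  shows "\<exists>N'\<in>blowup t R n (prods t Ps). ginv B (gone B + N) (gone B + N')"
  using assms
proof (induction "t - m" arbitrary: m N)
  case 0
  then have "N = 0" using blowup_subset_zero[OF prods_ge_zero[of m]] by simp
  then show ?case by (intro bexI[of _ 0]) (simp_all add: blowup_closed)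
next
  case (Suc d)
  have N: "N \<in> blowup t R n (prods t Ps)" using Suc.prems by (rule prods_ge_blowup)
  have supp: "supp_on B N" using N by (rule supp_on_blowup)
  have "d = t - Suc m" using Suc.hyps(2) by simp
  moreover have "- gmul B N N \<in> blowup t R n (prods_ge (Suc m))"
    using gmul_prods_ge_Suc[OF Suc.prems N] by (rule blowup_closed)
  ultimately obtain K where K: "K \<in> blowup t R n (prods t Ps)"
    "ginv B (gone B + - gmul B N N) (gone B + K)"
    using Suc.hyps(1) by blast
  have supp_K: "supp_on B K" using K(1) by (rule supp_on_blowup)
  let ?p = "gone B + N" and ?q = "gone B - N" and ?k = "gone B + K"
  have pq: "gmul B ?p ?q = gone B + - gmul B N N" "gmul B ?q ?p = gone B + - gmul B N N"
    using supp by (simp_all add: gmul_linear)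
  have left: "gmul B (gmul B ?k ?q) ?p = gone B"
    using K(2) unfolding gmul_assoc pq by (simp add: ginv_def)
  have right: "gmul B ?p (gmul B ?q ?k) = gone B"
    using K(2) unfolding gmul_assoc[symmetric] pq by (simp add: ginv_def)
  have "gmul B ?k ?q = gmul B (gmul B ?k ?q) (gmul B ?p (gmul B ?q ?k))"
    unfolding right by simp
  also have "\<dots> = gmul B ?q ?k"
    unfolding gmul_assoc[symmetric, of B "gmul B ?k ?q"] left by simp
  finally have "ginv B ?p (gmul B ?k ?q)"
    using left right by (simp add: ginv_def)
  moreover have "gmul B ?k ?q = gone B + (K - N - gmul B K N)"
    using supp supp_K by (simp add: gmul_linear)
  moreover have "K - N - gmul B K N \<in> blowup t R n (prods t Ps)"
    using K(1) N gmul_blowup[OF K(1) N, of "prods t Ps"] prods_gmul by (intro blowup_closed) auto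
  ultimately show ?case by metis
qed

text \<open>Block-diagonal generators are inverted block by block; the others are 1 plus an element
  of the radical, which is layer 0 of \<open>unipotent_inverse\<close>.\<close>

lemma tgen_inverse:
  assumes "tgen t R Ps n g"
  shows "g \<in> \<Gamma>n \<and> (\<exists>g'\<in>\<Gamma>n. ginv B g g')"
  using assms unfolding tgen_def
proof (elim disjE bexE exE conjE)
  fix I m E assume I: "I \<in> classes t R" "\<forall>i\<in>I. n i = m" and E: "elementary m E"
    and g: "g = blockdiag t n I E"
  have mem: "blockdiag t n I E \<in> \<Gamma>n" for E
  proof -
    have "i \<in> I \<longleftrightarrow> j \<in> I" if "(i, j) \<in> R" for i j
    proof -
      have "(j, i) \<in> R" using that equiv by (meson equivE symD)
      then show ?thesis using that I(1) classes_closed by blast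
    qed
    then show ?thesis
      unfolding blockdiag_bdiag using step_seq by (intro bdiag_\<Gamma>n) (auto simp: step_seq_def)
  qed
  obtain E' where E': "ginv {..<m} E E'" using elementary_ginv(2)[OF E] by blast
  have mult: "gmul B (blockdiag t n I E) (blockdiag t n I F) = gone B"
    if "gmul {..<m} E F = gone {..<m}" for E F :: "'a mat"
    unfolding blockdiag_bdiag gmul_bdiag gone_bdiag using I(2) that by (intro bdiag_cong) auto
  have "ginv B g (blockdiag t n I E')"
    unfolding g ginv_def using E' by (simp add: mult ginv_def)
  then show ?thesis using mem g by blast
next
  fix a P l r assume P: "P \<in> prods t Ps" "lr_ok t R n P l r"
    and g: "g = (\<lambda>x y. bone t n x y + a * bup t n P l r x y)"
  have g': "g = gone B + scl a (bup t n P l r)"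
    by (simp add: g bmat_as_generic fun_eq_iff)
  have N: "scl a (bup t n P l r) \<in> blowup t R n (prods t Ps)"
    using P by (intro blowup_closed bup_in_blowup) auto
  then show ?thesis
    using unipotent_inverse[of "scl a (bup t n P l r)" 0] prods_blowup_\<Gamma>n \<Gamma>n_add[OF gone_\<Gamma>n]
    unfolding g' by auto
qed

lemma tprods_inverse:
  assumes "S \<in> tprods t R Ps n"
  shows "S \<in> \<Gamma>n \<and> (\<exists>S'\<in>\<Gamma>n. ginv B S S')"
  using assms
proof (induction rule: tprods.induct)
  case one
  then show ?case using gone_\<Gamma>n ginv_gone[OF finite_bidx] by blast
next
  case (step S g)
  obtain S' where S': "S' \<in> \<Gamma>n" "ginv B S S'" using step.IH by blast
  obtain g' where g': "g \<in> \<Gamma>n" "g' \<in> \<Gamma>n" "ginv B g g'" using tgen_inverse[OF step.hyps(2)] by blast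
  have "ginv B (gmul B S g) (gmul B g' S')" using S'(2) g'(3) by (intro ginv_gmul) simp_all
  then show ?case using \<Gamma>n_gmul step.IH S'(1) g'(1,2) by blast
qed

text \<open>Induction over the span: adding a multiple of a generator to \<open>N\<close> is
  imitated by appending one factor to the word \<open>U\<close>, and the cross terms this creates
  fall into the next layer.\<close>

lemma tprods_approx:
  assumes "N \<in> blowup t R n (prods_ge m)"
  shows "\<exists>U\<in>tprods t R Ps n. U - gone B - N \<in> blowup t R n (prods_ge (Suc m))"
proof -
  let ?h = "\<lambda>N. N \<in> blowup t R n (prods_ge m) \<and>
    (\<exists>U\<in>tprods t R Ps n. U - gone B - N \<in> blowup t R n (prods_ge (Suc m)))"
  have "?h N"
  proof (rule mat_vs.span_induct_alt[OF assms[unfolded blowup_def], where h = ?h])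
    show "?h 0"
      using tprods.one[of t n R Ps] by (auto simp: blowup_closed intro!: bexI[of _ "gone B"])
    fix c x y assume x: "x \<in> blow_gens t R n (prods_ge m)" and y: "?h y"
    obtain V l r where V: "x = bup t n V l r" "V \<in> prods_ge m" "V \<noteq> (\<lambda>i j. 0)" "lr_ok t R n V l r"
      using x unfolding blow_gens_def by blast
    have V': "V \<in> prods t Ps" using V(2) prods_ge_subset_prods by blast
    obtain U where U: "U \<in> tprods t R Ps n" "U - gone B - y \<in> blowup t R n (prods_ge (Suc m))"
      using y by blast
    have x': "x \<in> blowup t R n (prods_ge m)" unfolding blowup_def using x by (rule mat_vs.span_base)
    note x'' = prods_ge_blowup[OF x']
    let ?g = "gone B + scl c x"
    have "?g = (\<lambda>x y. bone t n x y + c * bup t n V l r x y)"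
      by (simp add: V(1) bmat_as_generic fun_eq_iff)
    then have "tgen t R Ps n ?g"
      unfolding tgen_def using V' V(3,4) by blast
    then have U': "gmul B U ?g \<in> tprods t R Ps n" by (rule tprods.step[OF U(1)])
    \<comment> \<open>The cross term (U - 1) x is split as (U - 1 - y) x + y x: the first part is
      deep because the layers are right ideals, the second because \<open>y\<close> is in layer
      \<open>m\<close> and \<open>x\<close> in the radical.\<close>
    have "gmul B (U - gone B - y) x \<in> blowup t R n (prods_ge (Suc m))"
      using gmul_blowup[OF U(2), of x \<Gamma>gens "prods_ge (Suc m)"] gmul_prods_ge_\<Gamma>gens
        prods_blowup_\<Gamma>n[OF x''] unfolding \<Gamma>n_eq by blast
    moreover have "gmul B y x \<in> blowup t R n (prods_ge (Suc m))"
      using y x'' by (intro gmul_prods_ge_Suc) blast+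
    ultimately have "(U - gone B - y) + scl c (gmul B (U - gone B - y) x + gmul B y x)
        \<in> blowup t R n (prods_ge (Suc m))"
      by (intro blowup_closed(2)[OF U(2)] blowup_closed(5) blowup_closed(2)[of _ t R n _ "gmul B y x"])
    moreover have "gmul B U ?g - gone B - (scl c x + y)
        = (U - gone B - y) + scl c (gmul B (U - gone B - y) x + gmul B y x)"
      using supp_on_tprods[OF U(1)] supp_on_blowup[OF x']
      by (simp add: gmul_linear fun_eq_iff algebra_simps)
    ultimately have "\<exists>U\<in>tprods t R Ps n. U - gone B - (scl c x + y) \<in> blowup t R n (prods_ge (Suc m))"
      using U' by metis
    moreover have "scl c x + y \<in> blowup t R n (prods_ge m)"
      using y x' by (intro blowup_closed) blast+
    ultimately show "?h (scl c x + y)" by blast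
  qed
  then show ?thesis by blast
qed

text \<open>1 + N = (1 + K) U, where \<open>U\<close> is a word approximating 1 + N and
  \<open>K\<close> lies one layer deeper; induction on the layers left turns 1 + K into a
  word.\<close>

lemma unipotent_in_tprods:
  assumes "N \<in> blowup t R n (prods_ge m)"
  shows "gone B + N \<in> tprods t R Ps n"
  using assms
proof (induction "t - m" arbitrary: m N)
  case 0
  then have "N = 0" using blowup_subset_zero[OF prods_ge_zero[of m]] by simp
  then show ?case by (simp add: tprods.one)
next
  case (Suc d)
  obtain U where U: "U \<in> tprods t R Ps n" "U - gone B - N \<in> blowup t R n (prods_ge (Suc m))"
    using tprods_approx[OF Suc.prems] by blast
  obtain U' where U': "U' \<in> \<Gamma>n" "ginv B U U'" using tprods_inverse[OF U(1)] by blast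
  note supp = supp_on_tprods[OF U(1)] supp_on_blowup[OF Suc.prems] supp_on_\<Gamma>n[OF U'(1)]
  \<comment> \<open>Obtained by solving (1 + K) U = 1 + N, that is 1 + K = (1 + N) U', and inserting
    U U' = 1.\<close>
  let ?K = "- gmul B (U - gone B - N) U'"
  have "?K \<in> blowup t R n (prods_ge (Suc m))"
    using gmul_blowup[OF U(2), of U' \<Gamma>gens "prods_ge (Suc m)"] gmul_prods_ge_\<Gamma>gens U'(1)
    unfolding \<Gamma>n_eq by (intro blowup_closed) blast
  then have "gone B + ?K \<in> tprods t R Ps n"
    using Suc.hyps(2) by (intro Suc.hyps(1)[of "Suc m"]) simp_all
  then have "gmul B (gone B + ?K) U \<in> tprods t R Ps n" by (rule tprods_gmul[OF U(1)])
  moreover have "gmul B (gone B + ?K) U = gone B + N"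
  proof -
    have "gone B + ?K = gmul B (gone B + N) U'"
      using U'(2) supp by (simp add: gmul_linear ginv_def)
    then have "gmul B (gone B + ?K) U = gmul B (gone B + N) (gmul B U' U)"
      by (simp only: gmul_assoc)
    also have "\<dots> = gone B + N"
      using U'(2) supp by (simp add: ginv_def supp_on_add)
    finally show ?thesis .
  qed
  ultimately show ?case by simp
qed

lemma blockdiag_in_tprods:
  assumes I: "I \<in> classes t R" "\<forall>i\<in>I. n i = m" and "E \<in> elementary_products m"
  shows "blockdiag t n I E \<in> tprods t R Ps n"
  using assms(3)
proof (induction rule: elementary_products.induct)
  case one
  have "blockdiag t n I (gone {..<m}) = (gone B :: 'a bmat)"
    unfolding blockdiag_bdiag gone_bdiag using I(2) by (intro bdiag_cong) auto
  then show ?case by (simp add: tprods.one)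
next
  case (step S E)
  have "blockdiag t n I (gmul {..<m} S E) = gmul B (blockdiag t n I S) (blockdiag t n I E)"
    unfolding blockdiag_bdiag gmul_bdiag using I(2) by (intro bdiag_cong) auto
  moreover have "tgen t R Ps n (blockdiag t n I E)"
    unfolding tgen_def using I step.hyps(2) by blast
  ultimately show ?case using tprods.step[OF step.IH] by simp
qed

text \<open>The inverse is block diagonal too, so each block is invertible and Gaussian elimination
  applies to it; equal blocks within a class make the factors fit \<open>blockdiag\<close>.\<close>

lemma diag_in_tprods:
  assumes A: "A \<in> blowup t R n (eidems t R)" and A': "A' \<in> blowup t R n (eidems t R)"
    and inv: "ginv B A A'"
  shows "A \<in> tprods t R Ps n"
proof -
  define F where "F = (\<lambda>A i l r. (A :: 'a bmat) (i, l) (i, r))"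
  have bdiag: "A = bdiag t n (F A)" if A: "A \<in> blowup t R n (eidems t R)" for A
  proof (intro ext)
    fix x y
    have "\<forall>x\<in>eidems t R. \<forall>i j. (x :: 'a mat) i j \<noteq> 0 \<longrightarrow> i = j" using eidems_props(3) by blast
    note A' = blowup_subset[OF this A]
    show "A x y = bdiag t n (F A) x y"
      using A'(1) A'(2)[of "fst x" "snd x" "fst y" "snd y"]
      by (cases x, cases y) (auto simp: bdiag_def F_def supp_on_def)
  qed
  have inv_F: "gmul {..<n i} (F A i) (F A' i) = gone {..<n i}"
    if "i < t" "gmul B A A' = gone B" "A \<in> blowup t R n (eidems t R)" "A' \<in> blowup t R n (eidems t R)"
    for i A A'
  proof (intro ext)
    fix l r
    have "bdiag t n (\<lambda>i. gmul {..<n i} (F A i) (F A' i)) = bdiag t n (\<lambda>i. gone {..<n i})"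
      unfolding gmul_bdiag[symmetric] gone_bdiag[symmetric] using that bdiag by simp
    then have "bdiag t n (\<lambda>i. gmul {..<n i} (F A i) (F A' i)) (i, l) (i, r)
      = bdiag t n (\<lambda>i. gone {..<n i}) (i, l) (i, r)" by simp
    then show "gmul {..<n i} (F A i) (F A' i) l r = (gone {..<n i} l r :: 'a)"
      using that(1) by (cases "l < n i \<and> r < n i") (auto simp: bdiag_def bidx_def gmul_apply gone_def)
  qed
  have supp_F: "supp_on {..<n i} (F A i)" for i
    using supp_on_blowup[OF A] by (auto simp: supp_on_def F_def bidx_def)
  have elem: "F A i \<in> elementary_products (n i)" if "i < t" for i
    using inv_F[OF that _ A A'] inv_F[OF that _ A' A] inv supp_F
    by (intro invertible_elementary_products[where A' = "F A' i"]) (auto simp: ginv_def)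
  have F_eq: "F A i = F A k" if "I \<in> classes t R" "i \<in> I" "k \<in> I" for I i k
  proof -
    have "A \<in> \<Gamma>n" unfolding \<Gamma>n_eq using A blowup_mono[OF eidems_subset_\<Gamma>gens] by blast
    then have "A (i, l) (i, r) = A (k, l) (k, r)" for l r
      using classes_related[OF that] unfolding Gamma_n_def by blast
    then show ?thesis by (simp add: F_def)
  qed
  \<comment> \<open>Classes are treated one at a time: those in \<open>C\<close> carry the blocks of
    \<open>A\<close>, the others identities. By disjointness a new class meets only identity
    blocks.\<close>
  have part: "bdiag t n (\<lambda>i. if i \<in> \<Union>C then F A i else gone {..<n i}) \<in> tprods t R Ps n"
    if "finite C" "C \<subseteq> classes t R" for C
    using that
  proof (induction C rule: finite_induct)
    case empty
    then show ?case by (simp add: gone_bdiag[symmetric] tprods.one)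
  next
    case (insert I C)
    have I: "I \<in> classes t R" using insert.prems by simp
    obtain k where k: "k \<in> I" using classes_nonempty[OF I] by blast
    have disj: "i \<notin> \<Union>C" if "i \<in> I" for i
      using that insert.hyps(2) insert.prems classes_disjoint[OF I] by blast
    have n: "\<forall>i\<in>I. n i = n k" using step_const[OF I _ k] by blast
    have "blockdiag t n I (F A k) \<in> tprods t R Ps n"
      using I n elem[OF classes_less[OF I k]] by (rule blockdiag_in_tprods)
    moreover have "bdiag t n (\<lambda>i. if i \<in> \<Union>C then F A i else gone {..<n i}) \<in> tprods t R Ps n"
      using insert.IH insert.prems by simp
    ultimately have "gmul B (bdiag t n (\<lambda>i. if i \<in> \<Union>C then F A i else gone {..<n i}))
        (blockdiag t n I (F A k)) \<in> tprods t R Ps n" by (rule tprods_gmul)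
    moreover have "gmul B (bdiag t n (\<lambda>i. if i \<in> \<Union>C then F A i else gone {..<n i}))
        (blockdiag t n I (F A k)) = bdiag t n (\<lambda>i. if i \<in> \<Union>(insert I C) then F A i else gone {..<n i})"
      unfolding blockdiag_bdiag gmul_bdiag
    proof (rule bdiag_cong)
      fix i l r
      show "gmul {..<n i} (if i \<in> \<Union>C then F A i else gone {..<n i})
          (if i \<in> I then F A k else gone {..<n i}) l r
        = (if i \<in> \<Union>(insert I C) then F A i else gone {..<n i}) l r"
      proof (cases "i \<in> I")
        case True
        then have "F A k = F A i" using F_eq[OF I] k by blast
        then show ?thesis using True disj[OF True] supp_F[of i] by simp
      next
        case False
        then show ?thesis using supp_F[of i] by simp
      qed
    qed
    ultimately show ?case by simp
  qed
  have "bdiag t n (\<lambda>i. if i \<in> \<Union>(classes t R) then F A i else gone {..<n i}) = bdiag t n (F A)"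
  proof (rule bdiag_cong)
    fix i l r assume "i < t"
    then have "i \<in> \<Union>(classes t R)" using class_of by blast
    then show "(if i \<in> \<Union>(classes t R) then F A i else gone {..<n i}) l r = F A i l r"
      by (simp only: if_True)
  qed
  then show ?thesis using part[OF finite_classes] bdiag[OF A] by simp
qed

text \<open>With S = A + N and S' = A' + N', the product S S' is A A' + (A N' + N S'). The first
  term is block diagonal and the bracket strictly block upper, so comparing diagonal blocks gives A
  A' = 1.\<close>

lemma block_diag_part_gmul:
  assumes S: "S \<in> \<Gamma>n" and S': "S' \<in> \<Gamma>n" and inv: "gmul B S S' = gone B"
  shows "gmul B (block_diag_part S) (block_diag_part S') = gone B"
proof -
  let ?A = "block_diag_part S" and ?A' = "block_diag_part S'"
  let ?N = "S - block_diag_part S" and ?N' = "S' - block_diag_part S'"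
  note A = \<Gamma>n_decompose[OF S] and A' = \<Gamma>n_decompose[OF S']
  have "gmul B ?A ?N' + gmul B ?N S' \<in> blowup t R n (prods t Ps)"
  proof (rule blowup_closed)
    show "gmul B ?A ?N' \<in> blowup t R n (prods t Ps)"
      using A(1) A'(2) by (rule gmul_blowup) (rule gmul_eidems_prods)
    show "gmul B ?N S' \<in> blowup t R n (prods t Ps)"
      using A(2) S'[unfolded \<Gamma>n_eq] gmul_prods_ge_\<Gamma>gens[of _ 0] by (intro gmul_blowup) auto
  qed
  then have rad: "(gmul B ?A ?N' + gmul B ?N S') (i, l) (i, r) = 0" for i l r
    using blowup_subset(2)[where Q = "(<)" and X = "prods t Ps"] strict_prods by blast
  have AA: "gmul B ?A ?A' \<in> blowup t R n (eidems t R)"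
    using A(1) A'(1) by (rule gmul_blowup) (rule gmul_eidems_eidems)
  have diag: "gmul B ?A ?A' (i, l) (j, r) = 0" if "i \<noteq> j" for i l j r
    using blowup_subset(2)[OF _ AA, where Q = "(=)"] eidems_props(3) that by blast
  have eq: "gmul B S S' = gmul B ?A ?A' + (gmul B ?A ?N' + gmul B ?N S')"
    by (simp add: gmul_linear)
  show ?thesis
  proof (intro ext)
    fix x y :: "nat \<times> nat"
    obtain i a j b where xy: "x = (i, a)" "y = (j, b)" by (metis surj_pair)
    show "gmul B ?A ?A' x y = gone B x y"
    proof (cases "i = j")
      case True
      then have "gmul B S S' x y = gmul B ?A ?A' x y"
        unfolding eq plus_fun_apply[of "gmul B ?A ?A'"] using rad by (simp add: xy)
      then show ?thesis using inv by simp
    next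
      case False
      then show ?thesis using diag by (simp add: xy gone_def)
    qed
  qed
qed

theorem invertible_in_tprods:
  assumes S: "S \<in> \<Gamma>n" and S': "S' \<in> \<Gamma>n" and inv: "ginv B S S'"
  shows "S \<in> tprods t R Ps n"
proof -
  let ?A = "block_diag_part S" and ?A' = "block_diag_part S'"
  let ?N = "S - block_diag_part S"
  note A = \<Gamma>n_decompose[OF S] and A' = \<Gamma>n_decompose[OF S']
  have AA: "ginv B ?A ?A'"
    using block_diag_part_gmul[OF S S'] block_diag_part_gmul[OF S' S] inv by (simp add: ginv_def)
  \<comment> \<open>S = A + N = A (1 + A' N), and A' N is again in the radical because an idempotent
    times a product is that product or zero.\<close>
  have "gmul B ?A' ?N \<in> blowup t R n (prods_ge 0)"
    using A'(1) A(2) unfolding prods_ge.simps by (rule gmul_blowup) (rule gmul_eidems_prods)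
  then have "gmul B ?A (gone B + gmul B ?A' ?N) \<in> tprods t R Ps n"
    using diag_in_tprods[OF A(1) A'(1) AA] by (intro tprods_gmul unipotent_in_tprods)
  moreover have "gmul B ?A (gone B + gmul B ?A' ?N) = S"
  proof -
    have "gmul B ?A (gone B + gmul B ?A' ?N) = ?A + gmul B (gmul B ?A ?A') ?N"
      using supp_on_blowup[OF A(1)] by (simp add: gmul_linear gmul_assoc)
    moreover have "gmul B (gmul B ?A ?A') ?N = ?N"
      using AA supp_on_blowup[OF A(2)] by (simp add: ginv_def)
    ultimately show ?thesis by simp
  qed
  ultimately show ?thesis by simp
qed

text \<open>Conjugation by \<open>S g\<close> is conjugation by \<open>S\<close> followed by
  conjugation by \<open>g\<close>, so a word is carried out letter by letter from its left
  end.\<close>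

lemma tprods_steps:
  assumes "S \<in> tprods t R Ps n"
  shows "\<exists>S'. ginv B S S' \<and>
    (\<forall>A. supp_on B A \<longrightarrow> (tstep t R Ps n)\<^sup>*\<^sup>* A (gmul B (gmul B S' A) S))"
  using assms
proof (induction rule: tprods.induct)
  case one
  then show ?case by (intro exI[of _ "gone B"]) simp
next
  case (step S g)
  obtain S' where S': "ginv B S S'"
    "\<And>A. supp_on B A \<Longrightarrow> (tstep t R Ps n)\<^sup>*\<^sup>* A (gmul B (gmul B S' A) S)"
    using step.IH by blast
  obtain g' where g': "ginv B g g'" using tgen_inverse[OF step.hyps(2)] by blast
  have "ginv B (gmul B S g) (gmul B g' S')" using S'(1) g' by (intro ginv_gmul) simp_all
  moreover have "(tstep t R Ps n)\<^sup>*\<^sup>* A (gmul B (gmul B (gmul B g' S') A) (gmul B S g))"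
    if "supp_on B A" for A
  proof -
    have "sim_by t n g (gmul B (gmul B S' A) S) (gmul B (gmul B g' (gmul B (gmul B S' A) S)) g)"
      unfolding sim_by_iff using g' by blast
    then have "tstep t R Ps n (gmul B (gmul B S' A) S) (gmul B (gmul B g' (gmul B (gmul B S' A) S)) g)"
      unfolding tstep_iff using step.hyps(2) by blast
    with S'(2)[OF that] show ?thesis by (simp add: gmul_assoc)
  qed
  ultimately show ?case by blast
qed

section \<open>Similarity compared with chains of transformations\<close>

lemma Gamma_similar_iff: "Gamma_similar t (mat_vs.span \<Gamma>gens) R n M N \<longleftrightarrow>
    (\<exists>S\<in>\<Gamma>n. \<exists>S'\<in>\<Gamma>n. ginv B S S' \<and> N = gmul B (gmul B S' M) S)"
  unfolding Gamma_similar_def ginv_def bmat_as_generic by blast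

lemma Gamma_similar_sym:
  assumes "supp_on B M" "Gamma_similar t (mat_vs.span \<Gamma>gens) R n M N"
  shows "Gamma_similar t (mat_vs.span \<Gamma>gens) R n N M"
proof -
  obtain S S' where S: "S \<in> \<Gamma>n" "S' \<in> \<Gamma>n" "ginv B S S'" "N = gmul B (gmul B S' M) S"
    using assms(2) unfolding Gamma_similar_iff by blast
  have "gmul B (gmul B S N) S' = gmul B (gmul B (gmul B S S') M) (gmul B S S')"
    by (simp add: S(4) gmul_assoc)
  also have "\<dots> = M" using S(3) assms(1) by (simp add: ginv_def)
  finally show ?thesis
    unfolding Gamma_similar_iff using S(1-3) ginv_sym by metis
qed

lemma tsteps_Gamma_similar:
  assumes "(tstep t R Ps n)\<^sup>*\<^sup>* M N" "supp_on B M"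
  shows "Gamma_similar t (mat_vs.span \<Gamma>gens) R n M N"
  using assms(1)
proof (induction rule: rtranclp_induct)
  case base
  then show ?case
    unfolding Gamma_similar_iff using gone_\<Gamma>n assms(2) by (intro bexI[of _ "gone B"]) simp_all
next
  case (step N K)
  obtain S S' where S: "S \<in> \<Gamma>n" "S' \<in> \<Gamma>n" "ginv B S S'" "N = gmul B (gmul B S' M) S"
    using step.IH unfolding Gamma_similar_iff by blast
  obtain g g0 where g: "tgen t R Ps n g" "ginv B g g0" "K = gmul B (gmul B g0 N) g"
    using step.hyps(2) unfolding tstep_iff sim_by_iff by blast
  obtain g' where g': "g \<in> \<Gamma>n" "g' \<in> \<Gamma>n" "ginv B g g'" using tgen_inverse[OF g(1)] by blast
  \<comment> \<open>The step only supplies some inverse \<open>g0\<close>; it is exchanged for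
    \<open>g'\<close>, which lies in \<open>\<Gamma>n\<close>, without changing
    \<open>K\<close>.\<close>
  have "K = gmul B (gmul B g' N) g"
    unfolding g(3) using ginv_unique[OF _ g(2) g'(3)] by simp
  also have "\<dots> = gmul B (gmul B (gmul B g' S') M) (gmul B S g)"
    by (simp add: S(4) gmul_assoc)
  finally have "K = gmul B (gmul B (gmul B g' S') M) (gmul B S g)" .
  moreover have "ginv B (gmul B S g) (gmul B g' S')" using S(3) g'(3) by (intro ginv_gmul) simp_all
  ultimately show ?case
    unfolding Gamma_similar_iff using \<Gamma>n_gmul S(1,2) g'(1,2) by blast
qed

theorem triple_equiv_iff_Gamma_similar:
  assumes M: "supp_on B M" and N: "supp_on B N"
  shows "triple_equiv t R Ps n M N \<longleftrightarrow> Gamma_similar t (mat_vs.span \<Gamma>gens) R n M N"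
proof
  assume "triple_equiv t R Ps n M N"
  \<comment> \<open>\<open>triple_equiv\<close> allows the chain to start at either end; if it
    starts at \<open>N\<close>, symmetry of similarity turns the result around.\<close>
  then show "Gamma_similar t (mat_vs.span \<Gamma>gens) R n M N"
    unfolding triple_equiv_def
    using tsteps_Gamma_similar[OF _ M] tsteps_Gamma_similar[OF _ N] Gamma_similar_sym[OF N] by blast
next
  assume "Gamma_similar t (mat_vs.span \<Gamma>gens) R n M N"
  then obtain S S' where S: "S \<in> \<Gamma>n" "S' \<in> \<Gamma>n" "ginv B S S'" "N = gmul B (gmul B S' M) S"
    unfolding Gamma_similar_iff by blast
  obtain S0 where S0: "ginv B S S0" "(tstep t R Ps n)\<^sup>*\<^sup>* M (gmul B (gmul B S0 M) S)"
    using tprods_steps[OF invertible_in_tprods[OF S(1-3)]] M by blast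
  have "gmul B S0 M = gmul B S' M" using ginv_unique[OF _ S0(1) S(3)] by simp
  then show "triple_equiv t R Ps n M N"
    unfolding triple_equiv_def using S0(2) S(4) by simp
qed

end

section \<open>Passing between triples and linear matrix problems\<close>

theorem triple_to_problem:
  fixes Ps Vs :: "'a::field mat set"
  assumes "triple t R Ps Vs"
    and \<Gamma>: "\<Gamma> = gen_alg t (Ps \<union> {eidem I | I. I \<in> classes t R})" and M: "M = gen_bimod t Ps Vs"
  shows "basic_alg t \<Gamma>" "alg_rel t \<Gamma> R" "set_mult t \<Gamma> M \<subseteq> M" "set_mult t M \<Gamma> \<subseteq> M"
    and "step_seq t R n \<Longrightarrow> Mtr t R Ps Vs n = M_n t M R n"
    and "step_seq t R n \<Longrightarrow> A \<in> M_n t M R n \<Longrightarrow> B \<in> M_n t M R n \<Longrightarrow>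
      triple_equiv t R Ps n A B \<longleftrightarrow> Gamma_similar t \<Gamma> R n A B"
proof -
  interpret matrix_triple t R Ps Vs by unfold_locales (fact assms(1))
  show "basic_alg t \<Gamma>" "alg_rel t \<Gamma> R"
    using basic_alg_\<Gamma> alg_rel_\<Gamma> by (simp_all only: \<Gamma> gen_alg_eq)
  show "set_mult t \<Gamma> M \<subseteq> M" "set_mult t M \<Gamma> \<subseteq> M"
    using set_mult_\<Gamma> by (simp_all only: \<Gamma> M gen_alg_eq gen_bimod_eq)
  assume "step_seq t R n"
  then interpret blown_triple t R Ps Vs n by unfold_locales
  show "Mtr t R Ps Vs n = M_n t M R n" unfolding M gen_bimod_eq by (rule Mtr_eq_M_n)
  show "triple_equiv t R Ps n A B \<longleftrightarrow> Gamma_similar t \<Gamma> R n A B"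
    if "A \<in> M_n t M R n" "B \<in> M_n t M R n"
    unfolding \<Gamma> gen_alg_eq using that
    by (intro triple_equiv_iff_Gamma_similar) (simp_all add: M_n_def bmat_as_generic)
qed

section \<open>Cutting matrices into class blocks\<close>

lemma (in index_classes) sum_class_blocks:
  fixes X :: "'a::field mat"
  assumes "supp_on {..<t} X"
  shows "X = (\<Sum>(I, J)\<in>classes t R \<times> classes t R. (\<lambda>i j. if i \<in> I \<and> j \<in> J then X i j else 0))"
proof (intro ext)
  fix i j
  let ?K = "classes t R \<times> classes t R" and ?k = "(R `` {i}, R `` {j})"
  show "X i j = (\<Sum>(I, J)\<in>?K. (\<lambda>i j. if i \<in> I \<and> j \<in> J then X i j else 0)) i j"
  proof (cases "i < t \<and> j < t")
    case True
    have "(case k of (I, J) \<Rightarrow> (\<lambda>i j. if i \<in> I \<and> j \<in> J then X i j else 0)) i j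
        = (if k = ?k then X i j else 0)" if "k \<in> ?K" for k
    proof -
      obtain I J where k: "k = (I, J)" by (metis surj_pair)
      then have IJ: "I \<in> classes t R" "J \<in> classes t R" using that by auto
      then have "i \<in> I \<longleftrightarrow> I = R `` {i}" "j \<in> J \<longleftrightarrow> J = R `` {j}"
        using True class_of classes_disjoint by blast+
      then show ?thesis by (simp add: k)
    qed
    then have "(\<Sum>(I, J)\<in>?K. (\<lambda>i j. if i \<in> I \<and> j \<in> J then X i j else 0)) i j
      = (\<Sum>k\<in>?K. if k = ?k then X i j else 0)"
      unfolding sum_apply2 by (rule sum.cong[OF refl])
    also have "\<dots> = X i j" using True class_of finite_classes by simp
    finally show ?thesis by simp
  next
    case False
    then have "X i j = 0" using assms by (auto simp: supp_on_def)
    moreover have "(case k of (I, J) \<Rightarrow> (\<lambda>i j. if i \<in> I \<and> j \<in> J then X i j else 0)) i j = 0" for k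
      using \<open>X i j = 0\<close> by (cases k) simp
    ultimately show ?thesis by (simp add: sum_apply2)
  qed
qed

lemma (in index_classes) eidem_sandwich:
  fixes X :: "'a::field mat"
  assumes "supp_on {..<t} X" "I \<in> classes t R" "J \<in> classes t R"
  shows "mmult t (mmult t (eidem I) X) (eidem J) = (\<lambda>i j. if i \<in> I \<and> j \<in> J then X i j else 0)"
proof -
  have sub: "I \<subseteq> {..<t}" "J \<subseteq> {..<t}" using assms(2,3) classes_less by auto
  have "gmul {..<t} (gmul {..<t} (eidem I) X) (eidem J)
      = (\<lambda>i j. if j \<in> J then gmul {..<t} (eidem I) X i j else 0)"
    by (rule gmul_eidem_right[OF _ _ sub(2)]) simp_all
  also have "\<dots> = (\<lambda>i j. if i \<in> I \<and> j \<in> J then X i j else 0)"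
    unfolding gmul_eidem_left[OF finite_lessThan assms(1) sub(1)] by (intro ext) simp
  finally show ?thesis by (simp only: mat_as_generic)
qed

text \<open>With \<open>eidem_sandwich\<close> this joins bases chosen separately for each pair of
  classes into a spanning set of the whole space.\<close>

lemma (in index_classes) class_blocks_in_subspace:
  fixes X :: "'a::field mat"
  assumes "supp_on {..<t} X"
    and "\<And>I J. I \<in> classes t R \<Longrightarrow> J \<in> classes t R \<Longrightarrow>
      (\<lambda>i j. if i \<in> I \<and> j \<in> J then X i j else 0) \<in> mat_vs.span Y"
  shows "X \<in> mat_vs.span Y"
proof -
  have "(\<Sum>(I, J)\<in>classes t R \<times> classes t R. (\<lambda>i j. if i \<in> I \<and> j \<in> J then X i j else 0))
      \<in> mat_vs.span Y"
  proof (rule mat_vs.span_sum)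
    fix k assume "k \<in> classes t R \<times> classes t R"
    then obtain I J where k: "k = (I, J)" "I \<in> classes t R" "J \<in> classes t R" by blast
    show "(case k of (I, J) \<Rightarrow> \<lambda>i j. if i \<in> I \<and> j \<in> J then X i j else 0) \<in> mat_vs.span Y"
      unfolding k(1) prod.case by (rule assms(2)[OF k(2,3)])
  qed
  then show ?thesis by (simp only: sum_class_blocks[OF assms(1), symmetric])
qed

lemma span_UN_superset:
  "I \<in> C \<Longrightarrow> J \<in> C \<Longrightarrow> mat_vs.span (F I J) \<subseteq> mat_vs.span (\<Union>I\<in>C. \<Union>J\<in>C. F I J)"
  by (intro mat_vs.span_mono) blast

text \<open>Upper triangular with zero diagonal means strictly upper, which gives nilpotence. The
  chosen matrices, with the idempotents in the case of \<Gamma>, already span \<Gamma> and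
  \<open>M\<close> linearly; as \<Gamma> and \<open>M\<close> are closed under the multiplications
  in question, generation adds nothing beyond them.\<close>

theorem problem_to_triple:
  fixes \<Gamma> M :: "'a::field mat set"
  assumes lmp: "lmp t \<Gamma> M R"
    and BP: "\<And>I J. I \<in> classes t R \<Longrightarrow> J \<in> classes t R \<Longrightarrow>
      is_basis (BP I J) {mmult t (mmult t (eidem I) X) (eidem J) | X. X \<in> \<Gamma> \<and> diag_part X = (\<lambda>i j. 0)}"
    and BV: "\<And>I J. I \<in> classes t R \<Longrightarrow> J \<in> classes t R \<Longrightarrow>
      is_basis (BV I J) {mmult t (mmult t (eidem I) X) (eidem J) | X. X \<in> M}"
    and Ps: "Ps = (\<Union>I\<in>classes t R. \<Union>J\<in>classes t R. BP I J)"
    and Vs: "Vs = (\<Union>I\<in>classes t R. \<Union>J\<in>classes t R. BV I J)"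
  shows "triple t R Ps Vs" "\<Gamma> = gen_alg t (Ps \<union> {eidem I | I. I \<in> classes t R})"
    "M = gen_bimod t Ps Vs"
proof -
  have alg: "msubalg t \<Gamma>" "\<And>S. S \<in> \<Gamma> \<Longrightarrow> upper_tri S" "\<And>S. S \<in> \<Gamma> \<Longrightarrow> diag_part S \<in> \<Gamma>"
    using lmp unfolding lmp_def basic_alg_def by blast+
  have rel: "equiv {..<t} R" "{E\<in>\<Gamma>. is_diagonal E} = mat_vs.span (eidems t R)"
    using lmp unfolding lmp_def alg_rel_def lspan_eq_span eidems_def by blast+
  have mod: "msubspace t M" "set_mult t \<Gamma> M \<subseteq> M" "set_mult t M \<Gamma> \<subseteq> M"
    using lmp unfolding lmp_def by blast+
  interpret index_classes t R by unfold_locales (fact rel(1))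
  have supp: "supp_on {..<t} S" if "S \<in> \<Gamma>" for S
    using alg(1) that unfolding msubalg_def msubspace_iff mat_as_generic by blast
  have suppM: "supp_on {..<t} X" if "X \<in> M" for X
    using mod(1) that unfolding msubspace_iff mat_as_generic by blast
  have eid: "eidem I \<in> \<Gamma>" if "I \<in> classes t R" for I
  proof -
    have "eidem I \<in> eidems t R" using that unfolding eidems_def by blast
    then show ?thesis using rel(2) mat_vs.span_base by blast
  qed
  have mult: "mmult t S S' \<in> \<Gamma>" if "S \<in> \<Gamma>" "S' \<in> \<Gamma>" for S S'
    using alg(1) that unfolding msubalg_def by blast
  have multM: "mmult t S X \<in> M" "mmult t X S \<in> M" if "S \<in> \<Gamma>" "X \<in> M" for S X
    using mod(2,3) that unfolding set_mult_def by blast+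

  have P_props: "finite (BP I J)" "mat_vs.span (BP I J) = {mmult t (mmult t (eidem I) X) (eidem J) | X.
      X \<in> \<Gamma> \<and> diag_part X = (\<lambda>i j. 0)}" if "I \<in> classes t R" "J \<in> classes t R" for I J
    using BP[OF that] unfolding is_basis_def lin_indep_def lspan_eq_span by blast+
  have V_props: "finite (BV I J)" "mat_vs.span (BV I J) = {mmult t (mmult t (eidem I) X) (eidem J) | X.
      X \<in> M}" if "I \<in> classes t R" "J \<in> classes t R" for I J
    using BV[OF that] unfolding is_basis_def lin_indep_def lspan_eq_span by blast+
  have P: "P \<in> \<Gamma> \<and> (\<forall>i j. P i j \<noteq> 0 \<longrightarrow> i < j) \<and> links_some t R P" if "P \<in> Ps" for P
  proof -
    obtain I J where IJ: "I \<in> classes t R" "J \<in> classes t R" "P \<in> BP I J"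
      using \<open>P \<in> Ps\<close> unfolding Ps by blast
    have "P \<in> mat_vs.span (BP I J)" using IJ(3) by (rule mat_vs.span_base)
    then obtain X where X: "P = mmult t (mmult t (eidem I) X) (eidem J)" "X \<in> \<Gamma>"
      "diag_part X = (\<lambda>i j. 0)"
      unfolding P_props(2)[OF IJ(1,2)] by blast
    have P: "P = (\<lambda>i j. if i \<in> I \<and> j \<in> J then X i j else 0)"
      unfolding X(1) by (rule eidem_sandwich[OF supp[OF X(2)] IJ(1,2)])
    have "X i i = 0" for i using fun_cong[OF fun_cong[OF X(3), of i], of i] by (simp add: diag_part_def)
    moreover have "i \<le> j" if "X i j \<noteq> 0" for i j using alg(2)[OF X(2)] that by (simp add: upper_tri_def)
    ultimately have "i < j" if "P i j \<noteq> 0" for i j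
      using that unfolding P by (metis le_neq_implies_less)
    moreover have "P \<in> \<Gamma>" unfolding X(1) using IJ X(2) by (intro mult eid)
    moreover have "links I J P" by (simp add: links_def P)
    ultimately show ?thesis unfolding links_some_def using IJ(1,2) by blast
  qed
  have V: "V \<in> M \<and> links_some t R V" if "V \<in> Vs" for V
  proof -
    obtain I J where IJ: "I \<in> classes t R" "J \<in> classes t R" "V \<in> BV I J"
      using \<open>V \<in> Vs\<close> unfolding Vs by blast
    have "V \<in> mat_vs.span (BV I J)" using IJ(3) by (rule mat_vs.span_base)
    then obtain X where X: "V = mmult t (mmult t (eidem I) X) (eidem J)" "X \<in> M"
      unfolding V_props(2)[OF IJ(1,2)] by blast
    have "links I J V"
      unfolding X(1) eidem_sandwich[OF suppM[OF X(2)] IJ(1,2)] by (simp add: links_def)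
    moreover have "V \<in> M" unfolding X(1) using IJ X(2) by (intro multM eid)
    ultimately show ?thesis unfolding links_some_def using IJ(1,2) by blast
  qed

  show triple: "triple t R Ps Vs"
    unfolding triple_def mat_as_generic
  proof (intro conjI ballI)
    show "finite Ps" "finite Vs"
      unfolding Ps Vs using finite_classes P_props(1) V_props(1) by auto
    fix P assume "P \<in> Ps"
    note P' = P[OF this]
    show "supp_on {..<t} P" "links_some t R P" using P' supp by blast+
    show "upper_tri P" using P' alg(2) by blast
    show "nilpotent t P" using P' by (intro nilpotent_strictly_upper) blast
  next
    fix V assume "V \<in> Vs"
    then show "supp_on {..<t} V" "links_some t R V" using V suppM by blast+
  qed (fact rel(1))

  interpret matrix_triple t R Ps Vs by unfold_locales (fact triple)
  show "\<Gamma> = gen_alg t (Ps \<union> {eidem I | I. I \<in> classes t R})"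
  proof
    show "gen_alg t (Ps \<union> {eidem I | I. I \<in> classes t R}) \<subseteq> \<Gamma>"
      unfolding gen_alg_def using alg(1) P eid by blast
    show "\<Gamma> \<subseteq> gen_alg t (Ps \<union> {eidem I | I. I \<in> classes t R})"
    proof
      fix S assume S: "S \<in> \<Gamma>"
      have "is_diagonal (diag_part S)" by (simp add: is_diagonal_def diag_part_def)
      then have "diag_part S \<in> mat_vs.span (eidems t R)" using rel(2) alg(3)[OF S] by blast
      then have diag: "diag_part S \<in> mat_vs.span \<Gamma>gens"
        using mat_vs.span_mono[OF eidems_subset_\<Gamma>gens] by blast
      let ?N = "S - diag_part S"
      have "mat_vs.subspace \<Gamma>" using alg(1) unfolding msubalg_def msubspace_iff by blast
      \<comment> \<open>Closure of a basic algebra under diagonal parts enters here: it keeps the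
        zero-diagonal remainder of \<open>S\<close> inside \<Gamma>, where the bases
        \<open>BP\<close> reach it.\<close>
      then have N: "?N \<in> \<Gamma>" using S alg(3)[OF S] by (rule mat_vs.subspace_diff)
      have "diag_part ?N = (\<lambda>i j. 0)" by (simp add: diag_part_def fun_eq_iff)
      then have "mmult t (mmult t (eidem I) ?N) (eidem J) \<in> mat_vs.span Ps"
        if "I \<in> classes t R" "J \<in> classes t R" for I J
        using span_UN_superset[OF that, of BP] N unfolding P_props(2)[OF that] Ps by blast
      then have "(\<lambda>i j. if i \<in> I \<and> j \<in> J then ?N i j else 0) \<in> mat_vs.span Ps"
        if "I \<in> classes t R" "J \<in> classes t R" for I J
        unfolding eidem_sandwich[OF supp[OF N] that, symmetric] using that by blast
      then have "?N \<in> mat_vs.span Ps"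
        by (rule class_blocks_in_subspace[OF supp[OF N]])
      moreover have "Ps \<subseteq> \<Gamma>gens" using prods.base unfolding \<Gamma>gens_def by blast
      ultimately have "?N \<in> mat_vs.span \<Gamma>gens" using mat_vs.span_mono by blast
      with diag have "diag_part S + ?N \<in> mat_vs.span \<Gamma>gens" by (rule mat_vs.span_add)
      then show "S \<in> gen_alg t (Ps \<union> {eidem I | I. I \<in> classes t R})"
        unfolding gen_alg_eq by simp
    qed
  qed
  show "M = gen_bimod t Ps Vs"
  proof
    show "gen_bimod t Ps Vs \<subseteq> M"
      unfolding gen_bimod_def
    proof (rule Inter_lower, intro CollectI conjI ballI)
      show "mmult t P' X \<in> M" "mmult t X P' \<in> M" if "P' \<in> Ps" "X \<in> M" for P' X
        using multM[of P' X] P[OF that(1)] that(2) by auto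
    qed (use mod(1) V in auto)
    show "M \<subseteq> gen_bimod t Ps Vs"
    proof
      fix X assume X: "X \<in> M"
      have "(\<lambda>i j. if i \<in> I \<and> j \<in> J then X i j else 0) \<in> mat_vs.span Vs"
        if "I \<in> classes t R" "J \<in> classes t R" for I J
        using span_UN_superset[OF that, of BV] X
        unfolding eidem_sandwich[OF suppM[OF X] that, symmetric] V_props(2)[OF that] Vs by blast
      then have "X \<in> mat_vs.span Vs"
        by (rule class_blocks_in_subspace[OF suppM[OF X]])
      moreover have "mat_vs.span Vs \<subseteq> gen_bimod t Ps Vs"
        unfolding gen_bimod_def
      proof (rule Inter_greatest)
        fix S assume "S \<in> {S. msubspace t S \<and> Vs \<subseteq> S \<and>
          (\<forall>P\<in>Ps. \<forall>X\<in>S. mmult t P X \<in> S \<and> mmult t X P \<in> S)}"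
        then have "Vs \<subseteq> S" "mat_vs.subspace S" unfolding msubspace_iff by blast+
        then show "mat_vs.span Vs \<subseteq> S" by (rule mat_vs.span_minimal)
      qed
      ultimately show "X \<in> gen_bimod t Ps Vs" by blast
    qed
  qed
qed

theorem theorem2p1:
  fixes t :: nat
  assumes alg_closed: "\<forall>p :: 'a::field poly. 0 < degree p \<longrightarrow> (\<exists>x. poly p x = 0)"
  shows
   "(\<forall>R (Ps :: 'a mat set) Vs. triple t R Ps Vs \<longrightarrow>
      (let \<Gamma> = gen_alg t (Ps \<union> {eidem I | I. I \<in> classes t R});
           M = gen_bimod t Ps Vs in
        basic_alg t \<Gamma> \<and> alg_rel t \<Gamma> R \<and>
        set_mult t \<Gamma> M \<subseteq> M \<and> set_mult t M \<Gamma> \<subseteq> M \<and>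
        (\<forall>n. step_seq t R n \<longrightarrow>
           Mtr t R Ps Vs n = M_n t M R n \<and>
           (\<forall>A\<in>M_n t M R n. \<forall>B\<in>M_n t M R n.
              triple_equiv t R Ps n A B \<longleftrightarrow> Gamma_similar t \<Gamma> R n A B))))
    \<and>
    (\<forall>(\<Gamma> :: 'a mat set) M R Ps Vs. lmp t \<Gamma> M R \<longrightarrow>
      (\<exists>BP BV. (\<forall>I\<in>classes t R. \<forall>J\<in>classes t R.
          is_basis (BP I J) {mmult t (mmult t (eidem I) X) (eidem J) | X.
                               X \<in> \<Gamma> \<and> diag_part X = (\<lambda>i j. 0)} \<and>
          is_basis (BV I J) {mmult t (mmult t (eidem I) X) (eidem J) | X. X \<in> M}) \<and>
        Ps = (\<Union>I\<in>classes t R. \<Union>J\<in>classes t R. BP I J) \<and>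
        Vs = (\<Union>I\<in>classes t R. \<Union>J\<in>classes t R. BV I J)) \<longrightarrow>
      triple t R Ps Vs \<and>
      (\<forall>n. step_seq t R n \<longrightarrow>
         Mtr t R Ps Vs n = M_n t M R n \<and>
         (\<forall>A\<in>M_n t M R n. \<forall>B\<in>M_n t M R n.
            triple_equiv t R Ps n A B \<longleftrightarrow> Gamma_similar t \<Gamma> R n A B)))"
  (is "?a \<and> ?b")
proof
  show ?a
    unfolding Let_def by (intro allI impI conjI ballI triple_to_problem[OF _ refl refl])
  show ?b
  proof (intro allI impI, elim exE conjE)
    fix \<Gamma> M :: "'a mat set" and R Ps Vs BP BV
    assume lmp: "lmp t \<Gamma> M R"
      and bases: "\<forall>I\<in>classes t R. \<forall>J\<in>classes t R.
          is_basis (BP I J) {mmult t (mmult t (eidem I) X) (eidem J) | X.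
                               X \<in> \<Gamma> \<and> diag_part X = (\<lambda>i j. 0)} \<and>
          is_basis (BV I J) {mmult t (mmult t (eidem I) X) (eidem J) | X. X \<in> M}"
      and Ps: "Ps = (\<Union>I\<in>classes t R. \<Union>J\<in>classes t R. BP I J)"
      and Vs: "Vs = (\<Union>I\<in>classes t R. \<Union>J\<in>classes t R. BV I J)"
    have BP: "is_basis (BP I J) {mmult t (mmult t (eidem I) X) (eidem J) | X.
                               X \<in> \<Gamma> \<and> diag_part X = (\<lambda>i j. 0)}"
      and BV: "is_basis (BV I J) {mmult t (mmult t (eidem I) X) (eidem J) | X. X \<in> M}"
      if "I \<in> classes t R" "J \<in> classes t R" for I J
      using bases that by simp_all
    note prob = problem_to_triple[OF lmp BP BV Ps Vs]
    show "triple t R Ps Vs \<and> (\<forall>n. step_seq t R n \<longrightarrow>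
         Mtr t R Ps Vs n = M_n t M R n \<and>
         (\<forall>A\<in>M_n t M R n. \<forall>B\<in>M_n t M R n.
            triple_equiv t R Ps n A B \<longleftrightarrow> Gamma_similar t \<Gamma> R n A B))"
      using prob(1) triple_to_problem(5,6)[OF prob] by simp
  qed
qed

end
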